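(* For each $j=0,1,2$, the irreducible $U'_q(\widehat{\mathfrak{sp}}_4)$-module $\mathcal V(j)$ is a highest weight module of highest weight $\Lambda_j$ (the $j$-th fundamental weight of $\widehat{\mathfrak{sp}}_4$). The highest weight vectors are $$v_{2\Lambda_0}\otimes v(0)\in\mathcal V(0),\qquad v_{\Lambda_0+\Lambda_1}\otimes v(-\tfrac12)\in\mathcal V(1),\qquad v_{2\Lambda_0}\otimes v(-1)\in\mathcal V(2),$$ where the weights appearing in these vectors are weights of $\widehat{\mathfrak{sl}}_2$.
   Context: $q$ is generic (an indeterminate), the base field is $\mathbf{C}(q)$ (with $q^{1/2}$ adjoined if needed), $[n]=(q^n-q^{-n})/(q-q^{-1})$, $\delta(z)=\sum_{k\in\mathbf Z}z^k$, $[a,b]_v=ab-v\,ba$. **$U'_q(\widehat{\mathfrak{sp}}_4)$.** The quantum affine algebra of type $C_2^{(1)}$ with Chevalley generators $e_i,f_i,t_i^{\pm1}$ ($i=0,1,2$), $t_i=q_i^{h_i}$, $q_0=q_2=q^2$, $q_1=q$, and canonical central element $c=h_0+h_1+h_2$. Let $a_{1,1}=a_{2,2}=2$, $a_{1,2}=-2$, $a_{2,1}=-1$, $[n]_i=(q_i^n-q_i^{-n})/(q_i-q_i^{-1})$. Its Drinfeld generators are $x_i^\pm(k)$ ($k\in\mathbf Z$), $a_i(l)$ ($l\neq0$), $K_i^{\pm1}$, $\gamma^{\pm1/2}$ ($i=1,2$). With $X_i^\pm(z)=\sum_kx_i^\pm(k)z^{-k-1}$ the defining relations are: $\gamma^{\pm1/2}$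 central; the $K_i$ commute and are invertible; $[a_i(k),a_j(l)]=\delta_{k+l,0}\frac{[a_{i,j}k]_i}{k}\frac{\gamma^k-\gamma^{-k}}{q_j-q_j^{-1}}$; $K_ja_i(k)K_j^{-1}=a_i(k)$; $K_jX_i^\pm(z)K_j^{-1}=q_i^{\pm a_{i,j}}X_i^\pm(z)$; $[a_i(k),X_j^\pm(z)]=\pm\frac{[a_{i,j}k]_i}{k}\gamma^{\mp|k|/2}z^kX_j^\pm(z)$; $(z-q_i^{\pm a_{i,j}}w)X_i^\pm(z)X_j^\pm(w)+(w-q_i^{\pm a_{i,j}}z)X_j^\pm(w)X_i^\pm(z)=0$; $[X_i^+(z),X_j^-(w)]=\frac{\delta_{i,j}}{q_i-q_i^{-1}}\big(K_i\exp\{(q_i-q_i^{-1})\sum_{k\ge1}a_i(k)\gamma^{k/2}z^{-k}\}\frac{\delta(z/\gamma w)}{zw}-K_i^{-1}\exp\{-(q_i-q_i^{-1})\sum_{k\ge1}a_i(-k)\gamma^{k/2}z^k\}\frac{\delta(\gamma z/w)}{zw}\big)$; and, with Sym the sum over permutations of the $z$ variables, $\mathrm{Sym}_{z_1,z_2,z_3}\big(X_2^\pm(w)X_1^\pm(z_1)X_1^\pm(z_2)X_1^\pm(z_3)-[3]_1X_1^\pm(z_1)X_2^\pm(w)X_1^\pm(z_2)X_1^\pm(z_3)+[3]_1X_1^\pm(z_1)X_1^\pm(z_2)X_2^\pm(w)X_1^\pm(z_3)-X_1^\pm(z_1)X_1^\pm(z_2)X_1^\pm(z_3)X_2^\pm(w)\big)=0$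 and $\mathrm{Sym}_{z_1,z_2}\big(X_1^\pm(w)X_2^\pm(z_1)X_2^\pm(z_2)-[2]_2X_2^\pm(z_1)X_1^\pm(w)X_2^\pm(z_2)+X_2^\pm(z_1)X_2^\pm(z_2)X_1^\pm(w)\big)=0$. Identification at level 1 ($\gamma=q^2$): $t_1=K_1$, $t_2=K_2$, $t_0=\gamma(K_1^2K_2)^{-1}$, $e_1=x_1^+(0)$, $e_2=x_2^+(0)$, $e_0=q^2[x_1^-(0),[x_2^-(0),x_1^-(1)]_{q^{-2}}]_1K_1^{-2}K_2^{-1}$. A highest weight vector of weight $\Lambda_j$ is a generating vector $v$ with $e_iv=0$ and $t_iv=q_i^{\delta_{ij}}v$ for $i=0,1,2$. **$U_q(\widehat{\mathfrak{sl}}_2)$.** Drinfeld–Jimbo generators $e_i,f_i,t_i^{\pm1}=q^{\pm h_i}$ ($i=0,1$), $q^{\pm d}$, with $[e_i,f_j]=\delta_{ij}(t_i-t_i^{-1})/(q-q^{-1})$; $U'_q(\widehat{\mathfrak{sl}}_2)$ is the subalgebra without $q^{\pm d}$. Drinfeld generators $x^\pm(k)$, $a(l)$, $K^{\pm1}$, $\gamma^{\pm1/2}$, $X^\pm(z)=\sum_kx^\pm(k)z^{-k-1}$, satisfy: $\gamma^{\pm1/2}$ central; $[a(k),a(l)]=\delta_{k+l,0}\frac{[2k]}{k}\frac{\gamma^k-\gamma^{-k}}{q-q^{-1}}$; $Ka(k)K^{-1}=a(k)$; $KX^\pm(z)K^{-1}=q^{\pm2}X^\pm(z)$; $[a(k),X^\pm(z)]=\pm\frac{[2k]}{k}\gamma^{\mp|k|/2}z^kX^\pm(z)$;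 $(z-q^{\pm2}w)X^\pm(z)X^\pm(w)+(w-q^{\pm2}z)X^\pm(w)X^\pm(z)=0$; $[X^+(z),X^-(w)]=K\exp\{(q-q^{-1})\sum_{k\ge1}a(k)\gamma^{k/2}z^{-k}\}\frac{\delta(z/\gamma w)}{(q-q^{-1})zw}-K^{-1}\exp\{-(q-q^{-1})\sum_{k\ge1}a(-k)\gamma^{k/2}z^k\}\frac{\delta(\gamma z/w)}{(q-q^{-1})zw}$. Identification: $K=t_1$, $\gamma=t_0t_1$, $x^+(0)=e_1$, $x^-(0)=f_1$, $x^+(-1)=t_0f_0$, $x^-(1)=e_0t_0^{-1}$. $V(\lambda)$ is the irreducible highest weight module with highest weight vector $v_\lambda$; only the level 2 weights $2\Lambda_0,\Lambda_0+\Lambda_1,2\Lambda_1$ are used, so $\gamma=q^2$, $\gamma^{1/2}=q$. $\sigma$ exchanges $\Lambda_0,\Lambda_1$, and $\sigma:V(\lambda)\to V(\sigma\lambda)$ is linear with $\sigma v_\lambda=v_{\sigma\lambda}$, $\sigma f_i=f_{1-i}\sigma$. With $\exp_{q^{-1}}(x)=\sum_{n\ge0}\frac{q^{-n(n-1)/2}}{[n]!}x^n$, $S_0=\exp_{q^{-1}}(q^{-1}e_0t_0^{-1})\exp_{q^{-1}}(-f_0)\exp_{q^{-1}}(qe_0t_0)q^{h_0(h_0+1)/2}$, and $D^{\frac12}=S_0t_0^{-1}\sigma:V(\lambda)\to V(\sigma\lambda)$, with inverse $D^{-\frac12}$. **Vertex operators.** As maps $V(\lambda)\to V(\sigma\lambda)$: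 $\Phi_0^{(2)}(z)=\exp(\sum_{k\ge1}\frac{q^k}{[2k]}a(-k)z^k)\exp(-\sum_{k\ge1}\frac{q^k}{[2k]}a(k)z^{-k})D^{\frac12}z^{\frac12h_1}$, $\Psi_2^{(2)}(z)=\exp(-\sum_{k\ge1}\frac{q^{-k}}{[2k]}a(-k)(q^2z)^k)\exp(\sum_{k\ge1}\frac{q^{-k}}{[2k]}a(k)(q^2z)^{-k})D^{-\frac12}(q^2z)^{-\frac12h_1}$. **Heisenberg part.** $\mathcal B'$ is generated by $b(k)$, $k\in\mathbf Z$, with $[b(k),b(l)]=\delta_{k+l,0}\frac1k(q^{2k}-1+q^{-2k})$ ($k\ne0$), $[b(0),b(k)]=0$. $\mathcal V_p$ ($p\in\frac12\mathbf Z$) is the Fock module with vacuum $v(p)$: $b(k)v(p)=0$ for $k>0$, $b(0)v(p)=p\,v(p)$. $T^r:\mathcal V_p\to\mathcal V_{p+r}$ commutes with $b(k)$, $k\ne0$, and $T^rv(p)=v(p+r)$. Put $\Omega_0(z)=\exp(\sum_{k\ge1}b(-k)q^kz^k)\exp(-\sum_{k\ge1}b(k)q^kz^{-k})T^1z^{b(0)}$, $\Omega_2(z)=\exp(-\sum_{k\ge1}b(-k)q^{-k}z^k)\exp(\sum_{k\ge1}b(k)q^{-k}z^{-k})T^{-1}z^{-b(0)}$, $Y^+(z)=\Psi_2^{(2)}(q^{-2}z)\otimes\Omega_2(z)$, $Y^-(z)=\Phi_0^{(2)}(z)\otimes\Omega_0(z)$. **Spaces and action.** $\mathcal V(0)=(V(2\Lambda_0)\otimes\bigoplus_{p\in2\mathbf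 Z}\mathcal V_p)\oplus(V(2\Lambda_1)\otimes\bigoplus_{p\in2\mathbf Z}\mathcal V_{p+1})$; $\mathcal V(1)=V(\Lambda_0+\Lambda_1)\otimes\bigoplus_{p\in\mathbf Z}\mathcal V_{p+\frac12}$; $\mathcal V(2)=(V(2\Lambda_0)\otimes\bigoplus_{p\in2\mathbf Z}\mathcal V_{p+1})\oplus(V(2\Lambda_1)\otimes\bigoplus_{p\in2\mathbf Z}\mathcal V_p)$. $U'_q(\widehat{\mathfrak{sp}}_4)$ acts on $\mathcal V(j)$ by $\gamma^{1/2}\mapsto q$, $X_1^\pm(z)\mapsto X^\pm(z)$, $X_2^\pm(z)\mapsto Y^\pm(z)$, $a_1(\pm k)\mapsto a(\pm k)$, $a_2(\pm k)\mapsto-\frac1{[2]}(a(\pm k)+[2k]b(\pm k))$ ($k\ge1$), $K_1\mapsto K$, $K_2\mapsto(q^{2b(0)}K)^{-1}$; this is a well-defined action under which $\mathcal V(j)$ is irreducible. *)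

theory Defs
  imports
    Complex_Main
    "HOL-Library.Multiset"
    "HOL-Library.Poly_Mapping"
    "HOL-Computational_Algebra.Polynomial"
    "HOL-Computational_Algebra.Fraction_Field"
begin

section \<open>The base field\<close>

text \<open>
  No square root of \<open>q\<close> is needed: only level-2 modules of the affine \<open>sl\<^sub>2\<close> algebra occur, on which
  \<open>\<gamma>\<^sup>1\<^sup>/\<^sup>2\<close> acts as \<open>q\<close>, and all other exponents of \<open>q\<close> below are integers.
\<close>

type_synonym cq = "complex poly fract"

definition q :: cq where
  "q = Fract [:0, 1:] 1"

definition qint :: "int \<Rightarrow> cq" where
  "qint n = (q powi n - q powi (- n)) / (q - q powi (- 1))"

definition qfact :: "nat \<Rightarrow> cq" where
  "qfact n = (\<Prod>k = 1..n. qint (int k))"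


section \<open>Exponentials of formal series of operators\<close>

text \<open>
  The coefficient of \<open>z\<^sup>n\<close> in \<open>exp (\<Sum>k\<ge>1. A k z\<^sup>k) = \<Sum>m. (\<Sum>k\<ge>1. A k z\<^sup>k)\<^sup>m / m!\<close>, applied to \<open>v\<close>: the
  term for \<open>m\<close> is the sum over all lists of \<open>m\<close> positive integers with sum \<open>n\<close>. The argument
  \<open>s\<close> is scalar multiplication.
\<close>

definition exp_coeff ::
    "(cq \<Rightarrow> 'v \<Rightarrow> 'v::ab_group_add) \<Rightarrow> (nat \<Rightarrow> 'v \<Rightarrow> 'v) \<Rightarrow> nat \<Rightarrow> 'v \<Rightarrow> 'v" where
  "exp_coeff s A n v =
     (\<Sum>ks | 0 \<notin> set ks \<and> sum_list ks = n. s (1 / of_nat (fact (length ks))) (foldr A ks v))"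

text \<open>
  The coefficient of \<open>z\<^bsup>r/2\<^esup>\<close> in
  \<open>exp (\<Sum>k\<ge>1. A k z\<^sup>k) exp (\<Sum>k\<ge>1. B k z\<^bsup>-k\<^esup>) (\<Sum>m. C m z\<^bsup>m/2\<^esup>)\<close>, applied to \<open>v\<close>.
  Here and below \<open>Sum_any\<close> is the sum over the finitely many non-zero terms.
\<close>

definition vertex_coeff ::
    "(cq \<Rightarrow> 'w \<Rightarrow> 'w::ab_group_add) \<Rightarrow> (nat \<Rightarrow> 'w \<Rightarrow> 'w) \<Rightarrow> (nat \<Rightarrow> 'w \<Rightarrow> 'w) \<Rightarrow>
     (int \<Rightarrow> 'v \<Rightarrow> 'w) \<Rightarrow> int \<Rightarrow> 'v \<Rightarrow> 'w" where
  "vertex_coeff s A B C r v =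
     Sum_any (\<lambda>(i, j, m).
       if 2 * (int i - int j) + m = r then exp_coeff s A i (exp_coeff s B j (C m v)) else 0)"


section \<open>Modules over the quantum affine algebra of \<open>sl\<^sub>2\<close>\<close>

text \<open>
  A module is given by the operators by which the Chevalley generators \<open>e\<^sub>i, f\<^sub>i, t\<^sub>i\<close> (\<open>i = 0, 1\<close>)
  and \<open>q\<^sup>d\<close>, and the Drinfeld generators \<open>x\<^sup>\<plusminus>(k)\<close>, \<open>a(l)\<close> (\<open>l \<noteq> 0\<close>) act; \<open>mx m 1 k\<close> is \<open>x\<^sup>+(k)\<close> and
  \<open>mx m (-1) k\<close> is \<open>x\<^sup>-(k)\<close>. The underlying space is the whole type; that several modules share
  one type is no restriction, as all those below have countably infinite dimension.
\<close>

record 'v sl2_ops =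
  mscale :: "cq \<Rightarrow> 'v \<Rightarrow> 'v"
  me :: "nat \<Rightarrow> 'v \<Rightarrow> 'v"
  mf :: "nat \<Rightarrow> 'v \<Rightarrow> 'v"
  mt :: "nat \<Rightarrow> 'v \<Rightarrow> 'v"
  mqd :: "'v \<Rightarrow> 'v"
  mx :: "int \<Rightarrow> int \<Rightarrow> 'v \<Rightarrow> 'v"
  ma :: "int \<Rightarrow> 'v \<Rightarrow> 'v"

definition sl2_cartan :: "nat \<Rightarrow> nat \<Rightarrow> int" where
  "sl2_cartan i j = (if i = j then 2 else - 2)"

definition chevalley_relations :: "'v::ab_group_add sl2_ops \<Rightarrow> bool" where
  "chevalley_relations m \<longleftrightarrow>
    (let s = mscale m; e = me m; f = mf m; t = mt m; D = mqd m in
      (\<forall>i\<in>{0, 1}. bij (t i)) \<and> bij D \<and>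
      (\<forall>v. t 0 (t 1 v) = t 1 (t 0 v)) \<and>
      (\<forall>i\<in>{0, 1}. \<forall>v. D (t i v) = t i (D v)) \<and>
      (\<forall>i\<in>{0, 1}. \<forall>j\<in>{0, 1}. \<forall>v.
         t i (e j v) = s (q powi sl2_cartan i j) (e j (t i v)) \<and>
         t i (f j v) = s (q powi (- sl2_cartan i j)) (f j (t i v)) \<and>
         e i (f j v) - f j (e i v) =
           (if i = j then s (1 / (q - q powi (- 1))) (t i v - inv (t i) v) else 0)) \<and>
      (\<forall>v. D (e 0 v) = s q (e 0 (D v)) \<and> D (f 0 v) = s (q powi (- 1)) (f 0 (D v)) \<and>
           D (e 1 v) = e 1 (D v) \<and> D (f 1 v) = f 1 (D v)) \<and>
      (\<forall>i\<in>{0, 1}. \<forall>j\<in>{0, 1}. i \<noteq> j \<longrightarrow> (\<forall>g\<in>{e, f}. \<forall>v.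
         g i (g i (g i (g j v))) - s (qint 3) (g i (g i (g j (g i v))))
           + s (qint 3) (g i (g j (g i (g i v)))) - g j (g i (g i (g i v))) = 0)))"

text \<open>
  The Drinfeld relations, compared coefficientwise (\<open>X\<^sup>\<plusminus>(z) = \<Sum>k. x\<^sup>\<plusminus>(k) z\<^bsup>-k-1\<^esup>\<close>), with \<open>\<gamma>\<^sup>1\<^sup>/\<^sup>2\<close> acting
  as the scalar \<open>g\<close>. In the last relation, the coefficient of \<open>z\<^bsup>-k-1\<^esup> w\<^bsup>-l-1\<^esup>\<close> picks out the coefficient
  of \<open>z\<^bsup>-(k+l)\<^esup>\<close> of the first exponential, times \<open>\<gamma>\<^bsup>-l\<^esup>\<close> from the delta function, and the coefficient of
  \<open>z\<^bsup>-(k+l)\<^esup>\<close> of the second, times \<open>\<gamma>\<^sup>l\<close>.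
\<close>

definition drinfeld_relations :: "cq \<Rightarrow> 'v::ab_group_add sl2_ops \<Rightarrow> bool" where
  "drinfeld_relations g m \<longleftrightarrow>
    (let s = mscale m; K = mt m 1; a = ma m; x = mx m; \<gamma> = g ^ 2 in
      (\<forall>k l v. k \<noteq> 0 \<longrightarrow> l \<noteq> 0 \<longrightarrow>
         a k (a l v) - a l (a k v) =
           (if k + l = 0
            then s (qint (2 * k) / of_int k * ((\<gamma> powi k - \<gamma> powi (- k)) / (q - q powi (- 1)))) v
            else 0)) \<and>
      (\<forall>k v. k \<noteq> 0 \<longrightarrow> K (a k v) = a k (K v)) \<and>
      (\<forall>\<epsilon>\<in>{1, - 1}. \<forall>k v. K (x \<epsilon> k v) = s (q powi (2 * \<epsilon>)) (x \<epsilon> k (K v))) \<and>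
      (\<forall>\<epsilon>\<in>{1, - 1}. \<forall>k l v. k \<noteq> 0 \<longrightarrow>
         a k (x \<epsilon> l v) - x \<epsilon> l (a k v) =
           s (of_int \<epsilon> * (qint (2 * k) / of_int k) * g powi (- \<epsilon> * \<bar>k\<bar>)) (x \<epsilon> (k + l) v)) \<and>
      (\<forall>\<epsilon>\<in>{1, - 1}. \<forall>k l v.
         x \<epsilon> (k + 1) (x \<epsilon> l v) - s (q powi (2 * \<epsilon>)) (x \<epsilon> k (x \<epsilon> (l + 1) v))
           + x \<epsilon> (l + 1) (x \<epsilon> k v) - s (q powi (2 * \<epsilon>)) (x \<epsilon> l (x \<epsilon> (k + 1) v)) = 0) \<and>
      (\<forall>k l v.
         x 1 k (x (- 1) l v) - x (- 1) l (x 1 k v) =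
           s (1 / (q - q powi (- 1)))
             ((if 0 \<le> k + l
               then s (\<gamma> powi (- l))
                 (K (exp_coeff s (\<lambda>n w. s ((q - q powi (- 1)) * g ^ n) (a (int n) w)) (nat (k + l)) v))
               else 0)
              - (if k + l \<le> 0
                 then s (\<gamma> powi l)
                   (inv K (exp_coeff s (\<lambda>n w. s (- ((q - q powi (- 1)) * g ^ n)) (a (- int n) w))
                      (nat (- (k + l))) v))
                 else 0))))"

definition drinfeld_identification :: "cq \<Rightarrow> 'v::ab_group_add sl2_ops \<Rightarrow> bool" where
  "drinfeld_identification g m \<longleftrightarrow>
    (\<forall>v. mt m 0 (mt m 1 v) = mscale m (g ^ 2) v \<and>
         mx m 1 0 v = me m 1 v \<and> mx m (- 1) 0 v = mf m 1 v \<and>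
         mx m 1 (- 1) v = mt m 0 (mf m 0 v) \<and> mx m (- 1) 1 v = me m 0 (inv (mt m 0) v))"

definition uq_sl2hat_module :: "cq \<Rightarrow> 'v::ab_group_add sl2_ops \<Rightarrow> bool" where
  "uq_sl2hat_module g m \<longleftrightarrow>
     vector_space (mscale m) \<and>
     (\<forall>A \<in> me m ` {0, 1} \<union> mf m ` {0, 1} \<union> mt m ` {0, 1} \<union> {mqd m}
           \<union> {mx m \<epsilon> k | \<epsilon> k. \<epsilon> \<in> {1, - 1}} \<union> {ma m l | l. l \<noteq> 0}.
        Vector_Spaces.linear (mscale m) (mscale m) A) \<and>
     chevalley_relations m \<and> drinfeld_relations g m \<and> drinfeld_identification g m"

definition sl2_submodule :: "'v::ab_group_add sl2_ops \<Rightarrow> 'v set \<Rightarrow> bool" where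
  "sl2_submodule m W \<longleftrightarrow>
     module.subspace (mscale m) W \<and>
     (\<forall>i\<in>{0, 1}. \<forall>v\<in>W. me m i v \<in> W \<and> mf m i v \<in> W \<and> mt m i v \<in> W \<and> inv (mt m i) v \<in> W) \<and>
     (\<forall>v\<in>W. mqd m v \<in> W \<and> inv (mqd m) v \<in> W)"

datatype wt = TwoL0 | L0L1 | TwoL1

fun swap_wt :: "wt \<Rightarrow> wt" where
  "swap_wt TwoL0 = TwoL1"
| "swap_wt L0L1 = L0L1"
| "swap_wt TwoL1 = TwoL0"

text \<open>The value \<open>\<langle>\<nu>, h\<^sub>i\<rangle>\<close>.\<close>

fun wt_eval :: "wt \<Rightarrow> nat \<Rightarrow> int" where
  "wt_eval TwoL0 i = (if i = 0 then 2 else 0)"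
| "wt_eval L0L1 i = 1"
| "wt_eval TwoL1 i = (if i = 0 then 0 else 2)"

text \<open>
  \<open>m\<close> is the irreducible highest weight module \<open>V(\<nu>)\<close> and \<open>v\<close> its highest weight vector \<open>v\<^sub>\<nu>\<close>. As usual
  \<open>\<langle>\<Lambda>\<^sub>i, d\<rangle> = 0\<close>; as the level is 2, \<open>\<gamma>\<^sup>1\<^sup>/\<^sup>2\<close> acts as \<open>q\<close>.
\<close>

definition irreducible_hw_module :: "'v::ab_group_add sl2_ops \<Rightarrow> wt \<Rightarrow> 'v \<Rightarrow> bool" where
  "irreducible_hw_module m \<nu> v \<longleftrightarrow>
     uq_sl2hat_module q m \<and>
     v \<noteq> 0 \<and>
     (\<forall>i\<in>{0, 1}. me m i v = 0 \<and> mt m i v = mscale m (q powi wt_eval \<nu> i) v) \<and>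
     mqd m v = v \<and>
     (\<forall>W. sl2_submodule m W \<longrightarrow> v \<in> W \<longrightarrow> W = UNIV) \<and>
     (\<forall>W. sl2_submodule m W \<longrightarrow> W = {0} \<or> W = UNIV)"

text \<open>\<open>\<sigma>\<close> is the family of maps \<open>\<sigma> \<nu> : V(\<nu>) \<rightarrow> V(\<sigma>\<nu>)\<close>.\<close>

definition diagram_map ::
    "(wt \<Rightarrow> 'v::ab_group_add sl2_ops) \<Rightarrow> (wt \<Rightarrow> 'v) \<Rightarrow> (wt \<Rightarrow> 'v \<Rightarrow> 'v) \<Rightarrow> bool" where
  "diagram_map M vac \<sigma> \<longleftrightarrow>
     (\<forall>\<nu>. Vector_Spaces.linear (mscale (M \<nu>)) (mscale (M (swap_wt \<nu>))) (\<sigma> \<nu>) \<and>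
          \<sigma> \<nu> (vac \<nu>) = vac (swap_wt \<nu>) \<and>
          (\<forall>i\<in>{0, 1}. \<forall>v. \<sigma> \<nu> (mf (M \<nu>) i v) = mf (M (swap_wt \<nu>)) (1 - i) (\<sigma> \<nu> v)))"


section \<open>The operators \<open>D\<^bsup>1/2\<^esup>\<close> and the vertex operators\<close>

text \<open>
  \<open>h_component m i v n\<close> is the component of \<open>v\<close> of \<open>h\<^sub>i\<close>-weight \<open>n\<close>, where \<open>t\<^sub>i = q\<^bsup>h\<^sub>i\<^esup>\<close>; functions of \<open>h\<^sub>i\<close>
  such as \<open>z\<^bsup>h\<^sub>1/2\<^esup>\<close> are defined through it.
\<close>

definition h_component :: "'v::ab_group_add sl2_ops \<Rightarrow> nat \<Rightarrow> 'v \<Rightarrow> int \<Rightarrow> 'v" where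
  "h_component m i v =
     (THE c. finite {n. c n \<noteq> 0} \<and> (\<forall>n. mt m i (c n) = mscale m (q powi n) (c n)) \<and> v = Sum_any c)"

text \<open>\<open>exp\<^bsub>q\<inverse>\<^esub>(A)\<close> for a locally nilpotent operator \<open>A\<close>.\<close>

definition qexp :: "'v::ab_group_add sl2_ops \<Rightarrow> ('v \<Rightarrow> 'v) \<Rightarrow> 'v \<Rightarrow> 'v" where
  "qexp m A v =
     Sum_any (\<lambda>n. mscale m (q powi (- int (n * (n - 1) div 2)) / qfact n) ((A ^^ n) v))"

definition S0 :: "'v::ab_group_add sl2_ops \<Rightarrow> 'v \<Rightarrow> 'v" where
  "S0 m v =
     qexp m (\<lambda>w. mscale m (q powi (- 1)) (me m 0 (inv (mt m 0) w)))
       (qexp m (\<lambda>w. - mf m 0 w)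
         (qexp m (\<lambda>w. mscale m q (me m 0 (mt m 0 w)))
           (Sum_any (\<lambda>n. mscale m (q powi (n * (n + 1) div 2)) (h_component m 0 v n)))))"

definition D_half ::
    "(wt \<Rightarrow> 'v::ab_group_add sl2_ops) \<Rightarrow> (wt \<Rightarrow> 'v \<Rightarrow> 'v) \<Rightarrow> wt \<Rightarrow> 'v \<Rightarrow> 'v" where
  "D_half M \<sigma> \<nu> v = S0 (M (swap_wt \<nu>)) (inv (mt (M (swap_wt \<nu>)) 0) (\<sigma> \<nu> v))"

text \<open>\<open>D\<^bsup>-1/2\<^esup> : V(\<nu>) \<rightarrow> V(\<sigma>\<nu>)\<close> is the inverse of \<open>D\<^bsup>1/2\<^esup> : V(\<sigma>\<nu>) \<rightarrow> V(\<nu>)\<close>.\<close>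

definition D_half_inv ::
    "(wt \<Rightarrow> 'v::ab_group_add sl2_ops) \<Rightarrow> (wt \<Rightarrow> 'v \<Rightarrow> 'v) \<Rightarrow> wt \<Rightarrow> 'v \<Rightarrow> 'v" where
  "D_half_inv M \<sigma> \<nu> = inv (D_half M \<sigma> (swap_wt \<nu>))"

text \<open>The coefficients of \<open>z\<^bsup>r/2\<^esup>\<close> in \<open>\<Phi>\<^sub>0\<^sup>(\<^sup>2\<^sup>)(z)\<close> and \<open>\<Psi>\<^sub>2\<^sup>(\<^sup>2\<^sup>)(z)\<close> on \<open>V(\<nu>)\<close>.\<close>

definition Phi0 ::
    "(wt \<Rightarrow> 'v::ab_group_add sl2_ops) \<Rightarrow> (wt \<Rightarrow> 'v \<Rightarrow> 'v) \<Rightarrow> wt \<Rightarrow> int \<Rightarrow> 'v \<Rightarrow> 'v" where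
  "Phi0 M \<sigma> \<nu> =
     (let N = M (swap_wt \<nu>) in
      vertex_coeff (mscale N)
        (\<lambda>k w. mscale N (q ^ k / qint (2 * int k)) (ma N (- int k) w))
        (\<lambda>k w. mscale N (- (q ^ k / qint (2 * int k))) (ma N (int k) w))
        (\<lambda>n v. D_half M \<sigma> \<nu> (h_component (M \<nu>) 1 v n)))"

text \<open>Here \<open>(q\<^sup>2z)\<^bsup>-h\<^sub>1/2\<^esup>\<close> is \<open>q\<^sup>n z\<^bsup>n/2\<^esup>\<close> on the vectors of \<open>h\<^sub>1\<close>-weight \<open>-n\<close>.\<close>

definition Psi2 ::
    "(wt \<Rightarrow> 'v::ab_group_add sl2_ops) \<Rightarrow> (wt \<Rightarrow> 'v \<Rightarrow> 'v) \<Rightarrow> wt \<Rightarrow> int \<Rightarrow> 'v \<Rightarrow> 'v" where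
  "Psi2 M \<sigma> \<nu> =
     (let N = M (swap_wt \<nu>) in
      vertex_coeff (mscale N)
        (\<lambda>k w. mscale N (- (q powi (- int k) / qint (2 * int k)) * (q ^ 2) ^ k) (ma N (- int k) w))
        (\<lambda>k w. mscale N (q powi (- int k) / qint (2 * int k) * (q ^ 2) powi (- int k)) (ma N (int k) w))
        (\<lambda>n v. D_half_inv M \<sigma> \<nu> (mscale (M \<nu>) (q powi n) (h_component (M \<nu>) 1 v (- n)))))"


section \<open>The Heisenberg algebra and its Fock modules\<close>

text \<open>
  The direct sum of the Fock modules \<open>\<V>\<^sub>p\<close>, \<open>p \<in> \<onehalf>\<int>\<close>, has the basis of all \<open>\<Prod>\<^bsub>i\<in>\<mu>\<^esub> b(-(i+1)) v(p)\<close>, where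
  \<open>\<mu>\<close> is a multiset of natural numbers. This vector is indexed by \<open>(2p, \<mu>)\<close>: an element \<open>i\<close> of \<open>\<mu>\<close> stands
  for a factor \<open>b(-(i+1))\<close>, and the first component is \<open>n = 2p\<close>, not \<open>p\<close>. In this basis \<open>b(-k)\<close>
  is a multiplication operator and \<open>b(k)\<close> a multiple of the derivation \<open>\<partial>/\<partial>b(-k)\<close>.
\<close>

type_synonym fock_index = "int \<times> nat multiset"
type_synonym fock = "fock_index \<Rightarrow>\<^sub>0 cq"

definition fscale :: "cq \<Rightarrow> fock \<Rightarrow> fock" where
  "fscale c = Poly_Mapping.map ((*) c)"

definition fbasis :: "fock_index \<Rightarrow> fock" where
  "fbasis \<kappa> = Poly_Mapping.single \<kappa> 1"

definition flinear :: "(fock_index \<Rightarrow> fock) \<Rightarrow> fock \<Rightarrow> fock" where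
  "flinear g w = Sum_any (\<lambda>\<kappa>. fscale (Poly_Mapping.lookup w \<kappa>) (g \<kappa>))"

text \<open>\<open>fvac n\<close> is \<open>v(n/2)\<close>.\<close>

definition fvac :: "int \<Rightarrow> fock" where
  "fvac n = fbasis (n, {#})"

definition heis :: "int \<Rightarrow> fock \<Rightarrow> fock" where
  "heis k = flinear (\<lambda>(n, \<mu>).
     if k < 0 then fbasis (n, add_mset (nat (- k) - 1) \<mu>)
     else if k = 0 then fscale (of_int n / 2) (fbasis (n, \<mu>))
     else fscale (of_nat (count \<mu> (nat k - 1)) *
                  (1 / of_int k * (q powi (2 * k) - 1 + q powi (- 2 * k))))
            (fbasis (n, \<mu> - {# nat k - 1 #})))"

text \<open>\<open>T\<^sup>r\<close> for integral \<open>r\<close>.\<close>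

definition fshift :: "int \<Rightarrow> fock \<Rightarrow> fock" where
  "fshift r = flinear (\<lambda>(n, \<mu>). fbasis (n + 2 * r, \<mu>))"

text \<open>The projection to \<open>\<V>\<^bsub>n/2\<^esub>\<close>, that is, to the vectors on which \<open>z\<^bsup>b(0)\<^esup>\<close> acts as \<open>z\<^bsup>n/2\<^esup>\<close>.\<close>

definition b0_component :: "fock \<Rightarrow> int \<Rightarrow> fock" where
  "b0_component w n = flinear (\<lambda>(n', \<mu>). if n' = n then fbasis (n', \<mu>) else 0) w"

text \<open>The coefficients of \<open>z\<^bsup>r/2\<^esup>\<close> in \<open>\<Omega>\<^sub>0(z)\<close> and \<open>\<Omega>\<^sub>2(z)\<close>.\<close>

definition Omega0 :: "int \<Rightarrow> fock \<Rightarrow> fock" where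
  "Omega0 =
     vertex_coeff fscale
       (\<lambda>k w. fscale (q ^ k) (heis (- int k) w))
       (\<lambda>k w. fscale (- (q ^ k)) (heis (int k) w))
       (\<lambda>n w. fshift 1 (b0_component w n))"

definition Omega2 :: "int \<Rightarrow> fock \<Rightarrow> fock" where
  "Omega2 =
     vertex_coeff fscale
       (\<lambda>k w. fscale (- (q powi (- int k))) (heis (- int k) w))
       (\<lambda>k w. fscale (q powi (- int k)) (heis (int k) w))
       (\<lambda>n w. fshift (- 1) (b0_component w (- n)))"


section \<open>The tensor products\<close>

text \<open>
  As the Fock space has a basis, \<open>V(\<nu>) \<otimes> (\<Oplus>\<^sub>p \<V>\<^sub>p)\<close> is the space of finitely supported functions from
  the basis to \<open>V(\<nu>)\<close>; \<open>'v total\<close> is the direct sum of these three spaces.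
\<close>

type_synonym 'v total = "wt \<times> fock_index \<Rightarrow>\<^sub>0 'v"

definition tscale :: "(wt \<Rightarrow> 'v::ab_group_add sl2_ops) \<Rightarrow> cq \<Rightarrow> 'v total \<Rightarrow> 'v total" where
  "tscale M c = Poly_Mapping.mapp (\<lambda>(\<nu>, \<kappa>). mscale (M \<nu>) c)"

text \<open>\<open>tens M \<nu> v w\<close> is \<open>v \<otimes> w\<close> for \<open>v \<in> V(\<nu>)\<close>.\<close>

definition tens :: "(wt \<Rightarrow> 'v::ab_group_add sl2_ops) \<Rightarrow> wt \<Rightarrow> 'v \<Rightarrow> fock \<Rightarrow> 'v total" where
  "tens M \<nu> v w =
     Sum_any (\<lambda>\<kappa>. Poly_Mapping.single (\<nu>, \<kappa>) (mscale (M \<nu>) (Poly_Mapping.lookup w \<kappa>) v))"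

text \<open>
  The operator \<open>v \<otimes> w \<mapsto> A \<nu> v \<otimes> B w\<close> (\<open>v \<in> V(\<nu>)\<close>), where \<open>A \<nu> : V(\<nu>) \<rightarrow> V(g \<nu>)\<close> and \<open>B\<close> are linear.
\<close>

definition tens_op ::
    "(wt \<Rightarrow> 'v::ab_group_add sl2_ops) \<Rightarrow> (wt \<Rightarrow> wt) \<Rightarrow> (wt \<Rightarrow> 'v \<Rightarrow> 'v) \<Rightarrow> (fock \<Rightarrow> fock) \<Rightarrow>
     'v total \<Rightarrow> 'v total" where
  "tens_op M g A B x =
     Sum_any (\<lambda>(\<nu>, \<kappa>). tens M (g \<nu>) (A \<nu> (Poly_Mapping.lookup x (\<nu>, \<kappa>))) (B (fbasis \<kappa>)))"

text \<open>
  The pairs \<open>(\<nu>, 2p)\<close> for which \<open>V(\<nu>) \<otimes> \<V>\<^sub>p\<close> is a summand of \<open>\<V>(j)\<close>.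
\<close>

definition sectors :: "nat \<Rightarrow> (wt \<times> int) set" where
  "sectors j =
     (if j = 0 then {(TwoL0, 2 * p) | p. even p} \<union> {(TwoL1, 2 * (p + 1)) | p. even p}
      else if j = 1 then {(L0L1, 2 * p + 1) | p. True}
      else {(TwoL0, 2 * (p + 1)) | p. even p} \<union> {(TwoL1, 2 * p) | p. even p})"

definition V_space :: "nat \<Rightarrow> 'v::ab_group_add total set" where
  "V_space j = {x. \<forall>(\<nu>, n, \<mu>) \<in> Poly_Mapping.keys x. (\<nu>, n) \<in> sectors j}"

text \<open>
  The coefficients of \<open>z\<^bsup>-k-1\<^esup>\<close> in \<open>Y\<^sup>+(z) = \<Psi>\<^sub>2\<^sup>(\<^sup>2\<^sup>)(q\<^bsup>-2\<^esup>z) \<otimes> \<Omega>\<^sub>2(z)\<close> and \<open>Y\<^sup>-(z) = \<Phi>\<^sub>0\<^sup>(\<^sup>2\<^sup>)(z) \<otimes> \<Omega>\<^sub>0(z)\<close>; the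
  factor \<open>q\<^bsup>-r\<^esup>\<close> is \<open>(q\<^bsup>-2\<^esup>)\<^bsup>r/2\<^esup>\<close>.
\<close>

definition Yplus ::
    "(wt \<Rightarrow> 'v::ab_group_add sl2_ops) \<Rightarrow> (wt \<Rightarrow> 'v \<Rightarrow> 'v) \<Rightarrow> int \<Rightarrow> 'v total \<Rightarrow> 'v total" where
  "Yplus M \<sigma> k x =
     Sum_any (\<lambda>r.
       tens_op M swap_wt
         (\<lambda>\<nu> v. mscale (M (swap_wt \<nu>)) (q powi (- r)) (Psi2 M \<sigma> \<nu> r v))
         (Omega2 (2 * (- k - 1) - r)) x)"

definition Yminus ::
    "(wt \<Rightarrow> 'v::ab_group_add sl2_ops) \<Rightarrow> (wt \<Rightarrow> 'v \<Rightarrow> 'v) \<Rightarrow> int \<Rightarrow> 'v total \<Rightarrow> 'v total" where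
  "Yminus M \<sigma> k x =
     Sum_any (\<lambda>r. tens_op M swap_wt (\<lambda>\<nu>. Phi0 M \<sigma> \<nu> r) (Omega0 (2 * (- k - 1) - r)) x)"


section \<open>The quantum affine algebra of type \<open>C\<^sub>2\<^sup>(\<^sup>1\<^sup>)\<close> and its highest weight modules\<close>

text \<open>
  The operators by which the Drinfeld generators \<open>x\<^sub>i\<^sup>\<plusminus>(k)\<close>, \<open>a\<^sub>i(l)\<close> (\<open>l \<noteq> 0\<close>), \<open>K\<^sub>i\<close>, \<open>\<gamma>\<^sup>1\<^sup>/\<^sup>2\<close> act,
  \<open>i = 1, 2\<close>; signs are encoded as above. The Drinfeld relations of this algebra are not imposed
  here: submodules and highest weight vectors depend only on the operators, and that the operators
  of \<open>sp4_action\<close> satisfy the relations and act irreducibly on each \<open>\<V>(j)\<close> is a separate theorem, which is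
  not assumed.
\<close>

record 'w sp4_ops =
  wscale :: "cq \<Rightarrow> 'w \<Rightarrow> 'w"
  wx :: "nat \<Rightarrow> int \<Rightarrow> int \<Rightarrow> 'w \<Rightarrow> 'w"
  wa :: "nat \<Rightarrow> int \<Rightarrow> 'w \<Rightarrow> 'w"
  wK :: "nat \<Rightarrow> 'w \<Rightarrow> 'w"
  wg :: "'w \<Rightarrow> 'w"

definition sp4_submodule :: "'w::ab_group_add sp4_ops \<Rightarrow> 'w set \<Rightarrow> bool" where
  "sp4_submodule U W \<longleftrightarrow>
     module.subspace (wscale U) W \<and>
     (\<forall>i\<in>{1, 2}. \<forall>v\<in>W.
        (\<forall>\<epsilon>\<in>{1, - 1}. \<forall>k. wx U i \<epsilon> k v \<in> W) \<and>
        (\<forall>l. l \<noteq> 0 \<longrightarrow> wa U i l v \<in> W) \<and>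
        wK U i v \<in> W \<and> inv (wK U i) v \<in> W) \<and>
     (\<forall>v\<in>W. wg U v \<in> W \<and> inv (wg U) v \<in> W)"

definition sp4_generated :: "'w::ab_group_add sp4_ops \<Rightarrow> 'w \<Rightarrow> 'w set" where
  "sp4_generated U v = \<Inter> {W. sp4_submodule U W \<and> v \<in> W}"

definition q_comm :: "'w::ab_group_add sp4_ops \<Rightarrow> cq \<Rightarrow> ('w \<Rightarrow> 'w) \<Rightarrow> ('w \<Rightarrow> 'w) \<Rightarrow> 'w \<Rightarrow> 'w" where
  "q_comm U c A B x = A (B x) - wscale U c (B (A x))"

definition sp4_e :: "'w::ab_group_add sp4_ops \<Rightarrow> nat \<Rightarrow> 'w \<Rightarrow> 'w" where
  "sp4_e U i x =
     (if i = 0 then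
        wscale U (q ^ 2)
          (q_comm U 1 (wx U 1 (- 1) 0) (q_comm U (q powi (- 2)) (wx U 2 (- 1) 0) (wx U 1 (- 1) 1))
            (inv (wK U 1) (inv (wK U 1) (inv (wK U 2) x))))
      else wx U i 1 0 x)"

text \<open>\<open>t\<^sub>0 = \<gamma> (K\<^sub>1\<^sup>2 K\<^sub>2)\<inverse>\<close>.\<close>

definition sp4_t :: "'w::ab_group_add sp4_ops \<Rightarrow> nat \<Rightarrow> 'w \<Rightarrow> 'w" where
  "sp4_t U i x =
     (if i = 0 then wg U (wg U (inv (wK U 2) (inv (wK U 1) (inv (wK U 1) x)))) else wK U i x)"

definition sp4_q :: "nat \<Rightarrow> cq" where
  "sp4_q i = (if i = 1 then q else q ^ 2)"

text \<open>\<open>W\<close> is a highest weight module with highest weight \<open>\<Lambda>\<^sub>j\<close> and highest weight vector \<open>v\<close>.\<close>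

definition sp4_highest_weight_module :: "'w::ab_group_add sp4_ops \<Rightarrow> 'w set \<Rightarrow> nat \<Rightarrow> 'w \<Rightarrow> bool" where
  "sp4_highest_weight_module U W j v \<longleftrightarrow>
     sp4_submodule U W \<and> v \<noteq> 0 \<and> sp4_generated U v = W \<and>
     (\<forall>i\<in>{0, 1, 2}. sp4_e U i v = 0 \<and>
        sp4_t U i v = wscale U (sp4_q i ^ (if i = j then 1 else 0)) v)"

text \<open>
  The action on \<open>\<V>(0) + \<V>(1) + \<V>(2)\<close>. \<open>K\<^sub>2 = (q\<^bsup>2b(0)\<^esup> K)\<inverse>\<close>, and \<open>q\<^bsup>-2b(0)\<^esup>\<close> is \<open>q\<^bsup>-n\<^esup>\<close> on \<open>\<V>\<^bsub>n/2\<^esub>\<close>.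
\<close>

definition sp4_action ::
    "(wt \<Rightarrow> 'v::ab_group_add sl2_ops) \<Rightarrow> (wt \<Rightarrow> 'v \<Rightarrow> 'v) \<Rightarrow> 'v total sp4_ops" where
  "sp4_action M \<sigma> =
     \<lparr> wscale = tscale M,
       wx = (\<lambda>i \<epsilon> k.
         if i = 1 then tens_op M id (\<lambda>\<nu>. mx (M \<nu>) \<epsilon> k) id
         else if \<epsilon> = 1 then Yplus M \<sigma> k else Yminus M \<sigma> k),
       wa = (\<lambda>i l x.
         if i = 1 then tens_op M id (\<lambda>\<nu>. ma (M \<nu>) l) id x
         else tscale M (- (1 / qint 2))
           (tens_op M id (\<lambda>\<nu>. ma (M \<nu>) l) id x
             + tscale M (qint (2 * \<bar>l\<bar>)) (tens_op M id (\<lambda>\<nu>. id) (heis l) x))),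
       wK = (\<lambda>i.
         if i = 1 then tens_op M id (\<lambda>\<nu>. mt (M \<nu>) 1) id
         else tens_op M id (\<lambda>\<nu>. inv (mt (M \<nu>) 1))
           (flinear (\<lambda>(n, \<mu>). fscale (q powi (- n)) (fbasis (n, \<mu>))))),
       wg = tscale M q \<rparr>"

end

theory Submission
  imports Defs
begin

text \<open>
  Why the theorem holds. Only leading coefficients of the vertex operators are needed, and they are
  computed on extremal vectors.

  Let \<open>v\<^sub>\<nu>\<close> be the highest weight vector of the affine \<open>sl\<^sub>2\<close> module \<open>V(\<nu>)\<close> and \<open>c = \<langle>\<nu>, h\<^sub>1\<rangle>\<close>. The operator
  \<open>\<sigma>\<close> sends the extremal vector \<open>f\<^sub>1\<^sup>c v\<^sub>\<nu>\<close> to the lowest vector \<open>f\<^sub>0\<^sup>c v\<^bsub>\<sigma>\<nu>\<^esub>\<close> of an \<open>f\<^sub>0\<close>-string, and \<open>S\<^sub>0\<close> reflects the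
  latter to a nonzero multiple of \<open>v\<^bsub>\<sigma>\<nu>\<^esub>\<close> (\<open>S0_lowest\<close>; as \<open>c \<le> 2\<close>, this is a computation in a module of
  dimension at most 3). Hence \<open>D\<^bsup>1/2\<^esup>\<close> maps \<open>f\<^sub>1\<^sup>c v\<^sub>\<nu>\<close> to a multiple of \<open>v\<^bsub>\<sigma>\<nu>\<^esub>\<close>. It is injective, because a
  \<open>q\<close>-exponential of a locally nilpotent operator is: \<open>e\<^sub>0\<close> is locally nilpotent since \<open>q\<^sup>d\<close> has no
  eigenvalue of positive degree on \<open>V(\<nu>)\<close>, and \<open>f\<^sub>0\<close> is so by the Serre relation. Hence \<open>D\<^bsup>-1/2\<^esup>\<close> maps \<open>v\<^sub>\<nu>\<close> back
  to a multiple of the extremal vector of \<open>V(\<sigma>\<nu>)\<close>.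

  The Drinfeld generators \<open>x\<^sup>\<plusminus>(k)\<close> shift the degree by \<open>k\<close>. Therefore the \<open>a(k)\<close> with \<open>k > 0\<close> kill all vectors of
  degree 0, in particular the extremal vectors, and the half of the vertex operators that lowers the exponent
  of \<open>z\<close> acts trivially (\<open>vertex_coeff_leading\<close>). So
  \<open>Y\<^sup>-(z)\<close> on \<open>f\<^sub>1\<^sup>c v\<^sub>\<nu> \<otimes> v(p)\<close> starts with a multiple of \<open>v\<^bsub>\<sigma>\<nu>\<^esub> \<otimes> v(p + 1)\<close>, and \<open>Y\<^sup>+(z)\<close> on \<open>v\<^sub>\<nu> \<otimes> v(p)\<close> starts with a
  multiple of \<open>f\<^sub>1\<^sup>r v\<^bsub>\<sigma>\<nu>\<^esub> \<otimes> v(p - 1)\<close>, \<open>r = \<langle>\<nu>, h\<^sub>0\<rangle>\<close> (\<open>Yminus_leading\<close>, \<open>Yplus_vac\<close>).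

  That the vector generates \<open>\<V>(j)\<close> is shown directly. Let \<open>W\<close> be a submodule containing \<open>v\<^sub>\<nu> \<otimes> v(p)\<close>. The first
  node acts by affine \<open>sl\<^sub>2\<close>, and \<open>a\<^sub>1(l)\<close>, \<open>a\<^sub>2(l)\<close> together give the Heisenberg algebra, so
  \<open>V(\<nu>) \<otimes> \<V>\<^sub>p \<subseteq> W\<close> (\<open>W_sector\<close>). The leading terms above then lead to \<open>v\<^bsub>\<sigma>\<nu>\<^esub> \<otimes> v(p \<plusminus> 1) \<in> W\<close>, and thus, step by
  step, to all summands of \<open>\<V>(j)\<close> (\<open>W_chain\<close>). The equations \<open>e\<^sub>2 v = 0\<close> and \<open>e\<^sub>0 v = 0\<close> are read off from
  the exponents of leading terms, where for \<open>\<V>(1)\<close> also \<open>D\<^bsup>1/2\<^esup> v\<^sub>\<nu> = - f\<^sub>0 v\<^sub>\<nu>\<close> enters, and the weights from \<open>t\<^sub>1 = K\<close>, \<open>t\<^sub>2 = q\<^bsup>-2b(0)\<^esup> K\<inverse>\<close>, \<open>t\<^sub>0 = q\<^bsup>2+2b(0)\<^esup> K\<inverse>\<close>.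
\<close>

section \<open>The indeterminate\<close>

lemma q_power: "q ^ n = Fract ([:0, 1:] ^ n) 1"
  by (induction n) (simp_all add: q_def One_fract_def)

lemma q_nonzero [simp]: "q \<noteq> 0"
  by (simp add: q_def Zero_fract_def eq_fract)

lemma q_power_eq_1: "q ^ n = 1 \<longleftrightarrow> n = 0"
proof
  assume "q ^ n = 1"
  then have "[:0, 1 :: complex:] ^ n = 1"
    by (simp add: q_power One_fract_def eq_fract)
  then have "degree ([:0, 1 :: complex:] ^ n) = 0"
    by simp
  then show "n = 0"
    by (simp add: degree_power_eq)
qed simp

lemma q_powi_eq_1 [simp]: "q powi n = 1 \<longleftrightarrow> n = 0"
proof (cases "n \<ge> 0")
  case True
  then show ?thesis
    using q_power_eq_1[of "nat n"] by (simp add: power_int_def)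
next
  case False
  then show ?thesis
    using q_power_eq_1[of "nat (- n)"] by (simp add: power_int_def power_inverse)
qed

lemma q_powi_inj [simp]: "q powi a = q powi b \<longleftrightarrow> a = b"
  using q_powi_eq_1[of "a - b"] by (auto simp: power_int_diff)

lemma q_minus_inverse_nonzero [simp]: "q - inverse q \<noteq> 0"
  using q_powi_inj[of 1 "- 1"] by simp

lemma q_neq_inverse [simp]: "q \<noteq> inverse q" "inverse q \<noteq> q"
  using q_minus_inverse_nonzero by (metis diff_self)+

lemma qint_nonzero [simp]: "qint n = 0 \<longleftrightarrow> n = 0"
  using q_powi_inj[of n "- n"] q_powi_inj[of 1 "- 1"] unfolding qint_def by (auto simp del: q_powi_inj)

lemma qint_1 [simp]: "qint 1 = 1"
  by (simp add: qint_def)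

lemma qint_2: "qint 2 = q + inverse q"
proof -
  have "q\<^sup>2 - (inverse q)\<^sup>2 = (q + inverse q) * (q - inverse q)"
    by (simp add: algebra_simps power2_eq_square)
  then show ?thesis
    by (simp add: qint_def power_int_minus power_inverse)
qed

section \<open>Linear maps and their eigenvectors\<close>

lemma linear_simps:
  assumes "Vector_Spaces.linear s1 s2 A"
  shows "A (x + y) = A x + A y" and "A 0 = 0" and "A (s1 c x) = s2 c (A x)" and "A (- x) = - A x"
    and "A (x - y) = A x - A y" and "A (\<Sum>i\<in>I. f i) = (\<Sum>i\<in>I. A (f i))"
proof -
  interpret Vector_Spaces.linear s1 s2 A
    by fact
  show "A (x + y) = A x + A y" and "A 0 = 0" and "A (s1 c x) = s2 c (A x)" and "A (- x) = - A x"
    and "A (x - y) = A x - A y" and "A (\<Sum>i\<in>I. f i) = (\<Sum>i\<in>I. A (f i))"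
    by (rule add zero scale neg diff sum)+
qed

lemma linearI:
  assumes "vector_space s1" "vector_space s2"
    and "\<And>x y. A (x + y) = A x + A y" "\<And>c x. A (s1 c x) = s2 c (A x)"
  shows "Vector_Spaces.linear s1 s2 A"
  using assms unfolding Vector_Spaces.linear_iff by blast

locale cq_space = vector_space scale
  for scale :: "cq \<Rightarrow> 'v \<Rightarrow> 'v::ab_group_add"
begin

abbreviation endo :: "('v \<Rightarrow> 'v) \<Rightarrow> bool" where
  "endo \<equiv> Vector_Spaces.linear scale scale"

lemma endo_compose: "endo A \<Longrightarrow> endo B \<Longrightarrow> endo (\<lambda>x. A (B x))"
  unfolding Vector_Spaces.linear_iff by simp

lemma endo_scale: "endo A \<Longrightarrow> endo (\<lambda>x. scale c (A x))"
  unfolding Vector_Spaces.linear_iff by (simp add: scale_right_distrib scale_left_commute)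

lemma endo_uminus: "endo A \<Longrightarrow> endo (\<lambda>x. - A x)"
  unfolding Vector_Spaces.linear_iff by simp

lemma endo_funpow: "endo A \<Longrightarrow> endo (A ^^ n)"
  by (induction n) (simp_all add: Vector_Spaces.linear_iff vector_space_axioms)

lemma endo_inv: "endo A \<Longrightarrow> bij A \<Longrightarrow> endo (inv A)"
  unfolding Vector_Spaces.linear_iff
  by (metis bij_inv_eq_iff)

lemma eigenvectors_independent:
  assumes "endo T" "finite F" "inj_on r F" "\<And>n. n \<in> F \<Longrightarrow> T (c n) = scale (r n) (c n)"
    and "(\<Sum>n\<in>F. c n) = 0"
  shows "\<forall>n\<in>F. c n = 0"
  using assms(2-)
proof (induction F arbitrary: c rule: finite_induct)
  case empty
  then show ?case by simp
next
  case (insert a F)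
  have "0 = T (\<Sum>n\<in>insert a F. c n) - scale (r a) (\<Sum>n\<in>insert a F. c n)"
    using insert.prems(3) linear_simps(2)[OF assms(1)] by simp
  also have "\<dots> = (\<Sum>n\<in>insert a F. scale (r n - r a) (c n))"
    using insert.prems(2)
    by (simp add: linear_simps[OF assms(1)] scale_sum_right scale_left_diff_distrib sum_subtractf
        del: sum.insert)
  also have "\<dots> = (\<Sum>n\<in>F. scale (r n - r a) (c n))"
    using insert.hyps by simp
  finally have "\<forall>n\<in>F. scale (r n - r a) (c n) = 0"
    using insert.prems by (intro insert.IH)
      (auto simp: linear_simps[OF assms(1)] inj_on_insert scale_left_commute)
  moreover have "r n \<noteq> r a" if "n \<in> F" for n
    using that insert by (auto simp: inj_on_def)
  ultimately have "\<forall>n\<in>F. c n = 0"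
    by auto
  then show ?case
    using insert by simp
qed

definition nilpotent_at :: "('v \<Rightarrow> 'v) \<Rightarrow> 'v \<Rightarrow> bool" where
  "nilpotent_at A x \<longleftrightarrow> (\<exists>N. (A ^^ N) x = 0)"

lemma funpow_zero_mono:
  assumes "endo A" "(A ^^ N) x = 0" "N \<le> n"
  shows "(A ^^ n) x = 0"
proof -
  have "(A ^^ n) x = (A ^^ (n - N)) ((A ^^ N) x)"
    using assms(3) funpow_add[of "n - N" N A] by simp
  then show ?thesis
    using assms(2) linear_simps(2)[OF endo_funpow[OF assms(1)]] by simp
qed

lemma subspace_nilpotent:
  assumes "endo A"
  shows "subspace {x. nilpotent_at A x}"
proof (intro subspaceI CollectI)
  note [simp] = linear_simps[OF endo_funpow[OF assms]]
  show "nilpotent_at A 0"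
    unfolding nilpotent_at_def by simp
  fix x y c
  assume "x \<in> {x. nilpotent_at A x}"
  then obtain N where N: "(A ^^ N) x = 0"
    unfolding nilpotent_at_def by blast
  then show "nilpotent_at A (scale c x)"
    unfolding nilpotent_at_def by (intro exI[of _ N]) simp
  assume "y \<in> {x. nilpotent_at A x}"
  then obtain N' where N': "(A ^^ N') y = 0"
    unfolding nilpotent_at_def by blast
  have "(A ^^ max N N') (x + y) = 0"
    using funpow_zero_mono[OF assms N, of "max N N'"] funpow_zero_mono[OF assms N', of "max N N'"] by simp
  then show "nilpotent_at A (x + y)"
    unfolding nilpotent_at_def by blast
qed

text \<open>
  A polynomial in a nilpotent operator \<open>A\<close> with constant term 1 is injective: if \<open>N\<close> is least with \<open>A\<^sup>N x = 0\<close>,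
  then \<open>A\<^bsup>N-1\<^esup>\<close> maps its value at \<open>x\<close> to \<open>A\<^bsup>N-1\<^esup> x \<noteq> 0\<close>.
\<close>
lemma unipotent_injective:
  assumes A: "endo A" and N: "(A ^^ N) x = 0" and d: "d 0 = 1"
    and zero: "(\<Sum>n<N. scale (d n) ((A ^^ n) x)) = 0"
  shows "x = 0"
proof (rule ccontr)
  assume "x \<noteq> 0"
  note [simp] = linear_simps[OF endo_funpow[OF A]]
  define L where "L = (LEAST k. (A ^^ k) x = 0)"
  have L: "(A ^^ L) x = 0" "L \<le> N"
    unfolding L_def using N by (auto intro: LeastI Least_le)
  then have "L \<noteq> 0"
    using \<open>x \<noteq> 0\<close> by (metis eq_id_iff funpow_0)
  have *: "(A ^^ (L - 1)) ((A ^^ n) x) = 0" if "n \<noteq> 0" for n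
  proof -
    have "(A ^^ (L - 1 + n)) x = 0"
      using funpow_zero_mono[OF A L(1)] that \<open>L \<noteq> 0\<close> by simp
    then show ?thesis
      by (simp add: funpow_add)
  qed
  have "0 = (A ^^ (L - 1)) (\<Sum>n<N. scale (d n) ((A ^^ n) x))"
    by (simp add: zero)
  also have "\<dots> = (\<Sum>n<N. scale (d n) ((A ^^ (L - 1)) ((A ^^ n) x)))"
    by simp
  also have "\<dots> = (\<Sum>n<N. if n = 0 then (A ^^ (L - 1)) x else 0)"
    by (intro sum.cong) (auto simp: *[unfolded One_nat_def] d)
  also have "\<dots> = (A ^^ (L - 1)) x"
    using \<open>L \<noteq> 0\<close> L(2) by simp
  finally have "(A ^^ (L - 1)) x = 0" ..
  then have "L \<le> L - 1"
    unfolding L_def by (rule Least_le)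
  then show False
    using \<open>L \<noteq> 0\<close> by simp
qed

end

section \<open>Leading terms of exponentials\<close>

lemma finite_compositions: "finite {ks. 0 \<notin> set ks \<and> sum_list ks = (n :: nat)}"
proof (rule finite_subset)
  have "length ks \<le> sum_list ks" if "0 \<notin> set ks" for ks :: "nat list"
    using that by (induction ks) auto
  then show "{ks. 0 \<notin> set ks \<and> sum_list ks = n} \<subseteq> {ks. set ks \<subseteq> {..n} \<and> length ks \<le> n}"
    by (auto intro: member_le_sum_list)
  show "finite {ks. set ks \<subseteq> {..n} \<and> length ks \<le> n}"
    by (rule finite_lists_length_le) simp
qed

lemma foldr_zero:
  assumes "\<And>k. 0 < k \<Longrightarrow> A k 0 = (0 :: 'v::ab_group_add)" "0 \<notin> set (ks :: nat list)"
  shows "foldr A ks 0 = 0"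
  using assms(2) by (induction ks) (auto simp: assms(1))

lemma exp_coeff_0 [simp]:
  assumes "vector_space s"
  shows "exp_coeff s A 0 v = v"
proof -
  interpret vector_space s by fact
  have "{ks. 0 \<notin> set ks \<and> sum_list ks = (0 :: nat)} = {[]}"
    by (metis (mono_tags, lifting) list.set_intros(1) neq_Nil_conv Collect_cong singleton_conv sum_list_eq_0_iff emptyE list.set(1))
  then show ?thesis
    by (simp add: exp_coeff_def)
qed

text \<open>
  A composition of \<open>n\<close> other than \<open>[n]\<close> has a last part smaller than \<open>n\<close>, and this part acts first.
\<close>
lemma exp_coeff_first:
  assumes "vector_space s" "\<And>k. 0 < k \<Longrightarrow> A k 0 = 0" "n > 0" "\<And>k. 0 < k \<Longrightarrow> k < n \<Longrightarrow> A k v = 0"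
  shows "exp_coeff s A n v = A n v"
proof -
  interpret vector_space s by fact
  have *: "foldr A ks v = 0" if ks: "0 \<notin> set ks" "sum_list ks = n" "ks \<noteq> [n]" for ks
  proof (cases ks rule: rev_cases)
    case Nil
    then show ?thesis using ks \<open>n > 0\<close> by simp
  next
    case (snoc ks' k)
    have "ks' \<noteq> []"
      using ks snoc by auto
    then have "sum_list ks' \<noteq> 0" and "k \<noteq> 0"
      using ks snoc by (cases ks'; auto)+
    moreover have "sum_list ks' + k = n"
      using ks snoc by simp
    ultimately have "A k v = 0"
      using assms(4)[of k] by linarith
    then show ?thesis
      using snoc ks by (simp add: foldr_zero[of A, OF assms(2)])
  qed
  have "exp_coeff s A n v = (\<Sum>ks\<in>{[n]}. s (1 / of_nat (fact (length ks))) (foldr A ks v))"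
    unfolding exp_coeff_def
    by (rule sum.mono_neutral_right[OF finite_compositions]) (use \<open>n > 0\<close> * in auto)
  then show ?thesis
    by simp
qed

lemma exp_coeff_eq_0:
  assumes "vector_space s" "\<And>k. 0 < k \<Longrightarrow> A k 0 = 0" "n > 0" "\<And>k. 0 < k \<Longrightarrow> A k v = 0"
  shows "exp_coeff s A n v = 0"
  using exp_coeff_first[where A = A, OF assms(1,2,3)] assms(3,4) by simp

lemma exp_coeff_zero:
  assumes "vector_space s" "\<And>k. 0 < k \<Longrightarrow> A k 0 = 0"
  shows "exp_coeff s A n 0 = 0"
  using foldr_zero[of A, OF assms(2)] assms(1)
  by (simp add: exp_coeff_def module.scale_zero_right module_iff_vector_space)

text \<open>
  Since the \<open>B k\<close> annihilate \<open>y\<close>, only the \<open>A k\<close> contribute, and they raise the exponent.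
\<close>
lemma vertex_coeff_leading:
  assumes "vector_space s" "\<And>k. 0 < k \<Longrightarrow> A k 0 = 0" "\<And>k. 0 < k \<Longrightarrow> B k 0 = 0"
    and C: "\<And>m. C m v = (if m = h then y else 0)" and B: "\<And>k. 0 < k \<Longrightarrow> B k y = 0"
  shows "r < h \<Longrightarrow> vertex_coeff s A B C r v = 0" and "vertex_coeff s A B C h v = y"
proof -
  have *: "exp_coeff s A i (exp_coeff s B j (C m v)) =
      (if m = h \<and> j = 0 then exp_coeff s A i y else 0)" for i j m
    using assms(1-3) B by (cases "j = 0") (auto simp: C exp_coeff_zero exp_coeff_eq_0)
  show "vertex_coeff s A B C r v = 0" if "r < h"
  proof -
    have "(\<lambda>(i, j, m). if 2 * (int i - int j) + m = r
        then exp_coeff s A i (exp_coeff s B j (C m v)) else 0) = (\<lambda>_. 0)"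
      using that by (auto simp: * fun_eq_iff)
    then show ?thesis
      unfolding vertex_coeff_def by simp
  qed
  have "(\<lambda>(i, j, m). if 2 * (int i - int j) + m = h
        then exp_coeff s A i (exp_coeff s B j (C m v)) else 0)
      = (\<lambda>x. if x = (0, 0, h) then y else 0)"
    unfolding * using assms(1) by (auto simp: fun_eq_iff)
  then show "vertex_coeff s A B C h v = y"
    unfolding vertex_coeff_def by simp
qed

lemma vertex_coeff_zero:
  assumes "vector_space s" "\<And>k. 0 < k \<Longrightarrow> A k 0 = 0" "\<And>k. 0 < k \<Longrightarrow> B k 0 = 0" "\<And>m. C m 0 = 0"
  shows "vertex_coeff s A B C r 0 = 0"
proof -
  have "(\<lambda>(i, j, m). if 2 * (int i - int j) + m = r
        then exp_coeff s A i (exp_coeff s B j (C m 0)) else 0) = (\<lambda>_. 0)"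
    using assms by (auto simp: fun_eq_iff exp_coeff_zero)
  then show ?thesis
    unfolding vertex_coeff_def by simp
qed

lemma sum_mem:
  assumes "0 \<in> W" "\<And>x y. x \<in> W \<Longrightarrow> y \<in> W \<Longrightarrow> x + y \<in> W" "\<And>a. a \<in> F \<Longrightarrow> f a \<in> W"
  shows "sum f F \<in> W"
  using assms by (induction F rule: infinite_finite_induct) auto

text \<open>A sum over an infinite support is 0, hence a member of \<open>W\<close> as well.\<close>
lemma Sum_any_mem:
  assumes "0 \<in> W" "\<And>x y. x \<in> W \<Longrightarrow> y \<in> W \<Longrightarrow> x + y \<in> W" "\<And>a. f a \<in> W"
  shows "Sum_any f \<in> W"
  unfolding Sum_any.expand_set by (rule sum_mem) (use assms in auto)

(* 0 and 1 label the nodes of the Dynkin diagram and should stay numerals. *)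
declare One_nat_def [simp del]

section \<open>Decomposition into eigenvectors\<close>

lemma linear_Sum_any:
  assumes "Vector_Spaces.linear s1 s2 A" "finite {n. c n \<noteq> 0}"
  shows "A (Sum_any c) = Sum_any (\<lambda>n. A (c n))"
proof -
  have "Sum_any (\<lambda>n. A (c n)) = (\<Sum>n | c n \<noteq> 0. A (c n))"
    using assms(2) by (rule Sum_any.expand_superset) (auto simp: linear_simps[OF assms(1)])
  then show ?thesis
    by (simp add: Sum_any.expand_set linear_simps[OF assms(1)])
qed

context cq_space
begin

text \<open>
  For \<open>T = t\<^sub>i\<close> this is the property that characterizes \<open>h_component\<close>.
\<close>
definition eigen_decomposition :: "('v \<Rightarrow> 'v) \<Rightarrow> 'v \<Rightarrow> (int \<Rightarrow> 'v) \<Rightarrow> bool" where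
  "eigen_decomposition T x c \<longleftrightarrow>
     finite {n. c n \<noteq> 0} \<and> (\<forall>n. T (c n) = scale (q powi n) (c n)) \<and> x = Sum_any c"

lemma eigen_decomposition_unique:
  assumes T: "endo T" and c: "eigen_decomposition T x c" and c': "eigen_decomposition T x c'"
  shows "c = c'"
proof
  fix n
  define F where "F = insert n ({n. c n \<noteq> 0} \<union> {n. c' n \<noteq> 0})"
  have F: "finite F"
    using c c' by (simp add: F_def eigen_decomposition_def)
  have "x = sum c F" "x = sum c' F"
    using c c' Sum_any.expand_superset[OF F, of c] Sum_any.expand_superset[OF F, of c']
    by (auto simp: F_def eigen_decomposition_def)
  then have "(\<Sum>n\<in>F. c n - c' n) = 0"
    by (simp add: sum_subtractf)
  then have "\<forall>n\<in>F. c n - c' n = 0"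
    using c c' by (intro eigenvectors_independent[OF T F, where r = "\<lambda>n. q powi n"])
      (auto simp: inj_on_def eigen_decomposition_def linear_simps[OF T] scale_right_diff_distrib)
  then show "c n = c' n"
    by (simp add: F_def)
qed

lemma eigen_decomposition_eigenvector:
  assumes T: "endo T" and "T x = scale (q powi n) x"
  shows "eigen_decomposition T x (\<lambda>k. if k = n then x else 0)"
proof -
  have "finite {k. (if k = n then x else 0) \<noteq> 0}"
    by (rule finite_subset[of _ "{n}"]) auto
  then show ?thesis
    unfolding eigen_decomposition_def using assms by (auto simp: linear_simps[OF T])
qed

lemma eigen_decomposition_add:
  assumes T: "endo T" and c: "eigen_decomposition T x c" and c': "eigen_decomposition T y c'"
  shows "eigen_decomposition T (x + y) (\<lambda>n. c n + c' n)"
proof -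
  have "finite {n. c n + c' n \<noteq> 0}"
    by (rule finite_subset[of _ "{n. c n \<noteq> 0} \<union> {n. c' n \<noteq> 0}"])
      (use c c' in \<open>auto simp: eigen_decomposition_def\<close>)
  then show ?thesis
    using c c' unfolding eigen_decomposition_def
    by (auto simp: linear_simps[OF T] scale_right_distrib Sum_any.distrib)
qed

lemma eigen_decomposition_scale:
  assumes T: "endo T" and c: "eigen_decomposition T x c"
  shows "eigen_decomposition T (scale a x) (\<lambda>n. scale a (c n))"
proof -
  have "finite {n. scale a (c n) \<noteq> 0}"
    by (rule finite_subset[of _ "{n. c n \<noteq> 0}"]) (use c in \<open>auto simp: eigen_decomposition_def\<close>)
  then show ?thesis
    using c unfolding eigen_decomposition_def
    by (auto simp: linear_simps[OF T] scale_left_commute linear_Sum_any[OF linear_scale_self])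
qed

lemma eigen_decomposition_span:
  assumes T: "endo T" and S: "\<And>w. w \<in> S \<Longrightarrow> \<exists>n\<in>Z. T w = scale (q powi n) w" and x: "x \<in> span S"
  shows "\<exists>c. eigen_decomposition T x c \<and> (\<forall>n. n \<notin> Z \<longrightarrow> c n = 0)"
proof -
  let ?P = "\<lambda>x. \<exists>c. eigen_decomposition T x c \<and> (\<forall>n. n \<notin> Z \<longrightarrow> c n = 0)"
  have "?P x"
    using x
  proof (induction rule: span_induct)
    case base
    show ?case
    proof (intro subspaceI CollectI)
      show "?P 0"
        by (rule exI[of _ "\<lambda>_. 0"]) (simp add: eigen_decomposition_def linear_simps[OF T])
      fix x y a
      assume "x \<in> Collect ?P"
      then obtain c where c: "eigen_decomposition T x c" "\<forall>n. n \<notin> Z \<longrightarrow> c n = 0"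
        by blast
      then show "?P (scale a x)"
        using eigen_decomposition_scale[OF T, of x c a] by auto
      assume "y \<in> Collect ?P"
      then obtain c' where "eigen_decomposition T y c'" "\<forall>n. n \<notin> Z \<longrightarrow> c' n = 0"
        by blast
      then show "?P (x + y)"
        using eigen_decomposition_add[OF T c(1), of y c'] c(2) by auto
    qed
  next
    case (step w)
    then obtain n where "n \<in> Z" "T w = scale (q powi n) w"
      using S by blast
    then show "?P w"
      using eigen_decomposition_eigenvector[OF T] by (intro exI[of _ "\<lambda>k. if k = n then w else 0"]) auto
  qed
  then show ?thesis .
qed

end

section \<open>Highest weight modules of affine \<open>sl\<^sub>2\<close>\<close>

text \<open>
  The induction step for \<open>e f\<^sup>n v = [n] [c - n + 1] f\<^bsup>n-1\<^esup> v\<close>, where \<open>v\<close> is a highest weight vector with \<open>h v = c v\<close>.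
\<close>
lemma qint_string:
  "qint n * qint (c - n + 1) + qint (c - 2 * n) = qint (n + 1) * qint (c - n)"
proof -
  define A B where "A = q powi n" and "B = q powi c"
  have nz: "A \<noteq> 0" "B \<noteq> 0" "q * q - 1 \<noteq> 0"
    using q_powi_eq_1[of 2] by (simp_all add: A_def B_def power2_eq_square)
  have *: "q powi n = A" "q powi (- n) = 1 / A" "q powi (c - n + 1) = B * q / A"
    "q powi (- (c - n + 1)) = A / (B * q)" "q powi (c - 2 * n) = B / (A * A)"
    "q powi (- (c - 2 * n)) = A * A / B" "q powi (n + 1) = A * q" "q powi (- (n + 1)) = 1 / (A * q)"
    "q powi (c - n) = B / A" "q powi (- (c - n)) = A / B" "q powi (- 1) = 1 / q"
    by (simp_all add: A_def B_def power_int_minus power_int_add power_int_diff power_int_mult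
        power_mult_distrib power2_eq_square field_simps)
  show ?thesis
    unfolding qint_def * using nz by (simp add: divide_simps) (simp add: algebra_simps)
qed

locale hw_module =
  fixes m :: "'v::ab_group_add sl2_ops" and \<nu> :: wt and vac :: 'v
  assumes hw: "irreducible_hw_module m \<nu> vac"
begin

sublocale cq_space "mscale m"
  using hw unfolding irreducible_hw_module_def uq_sl2hat_module_def cq_space_def by blast

lemma module_axioms:
  shows endo_e [simp]: "i \<in> {0, 1} \<Longrightarrow> endo (me m i)"
    and endo_f [simp]: "i \<in> {0, 1} \<Longrightarrow> endo (mf m i)"
    and endo_t [simp]: "i \<in> {0, 1} \<Longrightarrow> endo (mt m i)"
    and endo_d [simp]: "endo (mqd m)"
    and endo_x [simp]: "\<epsilon> \<in> {1, - 1} \<Longrightarrow> endo (mx m \<epsilon> k)"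
    and endo_a [simp]: "l \<noteq> 0 \<Longrightarrow> endo (ma m l)"
    and chev: "chevalley_relations m" and drin: "drinfeld_relations q m"
    and ident: "drinfeld_identification q m"
proof -
  note h2 = hw[unfolded irreducible_hw_module_def uq_sl2hat_module_def, THEN conjunct1]
  note h3 = h2[THEN conjunct2] note h4 = h3[THEN conjunct2]
  have lin: "\<forall>A \<in> me m ` {0, 1} \<union> mf m ` {0, 1} \<union> mt m ` {0, 1} \<union> {mqd m}
      \<union> {mx m \<epsilon> k | \<epsilon> k. \<epsilon> \<in> {1, - 1}} \<union> {ma m l | l. l \<noteq> 0}. endo A"
    by (rule h3[THEN conjunct1])
  note l = lin[unfolded ball_Un]
  note l2 = l[THEN conjunct1] note l3 = l2[THEN conjunct1] note l4 = l3[THEN conjunct1]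
  note l5 = l4[THEN conjunct1]
  show "i \<in> {0, 1} \<Longrightarrow> endo (me m i)"
    by (rule l5[THEN conjunct1, THEN bspec, OF imageI])
  show "i \<in> {0, 1} \<Longrightarrow> endo (mf m i)"
    by (rule l5[THEN conjunct2, THEN bspec, OF imageI])
  show "i \<in> {0, 1} \<Longrightarrow> endo (mt m i)"
    by (rule l4[THEN conjunct2, THEN bspec, OF imageI])
  show "endo (mqd m)"
    by (rule l3[THEN conjunct2, THEN bspec, OF singletonI])
  show "\<epsilon> \<in> {1, - 1} \<Longrightarrow> endo (mx m \<epsilon> k)"
    by (rule l2[THEN conjunct2, THEN bspec], rule CollectI, intro exI conjI, rule refl, assumption)
  show "l \<noteq> 0 \<Longrightarrow> endo (ma m l)"
    by (rule l[THEN conjunct2, THEN bspec], rule CollectI, intro exI conjI, rule refl, assumption)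
  show "chevalley_relations m" "drinfeld_relations q m" "drinfeld_identification q m"
    by (rule h4[THEN conjunct1] h4[THEN conjunct2, THEN conjunct1] h4[THEN conjunct2, THEN conjunct2])+
qed

lemma chevalley:
  shows bij_t [simp]: "i \<in> {0, 1} \<Longrightarrow> bij (mt m i)" and bij_d [simp]: "bij (mqd m)"
    and dt: "i \<in> {0, 1} \<Longrightarrow> mqd m (mt m i x) = mt m i (mqd m x)"
    and tf: "i \<in> {0, 1} \<Longrightarrow> j \<in> {0, 1} \<Longrightarrow>
      mt m i (mf m j x) = mscale m (q powi (- sl2_cartan i j)) (mf m j (mt m i x))"
    and ef: "i \<in> {0, 1} \<Longrightarrow> j \<in> {0, 1} \<Longrightarrow> me m i (mf m j x) - mf m j (me m i x) =
      (if i = j then mscale m (1 / (q - q powi (- 1))) (mt m i x - inv (mt m i) x) else 0)"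
    and de: "mqd m (me m 0 x) = mscale m q (me m 0 (mqd m x))" "mqd m (me m 1 x) = me m 1 (mqd m x)"
    and df: "mqd m (mf m 0 x) = mscale m (q powi (- 1)) (mf m 0 (mqd m x))"
      "mqd m (mf m 1 x) = mf m 1 (mqd m x)"
    and serre_f: "i \<in> {0, 1} \<Longrightarrow> j \<in> {0, 1} \<Longrightarrow> i \<noteq> j \<Longrightarrow>
      mf m i (mf m i (mf m i (mf m j x))) - mscale m (qint 3) (mf m i (mf m i (mf m j (mf m i x))))
        + mscale m (qint 3) (mf m i (mf m j (mf m i (mf m i x)))) - mf m j (mf m i (mf m i (mf m i x))) = 0"
proof -
  note c = chev[unfolded chevalley_relations_def Let_def]
  note c2 = c[THEN conjunct2] note c3 = c2[THEN conjunct2] note c4 = c3[THEN conjunct2]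
  note c5 = c4[THEN conjunct2] note c6 = c5[THEN conjunct2] note c7 = c6[THEN conjunct2]
  show "i \<in> {0, 1} \<Longrightarrow> bij (mt m i)"
    using c[THEN conjunct1] by blast
  show "bij (mqd m)"
    by (rule c2[THEN conjunct1])
  show "i \<in> {0, 1} \<Longrightarrow> mqd m (mt m i x) = mt m i (mqd m x)"
    by (rule c4[THEN conjunct1, THEN bspec, THEN spec])
  note c5' = c5[THEN conjunct1, THEN bspec, THEN bspec, THEN spec]
  show "i \<in> {0, 1} \<Longrightarrow> j \<in> {0, 1} \<Longrightarrow>
      mt m i (mf m j x) = mscale m (q powi (- sl2_cartan i j)) (mf m j (mt m i x))"
    by (rule c5'[THEN conjunct2, THEN conjunct1])
  show "i \<in> {0, 1} \<Longrightarrow> j \<in> {0, 1} \<Longrightarrow> me m i (mf m j x) - mf m j (me m i x) =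
      (if i = j then mscale m (1 / (q - q powi (- 1))) (mt m i x - inv (mt m i) x) else 0)"
    by (rule c5'[THEN conjunct2, THEN conjunct2])
  note c6' = c6[THEN conjunct1, THEN spec]
  show "mqd m (me m 0 x) = mscale m q (me m 0 (mqd m x))" "mqd m (me m 1 x) = me m 1 (mqd m x)"
    "mqd m (mf m 0 x) = mscale m (q powi (- 1)) (mf m 0 (mqd m x))" "mqd m (mf m 1 x) = mf m 1 (mqd m x)"
    by (rule c6'[THEN conjunct1] c6'[THEN conjunct2, THEN conjunct1]
        c6'[THEN conjunct2, THEN conjunct2, THEN conjunct1] c6'[THEN conjunct2, THEN conjunct2, THEN conjunct2])+
  have "i \<in> {0, 1} \<Longrightarrow> j \<in> {0, 1} \<Longrightarrow> i \<noteq> j \<Longrightarrow> mf m \<in> {me m, mf m} \<Longrightarrow>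
      mf m i (mf m i (mf m i (mf m j x))) - mscale m (qint 3) (mf m i (mf m i (mf m j (mf m i x))))
        + mscale m (qint 3) (mf m i (mf m j (mf m i (mf m i x)))) - mf m j (mf m i (mf m i (mf m i x))) = 0"
    by (rule c7[THEN bspec, THEN bspec, THEN mp, THEN bspec, THEN spec])
  then show "i \<in> {0, 1} \<Longrightarrow> j \<in> {0, 1} \<Longrightarrow> i \<noteq> j \<Longrightarrow>
      mf m i (mf m i (mf m i (mf m j x))) - mscale m (qint 3) (mf m i (mf m i (mf m j (mf m i x))))
        + mscale m (qint 3) (mf m i (mf m j (mf m i (mf m i x)))) - mf m j (mf m i (mf m i (mf m i x))) = 0"
    by simp
qed

lemma drinfeld:
  shows Ka: "k \<noteq> 0 \<Longrightarrow> mt m 1 (ma m k x) = ma m k (mt m 1 x)"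
    and ax: "\<epsilon> \<in> {1, - 1} \<Longrightarrow> k \<noteq> 0 \<Longrightarrow> ma m k (mx m \<epsilon> l x) - mx m \<epsilon> l (ma m k x) =
      mscale m (of_int \<epsilon> * (qint (2 * k) / of_int k) * q powi (- \<epsilon> * \<bar>k\<bar>)) (mx m \<epsilon> (k + l) x)"
    and xx: "mx m 1 k (mx m (- 1) l x) - mx m (- 1) l (mx m 1 k x) =
      mscale m (1 / (q - q powi (- 1)))
       ((if 0 \<le> k + l
         then mscale m ((q\<^sup>2) powi (- l)) (mt m 1 (exp_coeff (mscale m)
            (\<lambda>n w. mscale m ((q - q powi (- 1)) * q ^ n) (ma m (int n) w)) (nat (k + l)) x))
         else 0)
        - (if k + l \<le> 0
           then mscale m ((q\<^sup>2) powi l) (inv (mt m 1) (exp_coeff (mscale m)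
            (\<lambda>n w. mscale m (- ((q - q powi (- 1)) * q ^ n)) (ma m (- int n) w)) (nat (- (k + l))) x))
           else 0))"
proof -
  note c = drin[unfolded drinfeld_relations_def Let_def]
  note c2 = c[THEN conjunct2] note c3 = c2[THEN conjunct2] note c4 = c3[THEN conjunct2]
  show "k \<noteq> 0 \<Longrightarrow> mt m 1 (ma m k x) = ma m k (mt m 1 x)"
    by (rule c2[THEN conjunct1, THEN spec, THEN spec, THEN mp])
  show "\<epsilon> \<in> {1, - 1} \<Longrightarrow> k \<noteq> 0 \<Longrightarrow> ma m k (mx m \<epsilon> l x) - mx m \<epsilon> l (ma m k x) =
      mscale m (of_int \<epsilon> * (qint (2 * k) / of_int k) * q powi (- \<epsilon> * \<bar>k\<bar>)) (mx m \<epsilon> (k + l) x)"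
    by (rule c4[THEN conjunct1, THEN bspec, THEN spec, THEN spec, THEN spec, THEN mp])
  show "mx m 1 k (mx m (- 1) l x) - mx m (- 1) l (mx m 1 k x) =
    mscale m (1 / (q - q powi (- 1)))
       ((if 0 \<le> k + l
         then mscale m ((q\<^sup>2) powi (- l)) (mt m 1 (exp_coeff (mscale m)
            (\<lambda>n w. mscale m ((q - q powi (- 1)) * q ^ n) (ma m (int n) w)) (nat (k + l)) x))
         else 0)
        - (if k + l \<le> 0
           then mscale m ((q\<^sup>2) powi l) (inv (mt m 1) (exp_coeff (mscale m)
            (\<lambda>n w. mscale m (- ((q - q powi (- 1)) * q ^ n)) (ma m (- int n) w)) (nat (- (k + l))) x))
           else 0))"
    by (rule c4[THEN conjunct2, THEN conjunct2, THEN spec, THEN spec, THEN spec])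
qed

lemma identification:
  shows t0t1: "mt m 0 (mt m 1 x) = mscale m (q\<^sup>2) x"
    and x_e1: "mx m 1 0 x = me m 1 x" and x_f1: "mx m (- 1) 0 x = mf m 1 x"
    and x_f0: "mx m 1 (- 1) x = mt m 0 (mf m 0 x)" and x_e0: "mx m (- 1) 1 x = me m 0 (inv (mt m 0) x)"
  using ident unfolding drinfeld_identification_def by auto

lemma inv_t [simp]:
  "i \<in> {0, 1} \<Longrightarrow> inv (mt m i) (mt m i x) = x" "i \<in> {0, 1} \<Longrightarrow> mt m i (inv (mt m i) x) = x"
  by (simp_all add: bij_is_inj bij_is_surj surj_f_inv_f)

lemma endo_inv_t [simp]: "i \<in> {0, 1} \<Longrightarrow> endo (inv (mt m i))"
  by (simp add: endo_inv)

lemma vac_nonzero: "vac \<noteq> 0"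
  and e_vac: "i \<in> {0, 1} \<Longrightarrow> me m i vac = 0"
  and t_vac: "i \<in> {0, 1} \<Longrightarrow> mt m i vac = mscale m (q powi wt_eval \<nu> i) vac"
  and d_vac: "mqd m vac = vac"
  and generates: "sl2_submodule m W \<Longrightarrow> vac \<in> W \<Longrightarrow> W = UNIV"
  and irreducible: "sl2_submodule m W \<Longrightarrow> W = {0} \<or> W = UNIV"
  using hw unfolding irreducible_hw_module_def by blast+

subsection \<open>Weights\<close>

definition weight_vector :: "int \<Rightarrow> int \<Rightarrow> int \<Rightarrow> 'v \<Rightarrow> bool" where
  "weight_vector a b d x \<longleftrightarrow> mt m 0 x = mscale m (q powi a) x \<and>
     mt m 1 x = mscale m (q powi b) x \<and> mqd m x = mscale m (q powi d) x"

lemma weight_vector_vac: "weight_vector (wt_eval \<nu> 0) (wt_eval \<nu> 1) 0 vac"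
  by (simp add: weight_vector_def t_vac d_vac)

lemma weight_vector_f:
  assumes "weight_vector a b d x"
  shows "weight_vector (a - 2) (b + 2) (d - 1) (mf m 0 x)" "weight_vector (a + 2) (b - 2) d (mf m 1 x)"
  using assms
  by (simp_all add: weight_vector_def tf df sl2_cartan_def linear_simps[OF endo_f] power_int_add
      power_int_diff power_int_minus field_simps)

lemma inv_t_eigen:
  assumes "i \<in> {0, 1}" "mt m i x = mscale m (q powi n) x"
  shows "inv (mt m i) x = mscale m (q powi (- n)) x"
proof -
  have "mt m i (mscale m (q powi (- n)) x) = x"
    using assms by (simp add: linear_simps[OF endo_t] power_int_minus)
  then show ?thesis
    using assms(1) by (metis inv_t(1))
qed

lemma inv_d_eigen:
  assumes "mqd m x = mscale m (q powi n) x"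
  shows "inv (mqd m) x = mscale m (q powi (- n)) x"
proof -
  have "mqd m (mscale m (q powi (- n)) x) = x"
    using assms by (simp add: linear_simps[OF endo_d] power_int_minus)
  then show ?thesis
    by (metis bij_d bij_inv_eq_iff)
qed

inductive_set words :: "'v \<Rightarrow> 'v set" for u :: 'v where
  base: "u \<in> words u"
| step: "w \<in> words u \<Longrightarrow> i \<in> {0, 1} \<Longrightarrow> mf m i w \<in> words u"

text \<open>
  The number \<open>4d + b\<close> attached to the eigenvalues \<open>q\<^sup>d\<close> of \<open>q\<^sup>d\<close> and \<open>q\<^sup>b\<close> of \<open>t\<^sub>1\<close> drops by 2 under both \<open>f\<^sub>0\<close>
  and \<open>f\<^sub>1\<close>; it measures the length of a word.
\<close>
lemma words_weight:
  assumes "weight_vector a b d u" "w \<in> words u"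
  shows "\<exists>a' b' d'. weight_vector a' b' d' w \<and> d' \<le> d \<and> 4 * d' + b' \<le> 4 * d + b"
  using assms(2)
proof induction
  case base
  then show ?case using assms(1) by blast
next
  case (step w i)
  then obtain a' b' d' where w: "weight_vector a' b' d' w" "d' \<le> d" "4 * d' + b' \<le> 4 * d + b"
    by blast
  have "i = 0 \<or> i = 1"
    using step by simp
  then show ?case
  proof
    assume "i = 0"
    then show ?thesis
      using weight_vector_f(1)[OF w(1)] w(2,3) by (intro exI conjI) (simp, simp_all)
  next
    assume "i = 1"
    then show ?thesis
      using weight_vector_f(2)[OF w(1)] w(2,3) by (intro exI conjI) (simp, simp_all)
  qed
qed

lemma span_invariant:
  assumes "endo A" "\<And>w. w \<in> S \<Longrightarrow> A w \<in> span S" "x \<in> span S"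
  shows "A x \<in> span S"
  using assms(3)
proof (induction rule: span_induct)
  case base
  show ?case
    by (intro subspaceI CollectI) (auto simp: linear_simps[OF assms(1)] intro: span_add span_scale span_zero)
next
  case (step w)
  then show ?case using assms(2) by blast
qed

lemma endo_inv_d [simp]: "endo (inv (mqd m))"
  by (simp add: endo_inv)

text \<open>
  The \<open>e\<^sub>j\<close> pass the \<open>f\<^sub>i\<close> of a word up to scalars, because all words are weight vectors, and finally kill \<open>u\<close>.
\<close>
lemma submodule_words:
  assumes u: "weight_vector a b d u" and sing: "\<And>i. i \<in> {0, 1} \<Longrightarrow> me m i u = 0"
  shows "sl2_submodule m (span (words u))"
proof -
  have eig: "\<exists>n. mt m i w = mscale m (q powi n) w" "\<exists>n. mqd m w = mscale m (q powi n) w"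
    if w: "w \<in> words u" and i: "i \<in> {0, 1}" for w i
  proof -
    obtain a' b' d' where "weight_vector a' b' d' w"
      using words_weight[OF u w] by blast
    then show "\<exists>n. mt m i w = mscale m (q powi n) w" "\<exists>n. mqd m w = mscale m (q powi n) w"
      using i unfolding weight_vector_def by blast+
  qed
  have f: "mf m i x \<in> span (words u)" if "i \<in> {0, 1}" "x \<in> span (words u)" for i x
    by (rule span_invariant[OF endo_f[OF that(1)] _ that(2)]) (intro span_base words.step that(1))
  have t: "mt m i w \<in> span (words u)" "inv (mt m i) w \<in> span (words u)"
    if w: "w \<in> words u" and i: "i \<in> {0, 1}" for w i
  proof -
    obtain n where "mt m i w = mscale m (q powi n) w"
      using eig(1)[OF w i] by blast
    then show "mt m i w \<in> span (words u)" "inv (mt m i) w \<in> span (words u)"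
      using inv_t_eigen[OF i, of w n] w by (auto intro: span_base span_scale)
  qed
  have d: "mqd m w \<in> span (words u)" "inv (mqd m) w \<in> span (words u)" if w: "w \<in> words u" for w
  proof -
    obtain n where "mqd m w = mscale m (q powi n) w"
      using eig(2)[OF w, of 0] by blast
    then show "mqd m w \<in> span (words u)" "inv (mqd m) w \<in> span (words u)"
      using inv_d_eigen[of w n] w by (auto intro: span_base span_scale)
  qed
  have e: "me m j w \<in> span (words u)" if "w \<in> words u" "j \<in> {0, 1}" for w j
    using that
  proof induction
    case base
    then show ?case using sing by (simp add: span_zero)
  next
    case (step w i)
    have "me m j (mf m i w) = mf m i (me m j w) +
        (if j = i then mscale m (1 / (q - q powi (- 1))) (mt m j w - inv (mt m j) w) else 0)"
      using ef[OF step.prems step.hyps(2), of w] by (simp add: algebra_simps)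
    also have "\<dots> \<in> span (words u)"
      using step t f by (auto intro!: span_add span_scale span_diff span_zero)
    finally show ?case .
  qed
  note invariant = span_invariant[where S = "words u"]
  show ?thesis
    unfolding sl2_submodule_def
  proof (intro conjI ballI)
    fix x assume x: "x \<in> span (words u)"
    show "mqd m x \<in> span (words u)" "inv (mqd m) x \<in> span (words u)"
      by (rule invariant[OF endo_d d(1) x] invariant[OF endo_inv_d d(2) x]; assumption)+
    fix i :: nat assume i: "i \<in> {0, 1}"
    show "me m i x \<in> span (words u)" "mf m i x \<in> span (words u)"
      "mt m i x \<in> span (words u)" "inv (mt m i) x \<in> span (words u)"
      by (rule invariant[OF endo_e[OF i] e[OF _ i] x] f[OF i x] invariant[OF endo_t[OF i] t(1)[OF _ i] x]
          invariant[OF endo_inv_t[OF i] t(2)[OF _ i] x]; assumption)+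
  qed (rule subspace_span)
qed

lemma span_words: "span (words vac) = UNIV"
  by (rule generates[OF submodule_words[OF weight_vector_vac e_vac]]) (auto intro: span_base words.base)

lemma subspace_eq_UNIV:
  assumes "subspace W" "vac \<in> W" "\<And>i x. i \<in> {0, 1} \<Longrightarrow> x \<in> W \<Longrightarrow> mf m i x \<in> W"
  shows "x \<in> W"
proof -
  have "w \<in> W" if "w \<in> words vac" for w
    using that by induction (use assms in auto)
  then show ?thesis
    using span_minimal[of "words vac" W] assms(1) span_words by auto
qed

lemma decomposition:
  assumes "endo T" "\<And>a b d w. w \<in> words vac \<Longrightarrow> weight_vector a b d w \<Longrightarrow> d \<le> 0 \<Longrightarrow>
    \<exists>n\<in>Z. T w = mscale m (q powi n) w"
  shows "\<exists>c. eigen_decomposition T x c \<and> (\<forall>n. n \<notin> Z \<longrightarrow> c n = 0)"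
proof (rule eigen_decomposition_span[OF assms(1)])
  fix w assume w: "w \<in> words vac"
  then obtain a b d where "weight_vector a b d w" "d \<le> 0"
    using words_weight[OF weight_vector_vac w] by blast
  then show "\<exists>n\<in>Z. T w = mscale m (q powi n) w"
    using assms(2) w by blast
qed (simp add: span_words)

text \<open>
  The words in \<open>f\<^sub>0\<close>, \<open>f\<^sub>1\<close> applied to the highest weight vector have degree at most 0.
\<close>
lemma positive_degree_zero:
  assumes "mqd m x = mscale m (q powi n) x" "n > 0"
  shows "x = 0"
proof -
  have "\<exists>c. eigen_decomposition (mqd m) x c \<and> (\<forall>n. n \<notin> {..0} \<longrightarrow> c n = 0)"
    by (rule decomposition[OF endo_d]) (unfold weight_vector_def, blast)
  then obtain c where c: "eigen_decomposition (mqd m) x c" "\<forall>n. n \<notin> {..0} \<longrightarrow> c n = 0"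
    by blast
  have "c = (\<lambda>k. if k = n then x else 0)"
    using eigen_decomposition_unique[OF endo_d c(1) eigen_decomposition_eigenvector[OF endo_d assms(1)]] .
  then show ?thesis
    using c(2) assms(2) by (metis atMost_iff not_le)
qed

text \<open>
  A nonzero \<open>u\<close> would generate \<open>V(\<nu>)\<close> by irreducibility, but \<open>4d + b\<close> is smaller on all
  words in \<open>u\<close> than on the highest weight vector.
\<close>
lemma singular_zero:
  assumes u: "weight_vector a b d u" and sing: "\<And>i. i \<in> {0, 1} \<Longrightarrow> me m i u = 0"
    and less: "4 * d + b < wt_eval \<nu> 1"
  shows "u = 0"
proof (rule ccontr)
  assume "u \<noteq> 0"
  then have "span (words u) \<noteq> {0}"
    using span_base[OF words.base, of u] by auto
  then have "vac \<in> span (words u)"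
    using irreducible[OF submodule_words[OF u sing]] by auto
  define T where "T = (\<lambda>x. mqd m (mqd m (mqd m (mqd m (mt m 1 x)))))"
  have T: "endo T"
    unfolding T_def by (rule endo_compose[OF endo_d endo_compose[OF endo_d endo_compose[OF endo_d
      endo_compose[OF endo_d endo_t]]]]) simp
  have Tw: "T w = mscale m (q powi (4 * d + b)) w" if "weight_vector a b d w" for a b d w
  proof -
    have "q powi (4 * d + b) = q powi b * (q powi d * (q powi d * (q powi d * q powi d)))"
      by (simp flip: power_int_add)
    then show ?thesis
      using that by (simp add: T_def weight_vector_def linear_simps[OF endo_d])
  qed
  obtain c where c: "eigen_decomposition T vac c" "\<forall>n. n \<notin> {..<wt_eval \<nu> 1} \<longrightarrow> c n = 0"
  proof (rule exE[OF eigen_decomposition_span[OF T _ \<open>vac \<in> span (words u)\<close>]])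
    fix w assume "w \<in> words u"
    then obtain a' b' d' where "weight_vector a' b' d' w" "4 * d' + b' \<le> 4 * d + b"
      using words_weight[OF u] by blast
    then show "\<exists>n\<in>{..<wt_eval \<nu> 1}. T w = mscale m (q powi n) w"
      using Tw less by (intro bexI[of _ "4 * d' + b'"]) auto
  qed blast
  have "c = (\<lambda>k. if k = wt_eval \<nu> 1 then vac else 0)"
    using Tw[OF weight_vector_vac]
    by (intro eigen_decomposition_unique[OF T c(1) eigen_decomposition_eigenvector[OF T]]) simp
  then have "vac = 0"
    using c(2) by (metis lessThan_iff less_irrefl)
  then show False
    using vac_nonzero by simp
qed

definition f_string :: "nat \<Rightarrow> nat \<Rightarrow> 'v" where
  "f_string i n = (mf m i ^^ n) vac"

lemma f_string_0 [simp]: "f_string i 0 = vac"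
  and f_string_Suc: "f_string i (Suc n) = mf m i (f_string i n)"
  by (simp_all add: f_string_def)

lemma d_f_string_1: "mqd m (f_string 1 n) = f_string 1 n"
  by (induction n) (simp_all add: f_string_Suc d_vac df)

lemma t_f_string:
  assumes "i \<in> {0, 1}"
  shows "mt m i (f_string i n) = mscale m (q powi (wt_eval \<nu> i - 2 * int n)) (f_string i n)"
proof (induction n)
  case 0
  then show ?case using assms by (simp add: t_vac)
next
  case (Suc n)
  then show ?case
    by (simp add: f_string_Suc tf[OF assms assms] linear_simps[OF endo_f[OF assms]] sl2_cartan_def
        flip: power_int_add)
qed

lemma weight_vector_f_string:
  "\<exists>a b d. weight_vector a b d (f_string i n) \<and> 4 * d + b = wt_eval \<nu> 1 - 2 * int n" if i: "i \<in> {0, 1}"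
proof (induction n)
  case 0
  then show ?case using weight_vector_vac by (intro exI conjI) (simp, simp)
next
  case (Suc n)
  then obtain a b d where w: "weight_vector a b d (f_string i n)" "4 * d + b = wt_eval \<nu> 1 - 2 * int n"
    by blast
  consider "i = 0" | "i = 1"
    using i by blast
  then show ?case
  proof cases
    case 1
    then show ?thesis
      unfolding f_string_Suc using weight_vector_f(1)[OF w(1)] w(2) by (intro exI conjI) (simp, simp)
  next
    case 2
    then show ?thesis
      unfolding f_string_Suc using weight_vector_f(2)[OF w(1)] w(2) by (intro exI conjI) (simp, simp)
  qed
qed

lemma e_f_string:
  assumes i: "i \<in> {0, 1}"
  shows "me m i (f_string i n) =
    mscale m (qint (int n) * qint (wt_eval \<nu> i - int n + 1)) (f_string i (n - 1))"
proof (induction n)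
  case 0
  then show ?case using i by (simp add: e_vac qint_def)
next
  case (Suc n)
  define c where "c = wt_eval \<nu> i"
  have f: "mf m i (mscale m (qint (int n) * a) (f_string i (n - 1))) =
      mscale m (qint (int n) * a) (f_string i n)" for a
    by (cases n) (simp_all add: qint_def linear_simps[OF endo_f[OF i]] f_string_Suc)
  have "me m i (f_string i (Suc n)) = mf m i (me m i (f_string i n))
      + mscale m (1 / (q - q powi (- 1))) (mt m i (f_string i n) - inv (mt m i) (f_string i n))"
    using ef[OF i i, of "f_string i n"] by (simp add: f_string_Suc algebra_simps)
  also have "\<dots> = mscale m (qint (int n) * qint (c - int n + 1) + qint (c - 2 * int n)) (f_string i n)"
    using inv_t_eigen[OF i t_f_string[OF i, of n]]
    by (simp add: Suc f t_f_string[OF i] qint_def[of "c - 2 * int n"] scale_left_distrib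
        diff_divide_distrib scale_left_diff_distrib scale_right_diff_distrib flip: c_def)
  also have "\<dots> = mscale m (qint (int (Suc n)) * qint (c - int (Suc n) + 1)) (f_string i n)"
    using qint_string[of "int n" c] by (simp add: add.commute)
  finally show ?case
    by (simp add: c_def)
qed

text \<open>
  The vector \<open>f\<^sub>i\<^bsup>c+1\<^esup> v\<close>, \<open>c = \<langle>\<nu>, h\<^sub>i\<rangle>\<close>, is annihilated by both \<open>e\<^sub>0\<close> and \<open>e\<^sub>1\<close>.
\<close>
lemma f_string_end:
  assumes i: "i \<in> {0, 1}" and n: "int n = wt_eval \<nu> i + 1"
  shows "f_string i n = 0"
proof -
  have "me m j (f_string i k) = 0" if "j \<in> {0, 1}" "j \<noteq> i" for j k
  proof (induction k)
    case 0
    then show ?case using that by (simp add: e_vac)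
  next
    case (Suc k)
    then show ?case
      using ef[OF that(1) i, of "f_string i k"] that linear_simps(2)[OF endo_f[OF i]]
      by (simp add: f_string_Suc)
  qed
  moreover have "me m i (f_string i n) = 0"
    using n by (simp add: e_f_string[OF i] qint_def)
  ultimately have e: "me m j (f_string i n) = 0" if "j \<in> {0, 1}" for j
    using that by metis
  obtain a b d where "weight_vector a b d (f_string i n)" "4 * d + b = wt_eval \<nu> 1 - 2 * int n"
    using weight_vector_f_string[OF i] by blast
  moreover have "n > 0"
    using n by (cases \<nu>) (auto split: if_splits)
  ultimately show ?thesis
    using singular_zero e by simp
qed

subsection \<open>Local nilpotence\<close>

text \<open>The Serre relation moves \<open>f\<^sub>1\<close> to within two steps of the left end of \<open>f\<^sub>0\<^sup>n f\<^sub>1\<close>.\<close>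
lemma f0_power_f1:
  assumes "(mf m 0 ^^ N) x = 0"
  shows "(mf m 0 ^^ (N + 2)) (mf m 1 x) = 0"
proof -
  let ?f = "mf m 0"
  note [simp] = linear_simps[OF endo_funpow[OF endo_f[of 0]]]
  have "(?f ^^ a) (mf m 1 ((?f ^^ b) x)) = 0" if "a + b = N + 2" for a b
    using that
  proof (induction a arbitrary: b rule: less_induct)
    case (less a)
    show ?case
    proof (cases "a \<le> 2")
      case True
      then have "(?f ^^ b) x = 0"
        using funpow_zero_mono[OF endo_f assms, of b] less.prems by simp
      then show ?thesis
        by (simp add: linear_simps[OF endo_f])
    next
      case False
      define k where "k = a - 3"
      have a: "a = Suc (Suc (Suc k))"
        using False by (simp add: k_def)
      let ?y = "(?f ^^ b) x"
      have *: "?f (?f (?f (mf m 1 ?y))) = mscale m (qint 3) (?f (?f (mf m 1 (?f ?y))))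
          - mscale m (qint 3) (?f (mf m 1 (?f (?f ?y)))) + mf m 1 (?f (?f (?f ?y)))"
        using serre_f[of 0 1 ?y] by (simp add: algebra_simps)
      have "(?f ^^ Suc (Suc k)) (mf m 1 ((?f ^^ Suc b) x)) = 0"
        "(?f ^^ Suc k) (mf m 1 ((?f ^^ Suc (Suc b)) x)) = 0"
        "(?f ^^ k) (mf m 1 ((?f ^^ Suc (Suc (Suc b))) x)) = 0"
        by (rule less.IH; use a less.prems in simp)+
      then show ?thesis
        unfolding a funpow_Suc_right comp_apply * by (simp add: funpow_swap1)
    qed
  qed
  from this[of "N + 2" 0] show ?thesis
    by simp
qed

text \<open>
  Holds for the highest weight vector as its \<open>f\<^sub>0\<close>-string ends, and is inherited by \<open>f\<^sub>0 w\<close> and \<open>f\<^sub>1 w\<close>.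
\<close>
lemma nilpotent_f0: "nilpotent_at (mf m 0) x"
proof -
  have "nilpotent_at (mf m 0) w" if "w \<in> words vac" for w
    using that
  proof induction
    case base
    show ?case
      using f_string_end[of 0 "nat (wt_eval \<nu> 0 + 1)"]
      unfolding nilpotent_at_def f_string_def by (intro exI[of _ "nat (wt_eval \<nu> 0 + 1)"]) (cases \<nu>, simp_all)
  next
    case (step w i)
    then obtain N where N: "(mf m 0 ^^ N) w = 0"
      unfolding nilpotent_at_def by blast
    consider "i = 0" | "i = 1"
      using step by blast
    then show ?case
    proof cases
      case 1
      have "(mf m 0 ^^ N) (mf m 0 w) = 0"
        using N by (simp add: funpow_swap1[symmetric] linear_simps[OF endo_f])
      then show ?thesis
        using 1 unfolding nilpotent_at_def by blast
    next
      case 2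
      then show ?thesis
        using f0_power_f1[OF N] unfolding nilpotent_at_def by blast
    qed
  qed
  then have "span (words vac) \<subseteq> {x. nilpotent_at (mf m 0) x}"
    by (intro span_minimal subspace_nilpotent) auto
  then show ?thesis
    using span_words by blast
qed

definition has_degree :: "int \<Rightarrow> ('v \<Rightarrow> 'v) \<Rightarrow> bool" where
  "has_degree k A \<longleftrightarrow> endo A \<and> (\<forall>x. mqd m (A x) = mscale m (q powi k) (A (mqd m x)))"

lemma has_degree_compose: "has_degree k A \<Longrightarrow> has_degree l B \<Longrightarrow> has_degree (k + l) (\<lambda>x. A (B x))"
  unfolding has_degree_def using endo_compose by (simp add: linear_simps(3)[of "mscale m" "mscale m"] power_int_add)

lemma has_degree_scale: "has_degree k A \<Longrightarrow> has_degree k (\<lambda>x. mscale m c (A x))"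
  unfolding has_degree_def using endo_scale
  by (simp add: linear_simps[OF endo_d] scale_left_commute)

lemma has_degree_diff:
  assumes "has_degree k A" "has_degree k B"
  shows "has_degree k (\<lambda>x. A x - B x)"
proof -
  have "endo (\<lambda>x. A x - B x)"
    using assms unfolding has_degree_def
    by (intro linearI vector_space_axioms) (simp_all add: linear_simps(1,3)[of "mscale m" "mscale m"] scale_right_diff_distrib)
  then show ?thesis
    using assms unfolding has_degree_def by (simp add: linear_simps[OF endo_d] scale_right_diff_distrib)
qed

lemma has_degree_t: "i \<in> {0, 1} \<Longrightarrow> has_degree 0 (mt m i)"
  unfolding has_degree_def by (simp add: dt)

lemma has_degree_inv_t:
  assumes "i \<in> {0, 1}"
  shows "has_degree 0 (inv (mt m i))"
proof -
  have "mqd m (inv (mt m i) x) = inv (mt m i) (mqd m x)" for x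
    using dt[OF assms, of "inv (mt m i) x"] inv_t assms by metis
  then show ?thesis
    unfolding has_degree_def using assms by simp
qed

lemma has_degree_chevalley:
  "has_degree 1 (me m 0)" "has_degree 0 (me m 1)" "has_degree (- 1) (mf m 0)" "has_degree 0 (mf m 1)"
  unfolding has_degree_def by (simp_all add: de df)

text \<open>No vector has positive degree, so an operator that raises the degree is locally nilpotent.\<close>
lemma nilpotent_degree_1:
  assumes "has_degree 1 A"
  shows "nilpotent_at A x"
proof -
  have A: "endo A"
    using assms by (simp add: has_degree_def)
  have "nilpotent_at A w" if w: "w \<in> words vac" for w
  proof -
    obtain a b d where "weight_vector a b d w"
      using words_weight[OF weight_vector_vac w] by blast
    then have d: "mqd m w = mscale m (q powi d) w"
      by (simp add: weight_vector_def)
    have "mqd m ((A ^^ n) w) = mscale m (q powi (d + int n)) ((A ^^ n) w)" for n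
    proof (induction n)
      case (Suc n)
      then show ?case
        using assms by (simp add: has_degree_def linear_simps[OF A] power_int_add mult_ac)
    qed (simp add: d)
    then have "(A ^^ nat (1 - d)) w = 0" if "d \<le> 0"
      using positive_degree_zero[of "(A ^^ nat (1 - d)) w" "d + int (nat (1 - d))"] that by simp
    moreover have "w = 0" if "d > 0"
      using positive_degree_zero[OF d that] .
    ultimately show ?thesis
      unfolding nilpotent_at_def by (metis funpow_0 linorder_not_le)
  qed
  then have "span (words vac) \<subseteq> {x. nilpotent_at A x}"
    by (intro span_minimal subspace_nilpotent[OF A]) auto
  then show ?thesis
    using span_words by blast
qed

subsection \<open>Degrees of the Drinfeld generators\<close>

lemma x_commutator_1: "mx m 1 0 (mx m (- 1) 1 x) - mx m (- 1) 1 (mx m 1 0 x) =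
    mscale m (q powi (- 1)) (mt m 1 (ma m 1 x))"
proof -
  let ?A = "\<lambda>n w. mscale m ((q - q powi (- 1)) * q ^ n) (ma m (int n) w)"
  have "exp_coeff (mscale m) ?A 1 x = ?A 1 x"
    by (rule exp_coeff_first) (simp_all add: vector_space_axioms linear_simps[OF endo_a])
  then show ?thesis
    using xx[of 0 1 x] unfolding One_nat_def
    by (simp add: linear_simps[OF endo_t] power_int_minus power2_eq_square del: minus_diff_eq)
qed

lemma x_commutator_minus_1: "mx m 1 (- 1) (mx m (- 1) 0 x) - mx m (- 1) 0 (mx m 1 (- 1) x) =
    mscale m q (inv (mt m 1) (ma m (- 1) x))"
proof -
  let ?A = "\<lambda>n w. mscale m (- ((q - q powi (- 1)) * q ^ n)) (ma m (- int n) w)"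
  have "exp_coeff (mscale m) ?A 1 x = ?A 1 x"
    by (rule exp_coeff_first) (simp_all add: vector_space_axioms linear_simps[OF endo_a])
  then show ?thesis
    using xx[of "- 1" 0 x] unfolding One_nat_def
    by (simp add: linear_simps[OF endo_inv_t] power_int_minus power2_eq_square del: minus_diff_eq)
qed

lemma has_degree_a_1: "has_degree 1 (ma m 1)"
proof -
  have "ma m 1 = (\<lambda>x. mscale m q (inv (mt m 1)
      (me m 1 (me m 0 (inv (mt m 0) x)) - me m 0 (inv (mt m 0) (me m 1 x)))))"
    using x_commutator_1
    by (simp add: fun_eq_iff x_e1 x_e0 linear_simps[OF endo_inv_t] power_int_minus)
  moreover have "has_degree (0 + (0 + (1 + 0))) (\<lambda>x. inv (mt m 1) (me m 1 (me m 0 (inv (mt m 0) x))))"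
    "has_degree (0 + (1 + (0 + 0))) (\<lambda>x. inv (mt m 1) (me m 0 (inv (mt m 0) (me m 1 x))))"
    by (intro has_degree_compose has_degree_inv_t has_degree_chevalley; simp)+
  ultimately show ?thesis
    using has_degree_scale[OF has_degree_diff] by (simp add: linear_simps[OF endo_inv_t])
qed

lemma has_degree_a_minus_1: "has_degree (- 1) (ma m (- 1))"
proof -
  have "ma m (- 1) = (\<lambda>x. mscale m (q powi (- 1)) (mt m 1
      (mt m 0 (mf m 0 (mf m 1 x)) - mf m 1 (mt m 0 (mf m 0 x)))))"
    using x_commutator_minus_1
    by (simp add: fun_eq_iff x_f1 x_f0 linear_simps[OF endo_t] power_int_minus)
  moreover have "has_degree (0 + (0 + (- 1 + 0))) (\<lambda>x. mt m 1 (mt m 0 (mf m 0 (mf m 1 x))))"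
    "has_degree (0 + (0 + (0 + (- 1)))) (\<lambda>x. mt m 1 (mf m 1 (mt m 0 (mf m 0 x))))"
    by (intro has_degree_compose has_degree_t has_degree_chevalley; simp)+
  ultimately show ?thesis
    using has_degree_scale[OF has_degree_diff] by (simp add: linear_simps[OF endo_t])
qed

text \<open>
  \<open>[a(k), x\<^sup>\<plusminus>(l)]\<close> is a nonzero multiple of \<open>x\<^sup>\<plusminus>(k + l)\<close>. For \<open>k = \<plusminus>1\<close> the degree of \<open>a(k)\<close> is known, because \<open>a(k)\<close> is a
  commutator of Chevalley generators up to Cartan factors.
\<close>
lemma x_step:
  assumes \<epsilon>: "\<epsilon> \<in> {1, - 1}" and k: "k \<in> {1, - 1}" and "has_degree k (ma m k)" "has_degree l (mx m \<epsilon> l)"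
  shows "has_degree (k + l) (mx m \<epsilon> (k + l))"
proof -
  define c where "c = of_int \<epsilon> * (qint (2 * k) / of_int k) * q powi (- \<epsilon> * \<bar>k\<bar>)"
  have "c \<noteq> 0" and k0: "k \<noteq> 0"
    using k \<epsilon> by (auto simp: c_def)
  then have "mx m \<epsilon> (k + l) = (\<lambda>x. mscale m (1 / c) (ma m k (mx m \<epsilon> l x) - mx m \<epsilon> l (ma m k x)))"
    using ax[OF \<epsilon> k0, of l, folded c_def] by (simp add: fun_eq_iff)
  moreover have "has_degree (k + l) (\<lambda>x. mx m \<epsilon> l (ma m k x))"
    using has_degree_compose[OF assms(4,3)] by (simp add: add.commute)
  ultimately show ?thesis
    using has_degree_scale[OF has_degree_diff[OF has_degree_compose[OF assms(3,4)]], of _ "1 / c"] by simp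
qed

lemma has_degree_x:
  assumes \<epsilon>: "\<epsilon> \<in> {1, - 1}"
  shows "has_degree k (mx m \<epsilon> k)"
proof (induction k rule: int_induct[where k = 0])
  case base
  have "mx m 1 0 = me m 1" "mx m (- 1) 0 = mf m 1"
    by (simp_all add: fun_eq_iff x_e1 x_f1)
  then show ?case
    using \<epsilon> has_degree_chevalley by auto
next
  case (step1 k)
  then show ?case
    using x_step[OF \<epsilon> _ has_degree_a_1, of k] by (simp add: add.commute)
next
  case (step2 k)
  then show ?case
    using x_step[OF \<epsilon> _ has_degree_a_minus_1, of k] by simp
qed

lemma x_degree_0:
  assumes "mqd m x = x" "\<epsilon> \<in> {1, - 1}" "k > 0"
  shows "mx m \<epsilon> k x = 0"
proof (rule positive_degree_zero[OF _ assms(3)])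
  show "mqd m (mx m \<epsilon> k x) = mscale m (q powi k) (mx m \<epsilon> k x)"
    using has_degree_x[OF assms(2), of k] assms(1) unfolding has_degree_def by metis
qed

text \<open>
  The first non-vanishing \<open>a(k) x\<close> would equal \<open>[x\<^sup>+(k), x\<^sup>-(0)] x\<close> up to an invertible factor. This commutator
  vanishes, because \<open>x\<^sup>+(k)\<close> has positive degree \<open>k\<close>.
\<close>
lemma a_degree_0:
  assumes x: "mqd m x = x" and "n > 0"
  shows "ma m (int n) x = 0"
  using \<open>n > 0\<close>
proof (induction n rule: less_induct)
  case (less n)
  let ?A = "\<lambda>n w. mscale m ((q - q powi (- 1)) * q ^ n) (ma m (int n) w)"
  have E: "exp_coeff (mscale m) ?A n x = ?A n x"
    using less by (intro exp_coeff_first) (simp_all add: vector_space_axioms linear_simps[OF endo_a])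
  have "mqd m (mx m (- 1) 0 x) = mx m (- 1) 0 x"
    using x by (simp add: x_f1 df)
  then have "mx m 1 (int n) (mx m (- 1) 0 x) - mx m (- 1) 0 (mx m 1 (int n) x) = 0"
    using x_degree_0 x less.prems by (simp add: linear_simps[OF endo_x])
  then have "mt m 1 (ma m (int n) x) = 0"
    using xx[of "int n" 0 x] E less.prems by (simp add: linear_simps[OF endo_t])
  then show ?case
    using inv_t(1)[of 1 "ma m (int n) x"] by (simp add: linear_simps[OF endo_inv_t])
qed

lemma a_f_string_1: "n > 0 \<Longrightarrow> ma m (int n) (f_string 1 k) = 0"
  by (simp add: a_degree_0 d_f_string_1)

lemma t0: "mt m 0 x = mscale m (q\<^sup>2) (inv (mt m 1) x)"
  using t0t1[of "inv (mt m 1) x"] by simp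

text \<open>
  Write \<open>f\<^sub>0 v = t\<^sub>0\<inverse> x\<^sup>+(-1) v\<close>. Commuting \<open>a(n)\<close> past \<open>x\<^sup>+(-1)\<close> leaves a multiple of \<open>x\<^sup>+(n - 1) v\<close>, which vanishes as
  \<open>e\<^sub>1 v = 0\<close> for \<open>n = 1\<close> and for reasons of degree for \<open>n > 1\<close>.
\<close>
lemma a_f0_vac:
  assumes "n > 0"
  shows "ma m (int n) (mf m 0 vac) = 0"
proof -
  have inv_K_a: "inv (mt m 0) (ma m (int n) x) = ma m (int n) (inv (mt m 0) x)" for x
  proof -
    have "mt m 0 (ma m (int n) y) = ma m (int n) (mt m 0 y)" for y
      using Ka[of "int n" "inv (mt m 1) y"] assms
      by (simp add: t0 linear_simps[OF endo_a]) (metis inv_t(1) insertI1 insertI2)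
    from this[of "inv (mt m 0) x"] show ?thesis
      by (metis inv_t insertI1)
  qed
  have "mx m 1 (int n + - 1) vac = 0"
  proof (cases "n = 1")
    case True
    then show ?thesis by (simp add: x_e1 e_vac)
  next
    case False
    then show ?thesis
      using assms by (intro x_degree_0) (simp_all add: d_vac)
  qed
  moreover have "ma m (int n) vac = 0"
    by (rule a_degree_0[OF d_vac assms])
  ultimately have "ma m (int n) (mx m 1 (- 1) vac) = 0"
    using ax[of 1 "int n" "- 1" vac] assms by (simp add: linear_simps[OF endo_x])
  then have "inv (mt m 0) (ma m (int n) (mt m 0 (mf m 0 vac))) = 0"
    by (simp add: x_f0 linear_simps[OF endo_inv_t])
  then show ?thesis
    by (simp add: inv_K_a)
qed

end

section \<open>The operator \<open>D\<^bsup>1/2\<^esup>\<close>\<close>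

definition qexp_coeff :: "nat \<Rightarrow> cq" where
  "qexp_coeff n = q powi (- int (n * (n - 1) div 2)) / qfact n"

lemma qexp_coeff_small [simp]:
  "qexp_coeff 0 = 1" "qexp_coeff 1 = 1" "qexp_coeff (Suc 0) = 1" "qexp_coeff (Suc (Suc 0)) = inverse q / qint 2" "qexp_coeff 2 = inverse q / qint 2"
  by (simp_all add: qexp_coeff_def qfact_def power_int_minus numeral_2_eq_2)

context hw_module
begin

lemma f_string_small [simp]: "f_string i 1 = mf m i vac" "f_string i (Suc 0) = mf m i vac"
    "f_string i 2 = mf m i (mf m i vac)"
  by (simp_all add: f_string_def One_nat_def numeral_2_eq_2)

definition injective_endo :: "('v \<Rightarrow> 'v) \<Rightarrow> bool" where
  "injective_endo A \<longleftrightarrow> endo A \<and> (\<forall>x. A x = 0 \<longrightarrow> x = 0)"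

lemma injective_endo_compose: "injective_endo A \<Longrightarrow> injective_endo B \<Longrightarrow> injective_endo (\<lambda>x. A (B x))"
  unfolding injective_endo_def using endo_compose by blast

lemma qexp_finite:
  assumes "endo A" "(A ^^ N) x = 0"
  shows "qexp m A x = (\<Sum>n<N. mscale m (qexp_coeff n) ((A ^^ n) x))"
  unfolding qexp_def qexp_coeff_def[symmetric]
proof (rule Sum_any.expand_superset)
  have "(A ^^ n) x = 0" if "n \<ge> N" for n
    using funpow_zero_mono[OF assms that] .
  then show "{n. mscale m (qexp_coeff n) ((A ^^ n) x) \<noteq> 0} \<subseteq> {..<N}"
    using linorder_not_le by auto
qed simp

lemma injective_qexp:
  assumes A: "endo A" and nil: "\<And>x. nilpotent_at A x"
  shows "injective_endo (qexp m A)"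
proof -
  note [simp] = linear_simps[OF endo_funpow[OF A]]
  have "qexp m A (x + y) = qexp m A x + qexp m A y" for x y
  proof -
    obtain N N' where "(A ^^ N) x = 0" "(A ^^ N') y = 0"
      using nil unfolding nilpotent_at_def by metis
    then have "(A ^^ max N N') x = 0" "(A ^^ max N N') y = 0"
      using funpow_zero_mono[OF A, of _ _ "max N N'"] by auto
    then show ?thesis
      using qexp_finite[OF A, of "max N N'"] by (simp add: scale_right_distrib sum.distrib)
  qed
  moreover have "qexp m A (mscale m c x) = mscale m c (qexp m A x)" for c x
  proof -
    obtain N where "(A ^^ N) x = 0"
      using nil unfolding nilpotent_at_def by metis
    then show ?thesis
      using qexp_finite[OF A, of N] by (simp add: scale_sum_right mult.commute)
  qed
  ultimately have "endo (qexp m A)"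
    by (intro linearI vector_space_axioms)
  moreover have "x = 0" if "qexp m A x = 0" for x
  proof -
    obtain N where N: "(A ^^ N) x = 0"
      using nil unfolding nilpotent_at_def by metis
    show ?thesis
      using unipotent_injective[OF A N, of qexp_coeff] that qexp_finite[OF A N] by simp
  qed
  ultimately show ?thesis
    unfolding injective_endo_def by blast
qed

lemma qexp_scale:
  assumes "endo A" "\<And>x. nilpotent_at A x"
  shows "qexp m A (mscale m c x) = mscale m c (qexp m A x)"
  using linear_simps(3) injective_qexp[OF assms] unfolding injective_endo_def by blast

lemma qexp_1:
  assumes "endo A" "A x = 0"
  shows "qexp m A x = x"
  using qexp_finite[OF assms(1), of 1 x] assms by (simp add: One_nat_def)

lemma qexp_2:
  assumes "endo A" "A (A x) = 0"
  shows "qexp m A x = x + A x"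
  using qexp_finite[OF assms(1), of 2 x] assms by (simp add: numeral_2_eq_2)

lemma qexp_3:
  assumes "endo A" "A (A (A x)) = 0"
  shows "qexp m A x = x + A x + mscale m (inverse q / qint 2) (A (A x))"
  using qexp_finite[OF assms(1), of 3 x] assms
  by (simp add: numeral_3_eq_3)

lemma h_component_eq:
  assumes "i \<in> {0, 1}" "eigen_decomposition (mt m i) x c"
  shows "h_component m i x = c"
  unfolding h_component_def
  using assms eigen_decomposition_unique[OF endo_t[OF assms(1)]]
  by (intro the_equality) (auto simp: eigen_decomposition_def)

lemma h_component_decomposition:
  assumes "i \<in> {0, 1}"
  shows "eigen_decomposition (mt m i) x (h_component m i x)"
proof -
  have "\<exists>c. eigen_decomposition (mt m i) x c \<and> (\<forall>n. n \<notin> UNIV \<longrightarrow> c n = 0)"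
    by (rule decomposition[OF endo_t[OF assms]]) (use assms in \<open>unfold weight_vector_def, blast\<close>)
  then show ?thesis
    using h_component_eq[OF assms] by metis
qed

lemma h_component_weight:
  assumes "i \<in> {0, 1}" "mt m i x = mscale m (q powi n) x"
  shows "h_component m i x = (\<lambda>k. if k = n then x else 0)"
  using assms by (intro h_component_eq eigen_decomposition_eigenvector endo_t)

lemma injective_function_of_h:
  assumes i: "i \<in> {0, 1}" and g: "\<And>n. g n \<noteq> 0"
  shows "injective_endo (\<lambda>x. Sum_any (\<lambda>n. mscale m (g n) (h_component m i x n)))"
proof -
  note T = endo_t[OF i]
  note dec = h_component_decomposition[OF i]
  have fin: "finite {n. mscale m (g n) (h_component m i x n) \<noteq> 0}" for x
    using dec[of x] g by (simp add: eigen_decomposition_def)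
  have "h_component m i (x + y) = (\<lambda>n. h_component m i x n + h_component m i y n)" for x y
    by (intro h_component_eq i eigen_decomposition_add T dec)
  moreover have "h_component m i (mscale m c x) = (\<lambda>n. mscale m c (h_component m i x n))" for c x
    by (intro h_component_eq i eigen_decomposition_scale T dec)
  ultimately have "endo (\<lambda>x. Sum_any (\<lambda>n. mscale m (g n) (h_component m i x n)))"
    by (intro linearI vector_space_axioms)
      (simp_all add: scale_right_distrib Sum_any.distrib[OF fin fin] mult.commute
        linear_Sum_any[OF linear_scale_self fin])
  moreover have "x = 0" if "Sum_any (\<lambda>n. mscale m (g n) (h_component m i x n)) = 0" for x
  proof -
    have "eigen_decomposition (mt m i) 0 (\<lambda>n. mscale m (g n) (h_component m i x n))"
      using dec[of x] that fin[of x]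
      by (simp add: eigen_decomposition_def linear_simps[OF T] scale_left_commute)
    moreover have "eigen_decomposition (mt m i) 0 (\<lambda>n. 0)"
      by (simp add: eigen_decomposition_def linear_simps[OF T])
    ultimately have "(\<lambda>n. mscale m (g n) (h_component m i x n)) = (\<lambda>n. 0)"
      by (rule eigen_decomposition_unique[OF T])
    then have "h_component m i x n = 0" for n
      using g by (simp add: fun_eq_iff)
    then show ?thesis
      using dec[of x] by (simp add: eigen_decomposition_def)
  qed
  ultimately show ?thesis
    unfolding injective_endo_def by blast
qed

lemma nilpotent_S0_factors:
  "nilpotent_at (\<lambda>w. mscale m (q powi (- 1)) (me m 0 (inv (mt m 0) w))) x"
  "nilpotent_at (\<lambda>w. mscale m q (me m 0 (mt m 0 w))) x"
  "nilpotent_at (\<lambda>w. - mf m 0 w) x"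
proof -
  show "nilpotent_at (\<lambda>w. mscale m (q powi (- 1)) (me m 0 (inv (mt m 0) w))) x"
    using has_degree_compose[OF has_degree_chevalley(1) has_degree_inv_t[of 0]]
    by (intro nilpotent_degree_1 has_degree_scale) simp
  show "nilpotent_at (\<lambda>w. mscale m q (me m 0 (mt m 0 w))) x"
    using has_degree_compose[OF has_degree_chevalley(1) has_degree_t[of 0]]
    by (intro nilpotent_degree_1 has_degree_scale) simp
  have "((\<lambda>w. - mf m 0 w) ^^ n) x = mscale m ((- 1) ^ n) ((mf m 0 ^^ n) x)" for n
    by (induction n) (simp_all add: linear_simps[OF endo_f])
  then show "nilpotent_at (\<lambda>w. - mf m 0 w) x"
    using nilpotent_f0[of x] by (auto simp: nilpotent_at_def)
qed

lemma endo_S0_factors [simp]: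
  "endo (\<lambda>w. mscale m c (me m 0 (inv (mt m 0) w)))"
  "endo (\<lambda>w. mscale m c (me m 0 (mt m 0 w)))"
  "endo (\<lambda>w. - mf m 0 w)"
  by (intro endo_scale endo_uminus endo_compose[OF endo_e] endo_t endo_f endo_inv_t; simp)+

lemma injective_S0: "injective_endo (S0 m)"
proof -
  have "injective_endo (\<lambda>x. Sum_any (\<lambda>n. mscale m (q powi (n * (n + 1) div 2)) (h_component m 0 x n)))"
    by (rule injective_function_of_h) simp_all
  note this = injective_endo_compose[OF injective_qexp[OF endo_S0_factors(1) nilpotent_S0_factors(1)]
    injective_endo_compose[OF injective_qexp[OF endo_S0_factors(3) nilpotent_S0_factors(3)]
    injective_endo_compose[OF injective_qexp[OF endo_S0_factors(2) nilpotent_S0_factors(2)] this]]]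
  then show ?thesis
    unfolding S0_def[abs_def] .
qed

text \<open>
  On the span of \<open>v, f\<^sub>0 v, \<dots>, f\<^sub>0\<^sup>c v\<close>, where \<open>c = \<langle>\<nu>, h\<^sub>0\<rangle>\<close>, the operator \<open>S\<^sub>0\<close> acts as a lift of the simple
  reflection, so it maps the lowest weight vector to a multiple of the highest one. As \<open>c \<le> 2\<close>, the
  exponentials have at most three terms on each vector.
\<close>
lemma S0_lowest:
  assumes c: "int c = wt_eval \<nu> 0"
  shows "\<exists>k. k \<noteq> 0 \<and> S0 m (f_string 0 c) = mscale m k vac"
proof -
  define A B C where "A = (\<lambda>w. mscale m q (me m 0 (mt m 0 w)))" and "B = (\<lambda>w. - mf m 0 w)"
    and "C = (\<lambda>w. mscale m (q powi (- 1)) (me m 0 (inv (mt m 0) w)))"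
  have endo: "endo A" "endo B" "endo C"
    unfolding A_def B_def C_def by (rule endo_S0_factors)+
  have nil: "nilpotent_at A x" "nilpotent_at B x" "nilpotent_at C x" for x
    unfolding A_def B_def C_def by (rule nilpotent_S0_factors)+
  define v0 v1 v2 where "v0 = f_string 0 0" and "v1 = f_string 0 1" and "v2 = f_string 0 2"
  have f: "mf m 0 v0 = v1" "mf m 0 v1 = v2"
    by (simp_all add: v0_def v1_def v2_def)
  have end0: "f_string 0 (Suc c) = 0"
    using c by (intro f_string_end) auto
  have e0: "me m 0 v0 = 0"
    by (simp add: v0_def e_vac)
  note lin = linear_simps[OF endo_f[of 0]] linear_simps[OF endo_e[of 0]] linear_simps[OF endo(1)]
    linear_simps[OF endo(2)]
  have A0: "A v0 = 0" and "C v0 = 0"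
    using inv_t_eigen[of 0, OF _ t_vac] by (simp_all add: A_def C_def v0_def lin t_vac e_vac)
  then have C: "qexp m C v0 = vac"
    using qexp_1[OF endo(3)] by (simp add: v0_def)
  have Q: "Sum_any (\<lambda>n. mscale m (q powi (n * (n + 1) div 2)) (h_component m 0 (f_string 0 c) n))
      = mscale m (q powi (int c * (int c - 1) div 2)) (f_string 0 c)"
  proof -
    have *: "h_component m 0 (f_string 0 c) = (\<lambda>k. if k = - int c then f_string 0 c else 0)"
      using t_f_string[of 0 c] c by (intro h_component_weight) auto
    have "(\<lambda>n. mscale m (q powi (n * (n + 1) div 2)) (h_component m 0 (f_string 0 c) n)) =
        (\<lambda>n. if n = - int c then mscale m (q powi (int c * (int c - 1) div 2)) (f_string 0 c) else 0)"
      by (auto simp: * fun_eq_iff algebra_simps)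
    note sum = this
    show ?thesis
      unfolding sum by simp
  qed
  have S: "S0 m (f_string 0 c) = mscale m (q powi (int c * (int c - 1) div 2))
      (qexp m C (qexp m B (qexp m A (f_string 0 c))))"
    unfolding S0_def Q A_def[symmetric] B_def[symmetric] C_def[symmetric]
    by (simp only: qexp_scale[OF endo(1) nil(1)] qexp_scale[OF endo(2) nil(2)] qexp_scale[OF endo(3) nil(3)])
  have "\<exists>k. k \<noteq> 0 \<and> qexp m B (qexp m A (f_string 0 c)) = mscale m k v0"
  proof -
    consider "c = 0" | "c = 1" | "c = 2"
      using c by (cases \<nu>) auto
    then show ?thesis
    proof cases
      case 1
      have "B v0 = 0"
        using end0 unfolding 1 f_string_Suc v0_def by (simp add: B_def)
      then have "qexp m A v0 = v0" "qexp m B v0 = v0"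
        using A0 qexp_1 endo by blast+
      then show ?thesis
        using 1 by (intro exI[of _ 1]) (simp add: v0_def[symmetric] del: f_string_0)
    next
      case 2
      have t: "mt m 0 v1 = mscale m (inverse q) v1"
        using 2 c t_f_string[of 0 1] by (simp add: v1_def power_int_minus)
      have e1: "me m 0 v1 = v0"
        using 2 c e_f_string[of 0 1] by (simp add: v0_def v1_def)
      have f1: "mf m 0 v1 = 0"
        using end0 unfolding 2 f_string_Suc v1_def .
      have A: "A v1 = v0" and B: "B v0 = - v1" "B v1 = 0"
        by (simp_all add: A_def B_def t e1 f(1) f1 lin)
      have "qexp m A v1 = v1 + v0"
        using qexp_2[OF endo(1), of v1] by (simp add: A A0)
      moreover have "qexp m B (v1 + v0) = v0"
        using qexp_2[OF endo(2), of "v1 + v0"] by (simp add: B lin)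
      ultimately show ?thesis
        using 2 by (intro exI[of _ 1]) (simp add: v1_def[symmetric] del: f_string_small)
    next
      case 3
      have t: "mt m 0 v2 = mscale m (inverse q * inverse q) v2" "mt m 0 v1 = v1"
        using 3 c t_f_string[of 0 2] t_f_string[of 0 1]
        by (simp_all add: v1_def v2_def power_int_minus power2_eq_square)
      have e: "me m 0 v1 = mscale m (qint 2) v0" "me m 0 v2 = mscale m (qint 2) v1"
        using 3 c e_f_string[of 0 1] e_f_string[of 0 2] by (simp_all add: v0_def v1_def v2_def)
      have f2: "mf m 0 v2 = 0"
        using end0 unfolding 3 f_string_Suc by (simp add: v2_def)
      have nz: "qint 2 \<noteq> 0"
        by simp
      define a where "a = inverse q * qint 2"
      have a: "a \<noteq> 0" "inverse q / qint 2 * a = inverse q * inverse q" "1 + inverse q * inverse q = a"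
        using nz by (simp_all add: a_def qint_2[symmetric]) (simp_all add: qint_2 distrib_left)
      have A: "A v2 = mscale m a v1" "A v1 = mscale m (q * qint 2) v0"
        by (simp_all add: A_def t e lin a_def mult_ac)
      have B: "B v0 = - v1" "B v1 = - v2" "B v2 = 0"
        by (simp_all add: B_def f f2)
      have "qexp m A v2 = v2 + A v2 + mscale m (inverse q / qint 2) (A (A v2))"
        by (rule qexp_3) (simp_all add: endo A A0 lin)
      also have "\<dots> = v2 + mscale m a v1 + mscale m a v0"
        by (simp add: A lin)
      finally have "qexp m B (qexp m A v2) = (v2 + mscale m a v1 + mscale m a v0)
          + B (v2 + mscale m a v1 + mscale m a v0)
          + mscale m (inverse q / qint 2) (B (B (v2 + mscale m a v1 + mscale m a v0)))"
        by (simp only:, intro qexp_3) (simp_all add: endo B lin)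
      also have "\<dots> = v2 + mscale m a v0 - mscale m a v2 + mscale m (inverse q / qint 2 * a) v2"
        by (simp add: B lin)
      \<comment> \<open>The coefficient of \<open>v2\<close> is \<open>1 - q\<inverse> [2] + q\<^sup>-\<^sup>2 = 0\<close>.\<close>
      also have "\<dots> = mscale m (1 - a + inverse q * inverse q) v2 + mscale m a v0"
        unfolding a by (simp add: scale_left_distrib scale_left_diff_distrib)
      finally have "qexp m B (qexp m A v2) = mscale m a v0"
        using a(3) by (simp add: algebra_simps)
      then show ?thesis
        using 3 a(1) by (intro exI[of _ a]) (simp add: v2_def[symmetric] del: f_string_small)
    qed
  qed
  then obtain k where "k \<noteq> 0" "qexp m B (qexp m A (f_string 0 c)) = mscale m k v0"
    by blast
  then show ?thesis
    unfolding S
    by (intro exI[of _ "q powi (int c * (int c - 1) div 2) * k"]) (simp add: qexp_scale[OF endo(3) nil(3)] C)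
qed

text \<open>
  The condition \<open>e\<^sub>0 v = 0\<close> in \<open>\<V>(1)\<close> also involves \<open>D\<^bsup>1/2\<^esup>\<close> on the highest weight vector itself; it again
  acts as a reflection.
\<close>
lemma S0_highest:
  assumes c: "wt_eval \<nu> 0 = 1"
  shows "S0 m vac = mscale m (- q) (mf m 0 vac)"
proof -
  define A B C where "A = (\<lambda>w. mscale m q (me m 0 (mt m 0 w)))" and "B = (\<lambda>w. - mf m 0 w)"
    and "C = (\<lambda>w. mscale m (q powi (- 1)) (me m 0 (inv (mt m 0) w)))"
  have endo: "endo A" "endo B" "endo C"
    unfolding A_def B_def C_def by (rule endo_S0_factors)+
  note lin = linear_simps[OF endo_e[of 0]] linear_simps[OF endo(1)] linear_simps[OF endo(2)]
    linear_simps[OF endo(3)]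
  define v1 where "v1 = mf m 0 vac"
  have f1: "mf m 0 v1 = 0"
    using f_string_end[of 0 2] c by (simp add: v1_def)
  have t0: "mt m 0 vac = mscale m (q powi 1) vac" and t1: "mt m 0 v1 = mscale m (q powi (- 1)) v1"
    using t_vac[of 0] t_f_string[of 0 1] c by (simp_all add: v1_def)
  have it: "inv (mt m 0) vac = mscale m (q powi (- 1)) vac" "inv (mt m 0) v1 = mscale m q v1"
    using inv_t_eigen[OF _ t0] inv_t_eigen[OF _ t1] by simp_all
  have e: "me m 0 vac = 0" "me m 0 v1 = vac"
    using e_f_string[of 0 1] c by (simp_all add: v1_def e_vac)
  have h: "h_component m 0 vac = (\<lambda>k. if k = 1 then vac else 0)"
    by (rule h_component_weight) (simp_all add: t0)
  have "(\<lambda>n. mscale m (q powi (n * (n + 1) div 2)) (h_component m 0 vac n)) =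
        (\<lambda>n. if n = 1 then mscale m q vac else 0)"
    by (auto simp: h fun_eq_iff)
  note sum = this
  have Q: "Sum_any (\<lambda>n. mscale m (q powi (n * (n + 1) div 2)) (h_component m 0 vac n)) = mscale m q vac"
    unfolding sum by simp
  have ABC: "A vac = 0" "B vac = - v1" "B v1 = 0" "C vac = 0" "C v1 = vac"
    by (simp_all add: A_def B_def C_def t0 it e f1 lin flip: v1_def)
  have "qexp m A (mscale m q vac) = mscale m q vac"
    by (rule qexp_1) (simp_all add: endo lin ABC)
  moreover have "qexp m B (mscale m q vac) = mscale m q vac - mscale m q v1"
    using qexp_2[OF endo(2), of "mscale m q vac"] by (simp add: lin ABC)
  moreover have "qexp m C (mscale m q vac - mscale m q v1) = mscale m (- q) v1"
    using qexp_2[OF endo(3), of "mscale m q vac - mscale m q v1"] by (simp add: lin ABC)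
  ultimately show ?thesis
    unfolding S0_def Q A_def[symmetric] B_def[symmetric] C_def[symmetric] by (simp add: v1_def)
qed

lemma f0_drinfeld: "mf m 0 x = mscale m (inverse (q\<^sup>2)) (mt m 1 (mx m 1 (- 1) x))"
  by (simp add: x_f0 t0 linear_simps[OF endo_t])

lemma d_multiple_vac: "mqd m (mscale m b vac) = mscale m b vac"
  by (simp add: linear_simps[OF endo_d] d_vac)

lemma f_1_vac: "wt_eval \<nu> 1 = 0 \<Longrightarrow> mf m 1 vac = 0"
  using f_string_end[of 1 1] by simp

end

lemma swap_wt_swap_wt [simp]: "swap_wt (swap_wt \<nu>) = \<nu>"
  by (cases \<nu>) simp_all

lemma wt_eval_swap_wt [simp]: "wt_eval (swap_wt \<nu>) 0 = wt_eval \<nu> 1" "wt_eval (swap_wt \<nu>) 1 = wt_eval \<nu> 0"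
  by (cases \<nu>; simp)+

lemma wt_eval_nonneg: "0 \<le> wt_eval \<nu> i"
  by (cases \<nu>) simp_all

locale hw_family =
  fixes M :: "wt \<Rightarrow> 'v::ab_group_add sl2_ops" and vac :: "wt \<Rightarrow> 'v" and \<sigma> :: "wt \<Rightarrow> 'v \<Rightarrow> 'v"
  assumes irreducible_hw: "\<And>\<nu>. irreducible_hw_module (M \<nu>) \<nu> (vac \<nu>)" and diagram: "diagram_map M vac \<sigma>"
begin

sublocale V: hw_module "M \<nu>" \<nu> "vac \<nu>" for \<nu>
  by unfold_locales (rule irreducible_hw)

lemma linear_\<sigma>: "Vector_Spaces.linear (mscale (M \<nu>)) (mscale (M (swap_wt \<nu>))) (\<sigma> \<nu>)"
  and \<sigma>_vac [simp]: "\<sigma> \<nu> (vac \<nu>) = vac (swap_wt \<nu>)"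
  and \<sigma>_f: "i \<in> {0, 1} \<Longrightarrow> \<sigma> \<nu> (mf (M \<nu>) i x) = mf (M (swap_wt \<nu>)) (1 - i) (\<sigma> \<nu> x)"
  using diagram unfolding diagram_map_def by blast+

text \<open>
  \<open>\<sigma>\<^sup>2\<close> fixes the highest weight vector and commutes with \<open>f\<^sub>0\<close> and \<open>f\<^sub>1\<close>, which generate everything from it.
\<close>
lemma \<sigma>_involution: "\<sigma> (swap_wt \<nu>) (\<sigma> \<nu> x) = x"
proof -
  have lin: "Vector_Spaces.linear (mscale (M (swap_wt \<nu>))) (mscale (M \<nu>)) (\<sigma> (swap_wt \<nu>))"
    using linear_\<sigma>[of "swap_wt \<nu>"] by simp
  note [simp] = linear_simps[OF linear_\<sigma>] linear_simps[OF lin]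
  have "x \<in> {x. \<sigma> (swap_wt \<nu>) (\<sigma> \<nu> x) = x}"
  proof (rule V.subspace_eq_UNIV[of \<nu>])
    show "V.subspace \<nu> {x. \<sigma> (swap_wt \<nu>) (\<sigma> \<nu> x) = x}"
      by (intro V.subspaceI CollectI) simp_all
    show "vac \<nu> \<in> {x. \<sigma> (swap_wt \<nu>) (\<sigma> \<nu> x) = x}"
      using \<sigma>_vac[of "swap_wt \<nu>"] by simp
    fix i :: nat and x
    assume i: "i \<in> {0, 1}" and "x \<in> {x. \<sigma> (swap_wt \<nu>) (\<sigma> \<nu> x) = x}"
    moreover have "1 - i \<in> {0, 1}" "1 - (1 - i) = i"
      using i by auto
    ultimately show "mf (M \<nu>) i x \<in> {x. \<sigma> (swap_wt \<nu>) (\<sigma> \<nu> x) = x}"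
      by (simp only: mem_Collect_eq \<sigma>_f swap_wt_swap_wt)
  qed
  then show ?thesis
    by simp
qed

lemma \<sigma>_f_string: "\<sigma> \<nu> (V.f_string \<nu> 1 n) = V.f_string (swap_wt \<nu>) 0 n"
  by (induction n) (simp_all add: V.f_string_Suc \<sigma>_f)

lemma linear_D_half: "Vector_Spaces.linear (mscale (M \<nu>)) (mscale (M (swap_wt \<nu>))) (D_half M \<sigma> \<nu>)"
  and D_half_injective: "D_half M \<sigma> \<nu> x = 0 \<Longrightarrow> x = 0"
proof -
  let ?\<nu> = "swap_wt \<nu>"
  have inj: "V.injective_endo ?\<nu> (S0 (M ?\<nu>))"
    by (rule V.injective_S0)
  then have S: "V.endo ?\<nu> (S0 (M ?\<nu>))"
    by (simp add: V.injective_endo_def)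
  have t: "V.endo ?\<nu> (inv (mt (M ?\<nu>) 0))"
    by (rule V.endo_inv_t) simp
  show "Vector_Spaces.linear (mscale (M \<nu>)) (mscale (M ?\<nu>)) (D_half M \<sigma> \<nu>)"
    by (rule linearI)
      (simp_all add: V.vector_space_axioms D_half_def linear_simps[OF linear_\<sigma>] linear_simps[OF S] linear_simps[OF t])
  assume "D_half M \<sigma> \<nu> x = 0"
  then have "inv (mt (M ?\<nu>) 0) (\<sigma> \<nu> x) = 0"
    using inj by (simp add: D_half_def V.injective_endo_def)
  then have "mt (M ?\<nu>) 0 (inv (mt (M ?\<nu>) 0) (\<sigma> \<nu> x)) = 0"
    by (simp add: linear_simps[OF V.endo_t])
  then have "\<sigma> \<nu> x = 0"
    by simp
  then show "x = 0"
    using \<sigma>_involution[of \<nu> x] linear_simps(2)[OF linear_\<sigma>[of "swap_wt \<nu>"]] by simp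
qed

lemma D_half_inj: "inj (D_half M \<sigma> \<nu>)"
proof (rule injI)
  fix x y assume "D_half M \<sigma> \<nu> x = D_half M \<sigma> \<nu> y"
  then show "x = y"
    using D_half_injective[of \<nu> "x - y"] by (simp add: linear_simps[OF linear_D_half])
qed

text \<open>\<open>\<sigma>\<close> turns the \<open>f\<^sub>1\<close>-string into an \<open>f\<^sub>0\<close>-string, whose lowest vector \<open>S\<^sub>0\<close> reflects to its highest one.\<close>
lemma D_half_f_string:
  assumes "int c = wt_eval \<nu> 1"
  shows "\<exists>k. k \<noteq> 0 \<and> D_half M \<sigma> \<nu> (V.f_string \<nu> 1 c) = mscale (M (swap_wt \<nu>)) k (vac (swap_wt \<nu>))"
proof -
  let ?\<nu> = "swap_wt \<nu>"
  obtain k where k: "k \<noteq> 0" "S0 (M ?\<nu>) (V.f_string ?\<nu> 0 c) = mscale (M ?\<nu>) k (vac ?\<nu>)"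
    using V.S0_lowest[of c ?\<nu>] assms by auto
  have "inv (mt (M ?\<nu>) 0) (V.f_string ?\<nu> 0 c) = mscale (M ?\<nu>) (q powi int c) (V.f_string ?\<nu> 0 c)"
    using V.inv_t_eigen[OF _ V.t_f_string[of 0 ?\<nu> c]] assms by simp
  moreover have "S0 (M ?\<nu>) (mscale (M ?\<nu>) a x) = mscale (M ?\<nu>) a (S0 (M ?\<nu>) x)" for a x
    using V.injective_S0[of ?\<nu>] by (simp add: V.injective_endo_def linear_simps(3)[of "mscale (M ?\<nu>)" "mscale (M ?\<nu>)"])
  ultimately have "D_half M \<sigma> \<nu> (V.f_string \<nu> 1 c) = mscale (M ?\<nu>) (q powi int c * k) (vac ?\<nu>)"
    by (simp add: D_half_def \<sigma>_f_string k)
  then show ?thesis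
    using k(1) by (intro exI[of _ "q powi int c * k"]) simp
qed

lemma D_half_inv_vac:
  assumes "int c = wt_eval \<nu> 0"
  shows "\<exists>k. k \<noteq> 0 \<and> (\<forall>a. D_half_inv M \<sigma> \<nu> (mscale (M \<nu>) a (vac \<nu>)) =
    mscale (M (swap_wt \<nu>)) (a * k) (V.f_string (swap_wt \<nu>) 1 c))"
proof -
  let ?\<nu> = "swap_wt \<nu>"
  obtain k where k: "k \<noteq> 0" "D_half M \<sigma> ?\<nu> (V.f_string ?\<nu> 1 c) = mscale (M \<nu>) k (vac \<nu>)"
    using D_half_f_string[of c ?\<nu>] assms by auto
  have "D_half_inv M \<sigma> \<nu> (mscale (M \<nu>) a (vac \<nu>)) = mscale (M ?\<nu>) (a / k) (V.f_string ?\<nu> 1 c)" for a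
    unfolding D_half_inv_def
  proof (rule inv_f_eq[OF D_half_inj])
    show "D_half M \<sigma> ?\<nu> (mscale (M ?\<nu>) (a / k) (V.f_string ?\<nu> 1 c)) = mscale (M \<nu>) a (vac \<nu>)"
      using k by (simp add: linear_simps(3)[OF linear_D_half])
  qed
  then show ?thesis
    using k(1) by (intro exI[of _ "1 / k"]) simp
qed

lemma D_half_inv_0: "D_half_inv M \<sigma> \<nu> 0 = 0"
  unfolding D_half_inv_def by (rule inv_f_eq[OF D_half_inj]) (rule linear_simps(2)[OF linear_D_half])

lemma D_half_vac_L0L1: "D_half M \<sigma> L0L1 (vac L0L1) = - mf (M L0L1) 0 (vac L0L1)"
proof -
  have "inv (mt (M L0L1) 0) (vac L0L1) = mscale (M L0L1) (inverse q) (vac L0L1)"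
    using V.inv_t_eigen[OF _ V.t_vac[of 0 L0L1]] by (simp add: power_int_minus)
  moreover have "S0 (M L0L1) (mscale (M L0L1) a x) = mscale (M L0L1) a (S0 (M L0L1) x)" for a x
    using V.injective_S0[of L0L1] by (simp add: V.injective_endo_def linear_simps(3)[of "mscale (M L0L1)" "mscale (M L0L1)"])
  ultimately show ?thesis
    using V.S0_highest[of L0L1] \<sigma>_vac[of L0L1] by (simp add: D_half_def)
qed

section \<open>Vertex operators on extremal vectors\<close>

lemma Phi0_leading:
  assumes t: "mt (M \<nu>) 1 x = mscale (M \<nu>) (q powi h) x"
    and a: "\<And>k. 0 < k \<Longrightarrow> ma (M (swap_wt \<nu>)) (int k) (D_half M \<sigma> \<nu> x) = 0"
  shows "r < h \<Longrightarrow> Phi0 M \<sigma> \<nu> r x = 0" and "Phi0 M \<sigma> \<nu> h x = D_half M \<sigma> \<nu> x"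
proof -
  have C: "D_half M \<sigma> \<nu> (h_component (M \<nu>) 1 x n) = (if n = h then D_half M \<sigma> \<nu> x else 0)" for n
    using V.h_component_weight[OF _ t] by (simp add: linear_simps[OF linear_D_half])
  note leading = vertex_coeff_leading[where C = "\<lambda>n v. D_half M \<sigma> \<nu> (h_component (M \<nu>) 1 v n)",
      OF V.vector_space_axioms _ _ C]
  show "r < h \<Longrightarrow> Phi0 M \<sigma> \<nu> r x = 0" and "Phi0 M \<sigma> \<nu> h x = D_half M \<sigma> \<nu> x"
    unfolding Phi0_def Let_def by (rule leading; simp add: a linear_simps[OF V.endo_a])+
qed

lemma h_component_zero [simp]: "h_component (M \<nu>) 1 0 n = 0"
  using V.h_component_weight[of 1 \<nu> 0 0] by (simp add: linear_simps[OF V.endo_t])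

lemma Phi0_zero [simp]: "Phi0 M \<sigma> \<nu> r 0 = 0"
  unfolding Phi0_def Let_def
  by (rule vertex_coeff_zero) (simp_all add: V.vector_space_axioms linear_simps[OF V.endo_a] linear_simps[OF linear_D_half])

lemma Psi2_zero [simp]: "Psi2 M \<sigma> \<nu> r 0 = 0"
  unfolding Psi2_def Let_def
  by (rule vertex_coeff_zero) (simp_all add: V.vector_space_axioms linear_simps[OF V.endo_a] D_half_inv_0)

text \<open>
  \<open>D\<^bsup>-1/2\<^esup> v\<^sub>\<nu>\<close> is an extremal vector of degree 0, so the \<open>a(k)\<close> with \<open>k > 0\<close> annihilate it.
\<close>
lemma Psi2_vac:
  assumes "int c = wt_eval \<nu> 0"
  shows "r < - wt_eval \<nu> 1 \<Longrightarrow> Psi2 M \<sigma> \<nu> r (vac \<nu>) = 0"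
    and "\<exists>k. k \<noteq> 0 \<and> Psi2 M \<sigma> \<nu> (- wt_eval \<nu> 1) (vac \<nu>) = mscale (M (swap_wt \<nu>)) k (V.f_string (swap_wt \<nu>) 1 c)"
proof -
  let ?h = "- wt_eval \<nu> 1"
  obtain k where k: "k \<noteq> 0" "\<And>a. D_half_inv M \<sigma> \<nu> (mscale (M \<nu>) a (vac \<nu>)) =
      mscale (M (swap_wt \<nu>)) (a * k) (V.f_string (swap_wt \<nu>) 1 c)"
    using D_half_inv_vac[OF assms] by blast
  define y where "y = mscale (M (swap_wt \<nu>)) (q powi ?h * k) (V.f_string (swap_wt \<nu>) 1 c)"
  have C: "D_half_inv M \<sigma> \<nu> (mscale (M \<nu>) (q powi n) (h_component (M \<nu>) 1 (vac \<nu>) (- n))) =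
      (if n = ?h then y else 0)" for n
    using V.h_component_weight[OF _ V.t_vac[of 1 \<nu>]]
    by (auto simp: D_half_inv_0 y_def k)
  note leading = vertex_coeff_leading[where C = "\<lambda>n v. D_half_inv M \<sigma> \<nu> (mscale (M \<nu>) (q powi n) (h_component (M \<nu>) 1 v (- n)))",
      OF V.vector_space_axioms _ _ C]
  show "r < ?h \<Longrightarrow> Psi2 M \<sigma> \<nu> r (vac \<nu>) = 0"
    unfolding Psi2_def Let_def by (rule leading; simp add: y_def V.a_f_string_1 linear_simps[OF V.endo_a])
  have "Psi2 M \<sigma> \<nu> ?h (vac \<nu>) = y"
    unfolding Psi2_def Let_def by (rule leading; simp add: y_def V.a_f_string_1 linear_simps[OF V.endo_a])
  then show "\<exists>k. k \<noteq> 0 \<and> Psi2 M \<sigma> \<nu> ?h (vac \<nu>) = mscale (M (swap_wt \<nu>)) k (V.f_string (swap_wt \<nu>) 1 c)"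
    using k(1) by (intro exI[of _ "q powi ?h * k"]) (simp add: y_def)
qed

end

section \<open>Fock space\<close>

lemma lookup_fscale [simp]: "Poly_Mapping.lookup (fscale c w) \<kappa> = c * Poly_Mapping.lookup w \<kappa>"
  by (simp add: fscale_def Poly_Mapping.map.rep_eq when_def)

lemma vector_space_fscale: "vector_space fscale"
  by unfold_locales (auto intro!: poly_mapping_eqI simp: lookup_add algebra_simps)

lemma fscale_simps [simp]: "fscale c 0 = 0" "fscale 1 w = w"
  by (auto intro!: poly_mapping_eqI)

lemma flinear_basis [simp]: "flinear g (fbasis \<kappa>) = g \<kappa>"
proof -
  have sum: "(\<lambda>\<kappa>'. fscale (Poly_Mapping.lookup (fbasis \<kappa>) \<kappa>') (g \<kappa>')) = (\<lambda>\<kappa>'. if \<kappa>' = \<kappa> then g \<kappa> else 0)"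
    by (auto simp: fun_eq_iff fbasis_def lookup_single when_def intro!: poly_mapping_eqI)
  show ?thesis
    unfolding flinear_def sum by simp
qed

lemma flinear_zero [simp]: "flinear g 0 = 0"
proof -
  have sum: "(\<lambda>\<kappa>. fscale (Poly_Mapping.lookup 0 \<kappa>) (g \<kappa>)) = (\<lambda>_. 0)"
    by (auto simp: fun_eq_iff intro!: poly_mapping_eqI)
  show ?thesis
    unfolding flinear_def sum by simp
qed

lemma heis_zero [simp]: "heis k 0 = 0"
  by (simp add: heis_def)

lemma heis_vac: "0 < k \<Longrightarrow> heis (int k) (fvac n) = 0"
  by (simp add: heis_def fvac_def) (auto intro!: poly_mapping_eqI)

lemma shift_component_vac:
  "fshift r (b0_component (fvac n) k) = (if k = n then fvac (n + 2 * r) else 0)"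
  by (simp add: fshift_def b0_component_def fvac_def)

lemma Omega0_vac: "r < n \<Longrightarrow> Omega0 r (fvac n) = 0" "Omega0 n (fvac n) = fvac (n + 2)"
  unfolding Omega0_def
  by (rule vertex_coeff_leading[OF vector_space_fscale, where y = "fvac (n + 2)"];
      simp add: shift_component_vac heis_vac)+

lemma Omega2_vac: "r < - n \<Longrightarrow> Omega2 r (fvac n) = 0" "Omega2 (- n) (fvac n) = fvac (n - 2)"
  unfolding Omega2_def
  by (rule vertex_coeff_leading[OF vector_space_fscale, where y = "fvac (n - 2)" and h = "- n"];
      auto simp add: shift_component_vac heis_vac)+

text \<open>This is \<open>\<V>\<^bsub>n/2\<^esub>\<close>.\<close>
definition fock_sector :: "int \<Rightarrow> fock set" where
  "fock_sector n = {w. \<forall>\<kappa>\<in>Poly_Mapping.keys w. fst \<kappa> = n}"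

lemma fock_sector_closed [simp, intro]:
  "0 \<in> fock_sector n" "w \<in> fock_sector n \<Longrightarrow> fscale c w \<in> fock_sector n"
  "w \<in> fock_sector n \<Longrightarrow> w' \<in> fock_sector n \<Longrightarrow> w + w' \<in> fock_sector n"
  "fbasis (n, \<mu>) \<in> fock_sector n"
  using Poly_Mapping.keys_add[of w w']
  by (auto simp: fock_sector_def in_keys_iff fbasis_def lookup_single when_def split: if_splits)

lemma Sum_any_fock_sector: "(\<And>a. f a \<in> fock_sector n) \<Longrightarrow> Sum_any f \<in> fock_sector n"
  by (rule Sum_any_mem) auto

lemma flinear_fock_sector:
  assumes "\<And>\<mu>. g (n, \<mu>) \<in> fock_sector n'" "w \<in> fock_sector n"
  shows "flinear g w \<in> fock_sector n'"
  unfolding flinear_def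
proof (rule Sum_any_fock_sector)
  fix \<kappa>
  show "fscale (Poly_Mapping.lookup w \<kappa>) (g \<kappa>) \<in> fock_sector n'"
  proof (cases "Poly_Mapping.lookup w \<kappa> = 0")
    case True
    then have "fscale (Poly_Mapping.lookup w \<kappa>) (g \<kappa>) = 0"
      by (auto intro!: poly_mapping_eqI)
    then show ?thesis by simp
  next
    case False
    then have "fst \<kappa> = n"
      using assms(2) by (simp add: fock_sector_def in_keys_iff)
    then show ?thesis
      using assms(1)[of "snd \<kappa>"] by (cases \<kappa>) auto
  qed
qed

lemma heis_fock_sector: "w \<in> fock_sector n \<Longrightarrow> heis k w \<in> fock_sector n"
  unfolding heis_def by (rule flinear_fock_sector) auto

lemma exp_coeff_fock_sector:
  assumes "\<And>k w. w \<in> fock_sector n \<Longrightarrow> A k w \<in> fock_sector n" "w \<in> fock_sector n"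
  shows "exp_coeff fscale A r w \<in> fock_sector n"
proof -
  have "foldr A ks w \<in> fock_sector n" for ks
    by (induction ks) (auto simp: assms)
  then show ?thesis
    unfolding exp_coeff_def by (intro sum_mem) auto
qed

lemma vertex_coeff_fock_sector:
  assumes "\<And>k w. w \<in> fock_sector n \<Longrightarrow> A k w \<in> fock_sector n" "\<And>k w. w \<in> fock_sector n \<Longrightarrow> B k w \<in> fock_sector n"
    and "\<And>k. C k w \<in> fock_sector n"
  shows "vertex_coeff fscale A B C r w \<in> fock_sector n"
  unfolding vertex_coeff_def
  by (rule Sum_any_fock_sector) (auto intro!: exp_coeff_fock_sector[where A = A] exp_coeff_fock_sector[where A = B] assms)

lemma shift_component_fock_sector:
  assumes "w \<in> fock_sector n"
  shows "fshift r (b0_component w k) \<in> fock_sector (n + 2 * r)"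
proof -
  have "b0_component w k \<in> fock_sector n"
    unfolding b0_component_def by (rule flinear_fock_sector[OF _ assms]) auto
  then show ?thesis
    unfolding fshift_def by (rule flinear_fock_sector[rotated]) auto
qed

lemma Omega_fock_sector:
  assumes "w \<in> fock_sector n"
  shows "Omega0 r w \<in> fock_sector (n + 2)" "Omega2 r w \<in> fock_sector (n - 2)"
  unfolding Omega0_def Omega2_def
  using shift_component_fock_sector[OF assms, of 1] shift_component_fock_sector[OF assms, of "- 1"]
  by (intro vertex_coeff_fock_sector; auto intro: heis_fock_sector)+

section \<open>Tensor products\<close>

abbreviation lk where "lk \<equiv> Poly_Mapping.lookup"
abbreviation sgl where "sgl \<equiv> Poly_Mapping.single"

lemma lookup_Sum_any_single:
  assumes "finite {k. f k \<noteq> 0}"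
  shows "lk (Sum_any (\<lambda>k. sgl k (f k))) j = f j"
proof -
  have "Sum_any (\<lambda>k. sgl k (f k)) = (\<Sum>k\<in>insert j {k. f k \<noteq> 0}. sgl k (f k))"
    by (rule Sum_any.expand_superset) (use assms in auto)
  then have "lk (Sum_any (\<lambda>k. sgl k (f k))) j = (\<Sum>k\<in>insert j {k. f k \<noteq> 0}. if k = j then f j else 0)"
    by (simp only: lookup_sum lookup_single) (auto intro: sum.cong simp: when_def)
  then show ?thesis
    using assms by simp
qed

lemma poly_mapping_sum_single: "x = (\<Sum>k\<in>Poly_Mapping.keys x. sgl k (lk x k))"
proof (rule poly_mapping_eqI)
  fix j
  have "lk (\<Sum>k\<in>Poly_Mapping.keys x. sgl k (lk x k)) j = (\<Sum>k\<in>Poly_Mapping.keys x. if k = j then lk x j else 0)"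
    unfolding lookup_sum by (intro sum.cong) (auto simp: lookup_single when_def)
  then show "lk x j = lk (\<Sum>k\<in>Poly_Mapping.keys x. sgl k (lk x k)) j"
    by (simp add: in_keys_iff)
qed

lemma finite_lookup_image:
  assumes "\<And>k. f k 0 = 0"
  shows "finite {k. f k (lk x k) \<noteq> 0}"
  by (rule finite_subset[OF _ finite_keys[of x]]) (use assms in \<open>auto simp: in_keys_iff\<close>)

context hw_family
begin

lemma lookup_tscale [simp]: "lk (tscale M c x) (\<nu>, \<kappa>) = mscale (M \<nu>) c (lk x (\<nu>, \<kappa>))"
  by (simp add: tscale_def lookup_mapp when_def in_keys_iff)

lemma vector_space_tscale: "vector_space (tscale M)"
  by unfold_locales
    (auto intro!: poly_mapping_eqI simp: lookup_add V.scale_right_distrib V.scale_left_distrib)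

sublocale T: vector_space "tscale M"
  by (rule vector_space_tscale)

lemma tscale_single [simp]: "tscale M c (sgl (\<nu>, \<kappa>) x) = sgl (\<nu>, \<kappa>) (mscale (M \<nu>) c x)"
  by (rule poly_mapping_eqI) (auto simp: lookup_single when_def split: if_splits)

lemma tens_scaled_basis [simp]: "tens M \<nu> x (fscale c (fbasis \<kappa>)) = sgl (\<nu>, \<kappa>) (mscale (M \<nu>) c x)"
proof -
  have sum: "(\<lambda>\<kappa>'. sgl (\<nu>, \<kappa>') (mscale (M \<nu>) (lk (fscale c (fbasis \<kappa>)) \<kappa>') x)) =
      (\<lambda>\<kappa>'. if \<kappa>' = \<kappa> then sgl (\<nu>, \<kappa>) (mscale (M \<nu>) c x) else 0)"
    by (auto simp: fun_eq_iff fbasis_def lookup_single when_def)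
  show ?thesis
    unfolding tens_def sum by simp
qed

lemma tens_basis [simp]: "tens M \<nu> x (fbasis \<kappa>) = sgl (\<nu>, \<kappa>) x"
  using tens_scaled_basis[of \<nu> x 1 \<kappa>] by simp

lemma tens_zero [simp]: "tens M \<nu> 0 w = 0" "tens M \<nu> x 0 = 0"
  by (simp_all add: tens_def)

lemma keys_tens: "Poly_Mapping.keys (tens M \<nu> x w) \<subseteq> {\<nu>} \<times> Poly_Mapping.keys w"
proof -
  have "tens M \<nu> x w \<in> {y. Poly_Mapping.keys y \<subseteq> {\<nu>} \<times> Poly_Mapping.keys w}"
    unfolding tens_def
  proof (rule Sum_any_mem)
    fix y z :: "'v total" and A
    assume "y \<in> {y. Poly_Mapping.keys y \<subseteq> A}" "z \<in> {y. Poly_Mapping.keys y \<subseteq> A}"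
    then show "y + z \<in> {y. Poly_Mapping.keys y \<subseteq> A}"
      using Poly_Mapping.keys_add[of y z] by auto
  next
    fix \<kappa>
    show "sgl (\<nu>, \<kappa>) (mscale (M \<nu>) (lk w \<kappa>) x) \<in> {y. Poly_Mapping.keys y \<subseteq> {\<nu>} \<times> Poly_Mapping.keys w}"
      by (auto simp: in_keys_iff lookup_single when_def)
  qed simp
  then show ?thesis by simp
qed

lemma tens_op_single:
  assumes "\<And>\<nu>. A \<nu> 0 = 0"
  shows "tens_op M g A B (sgl (\<nu>, \<kappa>) x) = tens M (g \<nu>) (A \<nu> x) (B (fbasis \<kappa>))"
proof -
  have sum: "(\<lambda>(\<nu>', \<kappa>'). tens M (g \<nu>') (A \<nu>' (lk (sgl (\<nu>, \<kappa>) x) (\<nu>', \<kappa>'))) (B (fbasis \<kappa>')))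
      = (\<lambda>k. if k = (\<nu>, \<kappa>) then tens M (g \<nu>) (A \<nu> x) (B (fbasis \<kappa>)) else 0)"
    by (auto simp: fun_eq_iff lookup_single when_def assms)
  show ?thesis
    unfolding tens_op_def sum by simp
qed

text \<open>
  Such operators act separately on each coefficient, which makes the inverses of \<open>K\<^sub>1\<close> and \<open>K\<^sub>2\<close> explicit.
\<close>
lemma lookup_tens_op_diagonal:
  assumes "\<And>\<nu>. A \<nu> 0 = 0" and B: "\<And>\<kappa>. B (fbasis \<kappa>) = fscale (\<beta> \<kappa>) (fbasis \<kappa>)"
  shows "lk (tens_op M id A B x) (\<nu>, \<kappa>) = mscale (M \<nu>) (\<beta> \<kappa>) (A \<nu> (lk x (\<nu>, \<kappa>)))"
proof -
  let ?f = "\<lambda>(\<nu>, \<kappa>) y. mscale (M \<nu>) (\<beta> \<kappa>) (A \<nu> y)"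
  have sum: "(\<lambda>(\<nu>, \<kappa>). tens M (id \<nu>) (A \<nu> (lk x (\<nu>, \<kappa>))) (B (fbasis \<kappa>))) = (\<lambda>k. sgl k (?f k (lk x k)))"
    by (auto simp: fun_eq_iff B)
  have "finite {k. ?f k (lk x k) \<noteq> 0}"
    by (rule finite_lookup_image) (auto simp: assms(1))
  then have "lk (Sum_any (\<lambda>k. sgl k (?f k (lk x k)))) (\<nu>, \<kappa>) = ?f (\<nu>, \<kappa>) (lk x (\<nu>, \<kappa>))"
    by (rule lookup_Sum_any_single)
  then show ?thesis
    unfolding tens_op_def sum by simp
qed

lemma lookup_tens_op_id:
  assumes "\<And>\<nu>. A \<nu> 0 = 0"
  shows "lk (tens_op M id A id x) (\<nu>, \<kappa>) = A \<nu> (lk x (\<nu>, \<kappa>))"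
  using lookup_tens_op_diagonal[of A id "\<lambda>_. 1"] assms by simp

section \<open>The action on pure tensors\<close>

abbreviation U :: "'v total sp4_ops" where
  "U \<equiv> sp4_action M \<sigma>"

abbreviation q_power_b0 :: "int \<Rightarrow> fock \<Rightarrow> fock" where
  "q_power_b0 s \<equiv> flinear (\<lambda>(n, \<mu>). fscale (q powi (s * n)) (fbasis (n, \<mu>)))"

lemma q_power_b0_basis: "q_power_b0 s (fbasis \<kappa>) = fscale (q powi (s * fst \<kappa>)) (fbasis \<kappa>)"
  by (cases \<kappa>) simp

lemma lookup_wx1: "\<epsilon> \<in> {1, - 1} \<Longrightarrow> lk (wx U 1 \<epsilon> k x) (\<nu>, \<kappa>) = mx (M \<nu>) \<epsilon> k (lk x (\<nu>, \<kappa>))"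
  by (simp add: sp4_action_def lookup_tens_op_id linear_simps[OF V.endo_x])

lemma lookup_wK1: "lk (wK U 1 x) (\<nu>, \<kappa>) = mt (M \<nu>) 1 (lk x (\<nu>, \<kappa>))"
  by (simp add: sp4_action_def lookup_tens_op_id linear_simps[OF V.endo_t])

lemma lookup_wK2: "lk (wK U 2 x) (\<nu>, \<kappa>) = mscale (M \<nu>) (q powi (- fst \<kappa>)) (inv (mt (M \<nu>) 1) (lk x (\<nu>, \<kappa>)))"
proof -
  have "wK U 2 = tens_op M id (\<lambda>\<nu>. inv (mt (M \<nu>) 1)) (q_power_b0 (- 1))"
    by (simp add: sp4_action_def)
  then show ?thesis
    using lookup_tens_op_diagonal[of "\<lambda>\<nu>. inv (mt (M \<nu>) 1)" "q_power_b0 (- 1)", OF _ q_power_b0_basis]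
    by (simp add: linear_simps[OF V.endo_inv_t])
qed

lemma wg_eq: "wg U = tscale M q" and wscale_eq [simp]: "wscale U = tscale M"
  by (simp_all add: sp4_action_def)

lemma lookup_inv_wK1: "lk (inv (wK U 1) x) (\<nu>, \<kappa>) = inv (mt (M \<nu>) 1) (lk x (\<nu>, \<kappa>))"
proof -
  let ?G = "tens_op M id (\<lambda>\<nu>. inv (mt (M \<nu>) 1)) id"
  have G: "lk (?G x) (\<nu>, \<kappa>) = inv (mt (M \<nu>) 1) (lk x (\<nu>, \<kappa>))" for x \<nu> \<kappa>
    by (simp add: lookup_tens_op_id linear_simps[OF V.endo_inv_t])
  have "inv (wK U 1) = ?G"
    by (rule inv_equality; rule poly_mapping_eqI; simp add: lookup_wK1 G split_paired_all)
  then show ?thesis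
    by (simp add: G)
qed

lemma lookup_inv_wK2: "lk (inv (wK U 2) x) (\<nu>, \<kappa>) = mscale (M \<nu>) (q powi fst \<kappa>) (mt (M \<nu>) 1 (lk x (\<nu>, \<kappa>)))"
proof -
  define G where "G = tens_op M id (\<lambda>\<nu>. mt (M \<nu>) 1) (q_power_b0 1)"
  have G: "lk (G x) (\<nu>, \<kappa>) = mscale (M \<nu>) (q powi fst \<kappa>) (mt (M \<nu>) 1 (lk x (\<nu>, \<kappa>)))" for x \<nu> \<kappa>
    using lookup_tens_op_diagonal[of "\<lambda>\<nu>. mt (M \<nu>) 1" "q_power_b0 1", OF _ q_power_b0_basis]
    by (simp add: G_def linear_simps[OF V.endo_t])
  have "inv (wK U 2) = G"
    by (rule inv_equality; rule poly_mapping_eqI;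
        simp add: lookup_wK2 G split_paired_all linear_simps[OF V.endo_t] linear_simps[OF V.endo_inv_t] power_int_minus)
  then show ?thesis
    by (simp add: G)
qed

lemma inv_wg: "inv (wg U) = tscale M (inverse q)"
  by (rule inv_equality) (simp_all add: wg_eq)

lemma sgl_eqI: "(\<And>\<kappa>' \<nu>'. lk y (\<nu>', \<kappa>') = (if (\<nu>', \<kappa>') = (\<nu>, \<kappa>) then x else 0)) \<Longrightarrow> y = sgl (\<nu>, \<kappa>) x"
  by (rule poly_mapping_eqI) (auto simp: lookup_single when_def split: if_splits)

lemma action_single:
  "\<epsilon> \<in> {1, - 1} \<Longrightarrow> wx U 1 \<epsilon> k (sgl (\<nu>, \<kappa>) x) = sgl (\<nu>, \<kappa>) (mx (M \<nu>) \<epsilon> k x)"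
  "wK U 1 (sgl (\<nu>, \<kappa>) x) = sgl (\<nu>, \<kappa>) (mt (M \<nu>) 1 x)"
  "inv (wK U 1) (sgl (\<nu>, \<kappa>) x) = sgl (\<nu>, \<kappa>) (inv (mt (M \<nu>) 1) x)"
  "wK U 2 (sgl (\<nu>, \<kappa>) x) = sgl (\<nu>, \<kappa>) (mscale (M \<nu>) (q powi (- fst \<kappa>)) (inv (mt (M \<nu>) 1) x))"
  "inv (wK U 2) (sgl (\<nu>, \<kappa>) x) = sgl (\<nu>, \<kappa>) (mscale (M \<nu>) (q powi fst \<kappa>) (mt (M \<nu>) 1 x))"
  by (rule sgl_eqI; auto simp: lookup_wx1 lookup_wK1 lookup_wK2 lookup_inv_wK1 lookup_inv_wK2
      lookup_single when_def linear_simps[OF V.endo_x] linear_simps[OF V.endo_t] linear_simps[OF V.endo_inv_t])+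

lemma wa2: "wa U 2 l x = tscale M (- (1 / qint 2))
   (wa U 1 l x + tscale M (qint (2 * \<bar>l\<bar>)) (tens_op M id (\<lambda>\<nu>. id) (heis l) x))"
  by (simp add: sp4_action_def)

lemma wx2: "wx U 2 1 k = Yplus M \<sigma> k" "wx U 2 (- 1) k = Yminus M \<sigma> k"
  by (simp_all add: sp4_action_def)

lemma tens_vac: "tens M \<nu> x (fvac n) = sgl (\<nu>, n, {#}) x"
  by (simp add: fvac_def)

text \<open>
  In a product of two series with lowest exponents \<open>h\<close> and \<open>n\<close>, only the two lowest terms contribute to \<open>z\<^bsup>h+n\<^esup>\<close>.
\<close>
lemma leading_term:
  fixes f :: "int \<Rightarrow> 'v"
  assumes f: "\<And>r. r < h \<Longrightarrow> f r = 0" and g: "\<And>r. r < n \<Longrightarrow> g r = 0"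
  shows "s < h + n \<Longrightarrow> Sum_any (\<lambda>r. tens M \<nu> (f r) (g (s - r))) = 0"
    and "s = h + n \<Longrightarrow> Sum_any (\<lambda>r. tens M \<nu> (f r) (g (s - r))) = tens M \<nu> (f h) (g n)"
proof -
  show "Sum_any (\<lambda>r. tens M \<nu> (f r) (g (s - r))) = 0" if "s < h + n"
  proof -
    have "tens M \<nu> (f r) (g (s - r)) = 0" for r
      using that f[of r] g[of "s - r"] by (cases "r < h"; cases "s - r < n") auto
    then show ?thesis by simp
  qed
  have sum: "(\<lambda>r. tens M \<nu> (f r) (g (h + n - r))) = (\<lambda>r. if r = h then tens M \<nu> (f h) (g n) else 0)"
  proof
    fix r
    show "tens M \<nu> (f r) (g (h + n - r)) = (if r = h then tens M \<nu> (f h) (g n) else 0)"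
      using f[of r] g[of "h + n - r"] by (cases r h rule: linorder_cases) auto
  qed
  show "Sum_any (\<lambda>r. tens M \<nu> (f r) (g (s - r))) = tens M \<nu> (f h) (g n)" if "s = h + n"
    unfolding that sum by simp
qed

lemma Yminus_leading:
  assumes t: "mt (M \<nu>) 1 x = mscale (M \<nu>) (q powi h) x"
    and a: "\<And>k. 0 < k \<Longrightarrow> ma (M (swap_wt \<nu>)) (int k) (D_half M \<sigma> \<nu> x) = 0"
  shows "2 * (- k - 1) < h + n \<Longrightarrow> Yminus M \<sigma> k (sgl (\<nu>, n, {#}) x) = 0"
    and "2 * (- k - 1) = h + n \<Longrightarrow>
      Yminus M \<sigma> k (sgl (\<nu>, n, {#}) x) = sgl (swap_wt \<nu>, n + 2, {#}) (D_half M \<sigma> \<nu> x)"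
proof -
  have Y: "Yminus M \<sigma> k (sgl (\<nu>, n, {#}) x) =
      Sum_any (\<lambda>r. tens M (swap_wt \<nu>) (Phi0 M \<sigma> \<nu> r x) (Omega0 (2 * (- k - 1) - r) (fvac n)))"
    by (simp add: Yminus_def tens_op_single fvac_def)
  note leading = leading_term[of h "\<lambda>r. Phi0 M \<sigma> \<nu> r x" n "\<lambda>r. Omega0 r (fvac n)",
      OF Phi0_leading(1)[OF t a] Omega0_vac(1)]
  show "2 * (- k - 1) < h + n \<Longrightarrow> Yminus M \<sigma> k (sgl (\<nu>, n, {#}) x) = 0"
    unfolding Y by (rule leading(1))
  assume k: "2 * (- k - 1) = h + n"
  show "Yminus M \<sigma> k (sgl (\<nu>, n, {#}) x) = sgl (swap_wt \<nu>, n + 2, {#}) (D_half M \<sigma> \<nu> x)"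
    unfolding Y
    by (subst leading(2)[OF _ _ _ k]) (simp_all only: Phi0_leading(2)[OF t a] Omega0_vac(2) tens_vac)
qed

lemma Yplus_vac:
  assumes c: "int c = wt_eval \<nu> 0"
  shows "2 * (- k - 1) < - wt_eval \<nu> 1 - n \<Longrightarrow> Yplus M \<sigma> k (sgl (\<nu>, n, {#}) (vac \<nu>)) = 0"
    and "2 * (- k - 1) = - wt_eval \<nu> 1 - n \<Longrightarrow>
      \<exists>a. a \<noteq> 0 \<and> Yplus M \<sigma> k (sgl (\<nu>, n, {#}) (vac \<nu>)) =
        sgl (swap_wt \<nu>, n - 2, {#}) (mscale (M (swap_wt \<nu>)) a (V.f_string (swap_wt \<nu>) 1 c))"
proof -
  let ?f = "\<lambda>r. mscale (M (swap_wt \<nu>)) (q powi (- r)) (Psi2 M \<sigma> \<nu> r (vac \<nu>))"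
  have Y: "Yplus M \<sigma> k (sgl (\<nu>, n, {#}) (vac \<nu>)) =
      Sum_any (\<lambda>r. tens M (swap_wt \<nu>) (?f r) (Omega2 (2 * (- k - 1) - r) (fvac n)))"
    by (simp add: Yplus_def tens_op_single fvac_def)
  have f: "?f r = 0" if "r < - wt_eval \<nu> 1" for r
    using Psi2_vac(1)[OF c that] by simp
  note leading = leading_term[of "- wt_eval \<nu> 1" ?f "- n" "\<lambda>r. Omega2 r (fvac n)", OF f Omega2_vac(1)]
  show "2 * (- k - 1) < - wt_eval \<nu> 1 - n \<Longrightarrow> Yplus M \<sigma> k (sgl (\<nu>, n, {#}) (vac \<nu>)) = 0"
    unfolding Y by (rule leading(1)) simp_all
  assume k: "2 * (- k - 1) = - wt_eval \<nu> 1 - n"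
  obtain a where a: "a \<noteq> 0" "Psi2 M \<sigma> \<nu> (- wt_eval \<nu> 1) (vac \<nu>) = mscale (M (swap_wt \<nu>)) a (V.f_string (swap_wt \<nu>) 1 c)"
    using Psi2_vac(2)[OF c] by blast
  have "Yplus M \<sigma> k (sgl (\<nu>, n, {#}) (vac \<nu>)) =
      tens M (swap_wt \<nu>) (?f (- wt_eval \<nu> 1)) (Omega2 (- n) (fvac n))"
    unfolding Y using k by (intro leading(2)) simp_all
  also have "\<dots> = sgl (swap_wt \<nu>, n - 2, {#})
      (mscale (M (swap_wt \<nu>)) (q powi wt_eval \<nu> 1 * a) (V.f_string (swap_wt \<nu>) 1 c))"
    by (simp add: Omega2_vac(2) tens_vac a)
  finally show "\<exists>a. a \<noteq> 0 \<and> Yplus M \<sigma> k (sgl (\<nu>, n, {#}) (vac \<nu>)) =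
        sgl (swap_wt \<nu>, n - 2, {#}) (mscale (M (swap_wt \<nu>)) a (V.f_string (swap_wt \<nu>) 1 c))"
    using a(1) by (intro exI[of _ "q powi wt_eval \<nu> 1 * a"]) simp
qed

section \<open>The spaces \<open>\<V>(j)\<close> are submodules\<close>

lemma V_space_iff: "x \<in> V_space j \<longleftrightarrow> (\<forall>\<nu> n \<mu>. lk x (\<nu>, n, \<mu>) \<noteq> 0 \<longrightarrow> (\<nu>, n) \<in> sectors j)"
  unfolding V_space_def Ball_def split_paired_All by (simp add: in_keys_iff)

lemma V_space_closed:
  "0 \<in> V_space j" "x \<in> V_space j \<Longrightarrow> y \<in> V_space j \<Longrightarrow> x + y \<in> V_space j"
  "x \<in> V_space j \<Longrightarrow> tscale M c x \<in> V_space j"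
  by (auto simp: V_space_iff lookup_add) (metis add.right_neutral)

lemma V_space_pointwise:
  assumes "x \<in> V_space j" "\<And>\<nu> \<kappa>. lk x (\<nu>, \<kappa>) = 0 \<Longrightarrow> lk y (\<nu>, \<kappa>) = 0"
  shows "y \<in> V_space j"
  using assms unfolding V_space_iff by metis

lemma sectors_iff: "(\<nu>, n) \<in> sectors j \<longleftrightarrow> (if j = 0 then (\<nu> = TwoL0 \<and> 4 dvd n) \<or> (\<nu> = TwoL1 \<and> 4 dvd (n - 2))
      else if j = 1 then \<nu> = L0L1 \<and> odd n
      else (\<nu> = TwoL1 \<and> 4 dvd n) \<or> (\<nu> = TwoL0 \<and> 4 dvd (n - 2)))"
  by (auto simp: sectors_def elim!: evenE oddE) presburger+

lemma sectors_swap: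
  assumes "(\<nu>, n) \<in> sectors j"
  shows "(swap_wt \<nu>, n + 2) \<in> sectors j" "(swap_wt \<nu>, n - 2) \<in> sectors j"
proof -
  have "4 dvd n + 2 \<longleftrightarrow> 4 dvd n - 2" "4 dvd n - 2 - 2 \<longleftrightarrow> 4 dvd n"
    by presburger+
  then show "(swap_wt \<nu>, n + 2) \<in> sectors j" "(swap_wt \<nu>, n - 2) \<in> sectors j"
    using assms unfolding sectors_iff by (cases \<nu>; simp split: if_splits)+
qed

lemma tens_op_V_space:
  assumes x: "x \<in> V_space j" and A: "\<And>\<nu>. A \<nu> 0 = 0"
    and B: "\<And>n \<mu>. B (fbasis (n, \<mu>)) \<in> fock_sector (t n)"
    and g: "\<And>\<nu> n. (\<nu>, n) \<in> sectors j \<Longrightarrow> (g \<nu>, t n) \<in> sectors j"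
  shows "tens_op M g A B x \<in> V_space j"
  unfolding tens_op_def
proof (rule Sum_any_mem[OF V_space_closed(1,2)])
  fix k :: "wt \<times> fock_index"
  obtain \<nu> n \<mu> where k: "k = (\<nu>, n, \<mu>)"
    by (cases k) auto
  show "(case k of (\<nu>, \<kappa>) \<Rightarrow> tens M (g \<nu>) (A \<nu> (lk x (\<nu>, \<kappa>))) (B (fbasis \<kappa>))) \<in> V_space j"
  proof (cases "lk x k = 0")
    case True
    then show ?thesis by (simp add: k A V_space_closed)
  next
    case False
    then have "(g \<nu>, t n) \<in> sectors j"
      using x g by (auto simp: V_space_iff k)
    then show ?thesis
      using keys_tens[of "g \<nu>" "A \<nu> (lk x (\<nu>, n, \<mu>))" "B (fbasis (n, \<mu>))"] B[of n \<mu>]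
      by (force simp: k V_space_def fock_sector_def)
  qed
qed

lemma submodule_V_space: "sp4_submodule U (V_space j)"
proof -
  have subspace: "T.subspace (V_space j)"
    by (intro T.subspaceI V_space_closed)
  have wx: "wx U i \<epsilon> k x \<in> V_space j" if x: "x \<in> V_space j" and i: "i \<in> {1, 2}" and \<epsilon>: "\<epsilon> \<in> {1, - 1}" for i \<epsilon> k x
  proof -
    consider "i = 1" | "i = 2" "\<epsilon> = 1" | "i = 2" "\<epsilon> = - 1"
      using i \<epsilon> by auto
    then show ?thesis
    proof cases
      case 1
      then show ?thesis
        using \<epsilon> by (intro V_space_pointwise[OF x]) (simp add: lookup_wx1 linear_simps[OF V.endo_x])
    next
      case 2
      have "Yplus M \<sigma> k x \<in> V_space j"
        unfolding Yplus_def
        by (intro Sum_any_mem[OF V_space_closed(1,2)] tens_op_V_space[where t = "\<lambda>n. n - 2"] x)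
          (simp_all add: Omega_fock_sector sectors_swap)
      then show ?thesis
        by (simp add: 2 wx2)
    next
      case 3
      have "Yminus M \<sigma> k x \<in> V_space j"
        unfolding Yminus_def
        by (intro Sum_any_mem[OF V_space_closed(1,2)] tens_op_V_space[where t = "\<lambda>n. n + 2"] x)
          (simp_all add: Omega_fock_sector sectors_swap)
      then show ?thesis
        by (simp add: 3 wx2)
    qed
  qed
  have wa1: "wa U 1 l x \<in> V_space j" if "x \<in> V_space j" "l \<noteq> 0" for l x
    using that by (intro V_space_pointwise[OF that(1)]) (simp add: sp4_action_def lookup_tens_op_id linear_simps[OF V.endo_a])
  have wa2: "wa U 2 l x \<in> V_space j" if "x \<in> V_space j" "l \<noteq> 0" for l x
    unfolding wa2 using that
    by (intro V_space_closed wa1 tens_op_V_space[where t = id]) (simp_all add: heis_fock_sector)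
  have wK: "wK U i x \<in> V_space j" "inv (wK U i) x \<in> V_space j" if x: "x \<in> V_space j" and i: "i \<in> {1, 2}" for i x
  proof -
    consider "i = 1" | "i = 2"
      using i by auto
    then show "wK U i x \<in> V_space j" "inv (wK U i) x \<in> V_space j"
      by (cases; intro V_space_pointwise[OF x];
          simp add: lookup_wK1 lookup_wK2 lookup_inv_wK1 lookup_inv_wK2 linear_simps[OF V.endo_t] linear_simps[OF V.endo_inv_t])+
  qed
  show ?thesis
    unfolding sp4_submodule_def wscale_eq
  proof (intro conjI ballI allI impI)
    fix x :: "'v total" assume x: "x \<in> V_space j"
    show "wg U x \<in> V_space j" "inv (wg U) x \<in> V_space j"
      using x by (simp_all only: inv_wg V_space_closed) (simp only: wg_eq V_space_closed)
    fix i :: nat assume i: "i \<in> {1, 2}"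
    show "wx U i \<epsilon> k x \<in> V_space j" if "\<epsilon> \<in> {1, - 1}" for \<epsilon> k
      using wx[OF x i that] .
    show "wK U i x \<in> V_space j" "inv (wK U i) x \<in> V_space j"
      using wK[OF x i] .
    show "wa U i l x \<in> V_space j" if "l \<noteq> 0" for l
      using wa1[OF x that] wa2[OF x that] i by auto
  qed (rule subspace)
qed

section \<open>The highest weight vectors generate\<close>

context
  fixes W assumes W: "sp4_submodule U W"
begin

lemma W_subspace: "T.subspace W"
  and W_wx: "i \<in> {1, 2} \<Longrightarrow> \<epsilon> \<in> {1, - 1} \<Longrightarrow> x \<in> W \<Longrightarrow> wx U i \<epsilon> k x \<in> W"
  and W_wa: "i \<in> {1, 2} \<Longrightarrow> l \<noteq> 0 \<Longrightarrow> x \<in> W \<Longrightarrow> wa U i l x \<in> W"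
  and W_wK: "i \<in> {1, 2} \<Longrightarrow> x \<in> W \<Longrightarrow> wK U i x \<in> W"
  using W unfolding sp4_submodule_def wscale_eq by blast+

lemma W_single_scale:
  assumes "sgl (\<nu>, \<kappa>) (mscale (M \<nu>) a x) \<in> W" "a \<noteq> 0"
  shows "sgl (\<nu>, \<kappa>) x \<in> W"
  using T.subspace_scale[OF W_subspace assms(1), of "1 / a"] assms(2) by simp

text \<open>
  \<open>1 \<otimes> b(l)\<close> is a linear combination of \<open>a\<^sub>1(l)\<close> and \<open>a\<^sub>2(l)\<close>.
\<close>
lemma W_heis:
  assumes "l \<noteq> 0" "x \<in> W"
  shows "tens_op M id (\<lambda>\<nu>. id) (heis l) x \<in> W"
proof -
  let ?z = "tens_op M id (\<lambda>\<nu>. id) (heis l) x"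
  have "tscale M (- qint 2) (wa U 2 l x) - wa U 1 l x \<in> W"
    using assms by (intro T.subspace_diff T.subspace_scale W_subspace W_wa) auto
  also have "tscale M (- qint 2) (wa U 2 l x) - wa U 1 l x = tscale M (qint (2 * \<bar>l\<bar>)) ?z"
    by (simp add: wa2)
  finally have "tscale M (1 / qint (2 * \<bar>l\<bar>)) (tscale M (qint (2 * \<bar>l\<bar>)) ?z) \<in> W"
    by (rule T.subspace_scale[OF W_subspace])
  then show ?thesis
    using assms(1) by simp
qed

text \<open>
  \<open>f\<^sub>1 = x\<^sup>-(0)\<close> and \<open>f\<^sub>0 = q\<^sup>-\<^sup>2 K x\<^sup>+(-1)\<close> produce \<open>V(\<nu>)\<close> from \<open>v\<^sub>\<nu>\<close>, and the \<open>b(-l)\<close> produce \<open>\<V>\<^bsub>n/2\<^esub>\<close> from its vacuum.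
\<close>
lemma W_sector:
  assumes "sgl (\<nu>, n, {#}) (vac \<nu>) \<in> W"
  shows "sgl (\<nu>, n, \<mu>) x \<in> W"
proof (induction \<mu>)
  case empty
  have "x \<in> {x. sgl (\<nu>, n, {#}) x \<in> W}"
  proof (rule V.subspace_eq_UNIV[of \<nu>])
    show "V.subspace \<nu> {x. sgl (\<nu>, n, {#}) x \<in> W}"
      using T.subspace_0[OF W_subspace] T.subspace_add[OF W_subspace]
        T.subspace_scale[OF W_subspace, of "sgl (\<nu>, n, {#}) _"]
      by (intro V.subspaceI) (auto simp: single_add)
    fix i :: nat and x assume i: "i \<in> {0, 1}" and "x \<in> {x. sgl (\<nu>, n, {#}) x \<in> W}"
    then have x: "sgl (\<nu>, n, {#}) x \<in> W"
      by simp
    have "sgl (\<nu>, n, {#}) (mx (M \<nu>) (- 1) 0 x) \<in> W" "sgl (\<nu>, n, {#}) (mx (M \<nu>) 1 (- 1) x) \<in> W"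
      using W_wx[OF _ _ x, of 1 "- 1" 0] W_wx[OF _ _ x, of 1 1 "- 1"] by (simp_all add: action_single)
    moreover from this(2) have "sgl (\<nu>, n, {#}) (mt (M \<nu>) 1 (mx (M \<nu>) 1 (- 1) x)) \<in> W"
      using W_wK[of 1] by (simp flip: action_single(2))
    from T.subspace_scale[OF W_subspace this, of "inverse (q\<^sup>2)"]
    have "sgl (\<nu>, n, {#}) (mf (M \<nu>) 0 x) \<in> W"
      by (simp add: V.f0_drinfeld)
    ultimately show "mf (M \<nu>) i x \<in> {x. sgl (\<nu>, n, {#}) x \<in> W}"
      using i by (auto simp: V.x_f1)
  qed (use assms in simp)
  then show ?case
    by simp
next
  case (add i \<mu>)
  have "tens_op M id (\<lambda>\<nu>. id) (heis (- int (Suc i))) (sgl (\<nu>, n, \<mu>) x) = sgl (\<nu>, n, add_mset i \<mu>) x"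
    by (simp add: tens_op_single heis_def nat_add_distrib)
  then show ?case
    using W_heis[OF _ add.IH, of "- int (Suc i)"] by simp
qed

text \<open>
  The lowest term of \<open>Y\<^sup>-(z) (f\<^sub>1\<^sup>c v\<^sub>\<nu> \<otimes> v(n/2))\<close> has exponent \<open>(n - c)/2\<close>, an integer by the parity condition.
\<close>
lemma W_next:
  assumes W: "sgl (\<nu>, n, {#}) (vac \<nu>) \<in> W" and even: "even (wt_eval \<nu> 1 + n)"
  shows "sgl (swap_wt \<nu>, n + 2, {#}) (vac (swap_wt \<nu>)) \<in> W"
proof -
  let ?\<nu> = "swap_wt \<nu>"
  define c where "c = nat (wt_eval \<nu> 1)"
  have c: "int c = wt_eval \<nu> 1"
    using wt_eval_nonneg[of \<nu> 1] by (simp add: c_def)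
  define x where "x = V.f_string \<nu> 1 c"
  have t: "mt (M \<nu>) 1 x = mscale (M \<nu>) (q powi (- int c)) x"
    using V.t_f_string[of 1 \<nu> c] c by (simp add: x_def)
  obtain k where k: "k \<noteq> 0" "D_half M \<sigma> \<nu> x = mscale (M ?\<nu>) k (vac ?\<nu>)"
    using D_half_f_string[OF c] unfolding x_def by blast
  have a: "ma (M ?\<nu>) (int r) (D_half M \<sigma> \<nu> x) = 0" if "0 < r" for r
    unfolding k(2) by (rule V.a_degree_0[OF V.d_multiple_vac that])
  obtain s where s: "wt_eval \<nu> 1 + n = 2 * s"
    using even by (rule evenE)
  have "Yminus M \<sigma> (int c - s - 1) (sgl (\<nu>, n, {#}) x) = sgl (?\<nu>, n + 2, {#}) (D_half M \<sigma> \<nu> x)"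
    using s c by (intro Yminus_leading(2)[OF t a]) auto
  moreover have "Yminus M \<sigma> (int c - s - 1) (sgl (\<nu>, n, {#}) x) \<in> W"
    using W_wx[OF _ _ W_sector[OF W], of 2 "- 1"] by (simp add: wx2)
  ultimately show ?thesis
    using W_single_scale k by simp
qed

text \<open>
  The lowest term of \<open>Y\<^sup>+(z) (v\<^sub>\<nu> \<otimes> v(n/2))\<close> contains the extremal vector of \<open>V(\<sigma>\<nu>)\<close>, from which powers of \<open>e\<^sub>1\<close> lead
  back to the highest weight vector.
\<close>
lemma W_previous:
  assumes W: "sgl (\<nu>, n, {#}) (vac \<nu>) \<in> W" and even: "even (wt_eval \<nu> 1 + n)"
  shows "sgl (swap_wt \<nu>, n - 2, {#}) (vac (swap_wt \<nu>)) \<in> W"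
proof -
  let ?\<nu> = "swap_wt \<nu>"
  define c where "c = nat (wt_eval \<nu> 0)"
  have c: "int c = wt_eval \<nu> 0"
    using wt_eval_nonneg[of \<nu> 0] by (simp add: c_def)
  obtain s where s: "wt_eval \<nu> 1 + n = 2 * s"
    using even by (rule evenE)
  obtain a where a: "a \<noteq> 0" "Yplus M \<sigma> (s - 1) (sgl (\<nu>, n, {#}) (vac \<nu>)) =
      sgl (?\<nu>, n - 2, {#}) (mscale (M ?\<nu>) a (V.f_string ?\<nu> 1 c))"
    using Yplus_vac(2)[OF c, of "s - 1" n] s by auto
  have "Yplus M \<sigma> (s - 1) (sgl (\<nu>, n, {#}) (vac \<nu>)) \<in> W"
    using W_wx[OF _ _ W, of 2 1] by (simp add: wx2)
  then have top: "sgl (?\<nu>, n - 2, {#}) (V.f_string ?\<nu> 1 c) \<in> W"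
    using W_single_scale a by simp
  have "sgl (?\<nu>, n - 2, {#}) (V.f_string ?\<nu> 1 (c - j)) \<in> W" if "j \<le> c" for j
    using that
  proof (induction j)
    case 0
    then show ?case using top by simp
  next
    case (Suc j)
    define i where "i = c - j"
    have i: "0 < i" "i \<le> c" "c - Suc j = i - 1"
      using Suc.prems by (auto simp: i_def)
    have "sgl (?\<nu>, n - 2, {#}) (me (M ?\<nu>) 1 (V.f_string ?\<nu> 1 i)) \<in> W"
      using W_wx[of 1 1 _ 0, OF _ _ Suc.IH] Suc.prems by (simp add: action_single V.x_e1 i_def)
    then have "sgl (?\<nu>, n - 2, {#}) (mscale (M ?\<nu>) (qint (int i) * qint (int c - int i + 1)) (V.f_string ?\<nu> 1 (i - 1))) \<in> W"
      using c by (simp add: V.e_f_string)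
    then show ?case
      unfolding i(3) by (rule W_single_scale) (use i in simp)
  qed
  from this[of c] show ?thesis
    by simp
qed

lemma W_chain:
  assumes W: "sgl (\<nu>, n, {#}) (vac \<nu>) \<in> W" and even: "even (wt_eval \<nu> 1 + n)"
    and \<nu>': "\<nu>' = (if even k then \<nu> else swap_wt \<nu>)"
  shows "sgl (\<nu>', n + 2 * k, {#}) (vac \<nu>') \<in> W"
  unfolding \<nu>'
proof (induction k rule: int_induct[where k = 0])
  case base
  then show ?case using W by simp
next
  case (step1 k)
  have "even (wt_eval (if even k then \<nu> else swap_wt \<nu>) 1 + (n + 2 * k))"
    using even by (cases \<nu>) auto
  from W_next[OF step1(2) this] show ?case
    by (cases "even k") (simp_all add: algebra_simps)
next
  case (step2 k)
  have "even (wt_eval (if even k then \<nu> else swap_wt \<nu>) 1 + (n + 2 * k))"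
    using even by (cases \<nu>) auto
  from W_previous[OF step2(2) this] show ?case
    by (cases "even k") (simp_all add: algebra_simps)
qed

lemma V_space_subset:
  assumes "\<And>\<nu> n. (\<nu>, n) \<in> sectors j \<Longrightarrow> sgl (\<nu>, n, {#}) (vac \<nu>) \<in> W"
  shows "V_space j \<subseteq> W"
proof
  fix x :: "'v total" assume x: "x \<in> V_space j"
  have "sgl k (lk x k) \<in> W" if k: "k \<in> Poly_Mapping.keys x" for k
  proof -
    obtain \<nu> n \<mu> where \<nu>: "k = (\<nu>, n, \<mu>)"
      by (cases k) auto
    have "lk x (\<nu>, n, \<mu>) \<noteq> 0"
      using k by (simp add: \<nu> in_keys_iff)
    then have "(\<nu>, n) \<in> sectors j"
      by (rule x[unfolded V_space_iff, THEN spec, THEN spec, THEN spec, THEN mp])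
    then show ?thesis
      unfolding \<nu> by (rule W_sector[OF assms])
  qed
  then have "(\<Sum>k\<in>Poly_Mapping.keys x. sgl k (lk x k)) \<in> W"
    by (intro T.subspace_sum[OF W_subspace])
  then show "x \<in> W"
    using poly_mapping_sum_single[of x] by simp
qed

end

lemma generated_V_space:
  assumes sector: "(\<nu>, n) \<in> sectors j" and even: "even (wt_eval \<nu> 1 + n)"
    and chain: "\<And>\<nu>' n'. (\<nu>', n') \<in> sectors j \<Longrightarrow> \<exists>k. n' = n + 2 * k \<and> \<nu>' = (if even k then \<nu> else swap_wt \<nu>)"
  shows "sp4_generated U (sgl (\<nu>, n, {#}) (vac \<nu>)) = V_space j"
proof
  have "sgl (\<nu>, n, {#}) (vac \<nu>) \<in> V_space j"
    using sector by (auto simp: V_space_iff lookup_single when_def split: if_splits)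
  then show "sp4_generated U (sgl (\<nu>, n, {#}) (vac \<nu>)) \<subseteq> V_space j"
    unfolding sp4_generated_def using submodule_V_space by blast
  show "V_space j \<subseteq> sp4_generated U (sgl (\<nu>, n, {#}) (vac \<nu>))"
    unfolding sp4_generated_def
  proof (rule Inter_greatest)
    fix W assume "W \<in> {W. sp4_submodule U W \<and> sgl (\<nu>, n, {#}) (vac \<nu>) \<in> W}"
    then have W: "sp4_submodule U W" "sgl (\<nu>, n, {#}) (vac \<nu>) \<in> W"
      by auto
    show "V_space j \<subseteq> W"
    proof (rule V_space_subset[OF W(1)])
      fix \<nu>' n' assume "(\<nu>', n') \<in> sectors j"
      then obtain k where "n' = n + 2 * k" "\<nu>' = (if even k then \<nu> else swap_wt \<nu>)"
        using chain by blast
      then show "sgl (\<nu>', n', {#}) (vac \<nu>') \<in> W"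
        using W_chain[OF W even] by simp
    qed
  qed
qed

section \<open>The highest weight conditions\<close>

lemma Yminus_zero [simp]: "Yminus M \<sigma> k 0 = 0"
  by (simp add: Yminus_def tens_op_def case_prod_unfold)

lemma wx1_zero [simp]: "\<epsilon> \<in> {1, - 1} \<Longrightarrow> wx U 1 \<epsilon> k 0 = 0"
  using action_single(1)[of \<epsilon> k undefined undefined 0] by (simp add: linear_simps[OF V.endo_x])

lemma x_1_vanish:
  assumes "mqd (M \<nu>) x = x"
  shows "wx U 1 (- 1) 1 (sgl (\<nu>, \<kappa>) x) = 0"
  using V.x_degree_0[OF assms, of "- 1" 1] by (simp add: action_single)

lemma D_half_scale: "D_half M \<sigma> \<nu> (mscale (M \<nu>) b x) = mscale (M (swap_wt \<nu>)) b (D_half M \<sigma> \<nu> x)"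
  by (rule linear_simps(3)[OF linear_D_half])

text \<open>
  Up to a factor, \<open>e\<^sub>0\<close> is a linear combination of products of \<open>x\<^sub>1\<^sup>-(0)\<close>, \<open>x\<^sub>2\<^sup>-(0)\<close> and \<open>x\<^sub>1\<^sup>-(1)\<close>. The vectors to which
  \<open>x\<^sub>1\<^sup>-(1)\<close> is applied are all 0 or of degree 0, so \<open>x\<^sub>1\<^sup>-(1)\<close>, which has degree 1, annihilates them.
\<close>
lemma e_0_vac:
  assumes cases: "(\<nu>, n) \<in> {(TwoL0, 0), (L0L1, - 1), (TwoL0, - 2)}"
  shows "sp4_e U 0 (sgl (\<nu>, n, {#}) (vac \<nu>)) = 0"
proof -
  let ?w = "wt_eval \<nu> 1"
  let ?X = "wx U 1 (- 1) 0" and ?Y = "wx U 2 (- 1) 0" and ?Z = "wx U 1 (- 1) 1"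
  obtain b where b: "inv (wK U 1) (inv (wK U 1) (inv (wK U 2) (sgl (\<nu>, n, {#}) (vac \<nu>)))) =
      sgl (\<nu>, n, {#}) (mscale (M \<nu>) b (vac \<nu>))"
    using V.inv_t_eigen[OF _ V.t_vac[of 1 \<nu>]]
    by (simp add: action_single V.t_vac linear_simps[OF V.endo_inv_t] del: scale_scale)
  define x where "x = mscale (M \<nu>) b (vac \<nu>)"
  have d: "mqd (M \<nu>) x = x" "mqd (M \<nu>) (mf (M \<nu>) 1 x) = mf (M \<nu>) 1 x"
    by (simp_all add: x_def V.d_multiple_vac V.df)
  have t: "mt (M \<nu>) 1 x = mscale (M \<nu>) (q powi ?w) x"
    by (simp add: x_def linear_simps[OF V.endo_t] V.t_vac mult.commute)
  let ?s = "sgl (\<nu>, n, {#}) x"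
  have X: "?X ?s = sgl (\<nu>, n, {#}) (mf (M \<nu>) 1 x)"
    by (simp add: action_single V.x_f1)
  have Z: "?Z ?s = 0" "?Z (?X ?s) = 0"
    unfolding X by (rule x_1_vanish d)+
  consider "\<nu> = TwoL0" "n = 0 \<or> n = - 2" | "\<nu> = L0L1" "n = - 1"
    using cases by auto
  then have ZY: "?Z (?Y ?s) = 0 \<and> ?Z (?Y (?X ?s)) = 0"
  proof cases
    case 1
    obtain k where "D_half M \<sigma> TwoL0 (V.f_string TwoL0 1 0) = mscale (M TwoL1) k (vac TwoL1)"
      using D_half_f_string[of 0 TwoL0] by auto
    then have D: "D_half M \<sigma> TwoL0 x = mscale (M TwoL1) (b * k) (vac TwoL1)"
      using 1 D_half_scale[of TwoL0] by (simp add: x_def)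
    have a: "ma (M (swap_wt TwoL0)) (int r) (D_half M \<sigma> TwoL0 x) = 0" if "0 < r" for r
      using V.a_degree_0[OF V.d_multiple_vac that] by (simp add: D)
    have t': "mt (M TwoL0) 1 x = mscale (M TwoL0) (q powi 0) x"
      using t 1 by simp
    have "?Z (?Y ?s) = 0"
    proof (cases "n = 0")
      case True
      then show ?thesis
        using 1 Yminus_leading(1)[OF t' a, of 0 0] by (simp add: wx2)
    next
      case False
      then have "?Y ?s = sgl (TwoL1, 0, {#}) (mscale (M TwoL1) (b * k) (vac TwoL1))"
        using 1 Yminus_leading(2)[OF t' a, of 0 "- 2"] by (simp add: wx2 D)
      then show ?thesis
        using x_1_vanish[OF V.d_multiple_vac] by simp
    qed
    moreover have "?X ?s = 0"
      unfolding X using 1 by (simp add: x_def linear_simps[OF V.endo_f] V.f_1_vac)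
    ultimately show ?thesis
      by (simp add: wx2)
  next
    case 2
    have "D_half M \<sigma> L0L1 x = mscale (M L0L1) (- b) (mf (M L0L1) 0 (vac L0L1))"
      using 2 D_half_scale[of L0L1] by (simp add: x_def D_half_vac_L0L1)
    then have a: "ma (M (swap_wt L0L1)) (int r) (D_half M \<sigma> L0L1 x) = 0" if "0 < r" for r
      using that by (simp add: linear_simps[OF V.endo_a] V.a_f0_vac)
    have t': "mt (M L0L1) 1 x = mscale (M L0L1) (q powi 1) x"
      using t 2 by simp
    have Y: "?Z (?Y ?s) = 0"
      using 2 Yminus_leading(1)[OF t' a, of 0 "- 1"] by (simp add: wx2)
    let ?y = "mf (M L0L1) 1 x"
    obtain k where "D_half M \<sigma> L0L1 (V.f_string L0L1 1 1) = mscale (M L0L1) k (vac L0L1)"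
      using D_half_f_string[of 1 L0L1] by auto
    then have D: "D_half M \<sigma> L0L1 ?y = mscale (M L0L1) (b * k) (vac L0L1)"
      using 2 D_half_scale[of L0L1] by (simp add: x_def linear_simps[OF V.endo_f])
    have a': "ma (M (swap_wt L0L1)) (int r) (D_half M \<sigma> L0L1 ?y) = 0" if "0 < r" for r
      using V.a_degree_0[OF V.d_multiple_vac that] by (simp add: D)
    have "mt (M L0L1) 1 ?y = mscale (M L0L1) (q powi (- 1)) ?y"
      using t' by (simp add: V.tf sl2_cartan_def linear_simps[OF V.endo_f] power_int_minus power2_eq_square)
    from Yminus_leading(2)[OF this a', of 0 "- 1"]
    have "?Y (?X ?s) = sgl (L0L1, 1, {#}) (mscale (M L0L1) (b * k) (vac L0L1))"
      unfolding X using 2 by (simp add: wx2 D)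
    then show ?thesis
      using Y x_1_vanish[OF V.d_multiple_vac] by simp
  qed
  have "?X 0 = 0" "?Y 0 = 0"
    by (simp_all add: wx2)
  then show ?thesis
    unfolding sp4_e_def b q_comm_def by (simp add: ZY Z flip: x_def)
qed

lemma highest_weight_module:
  assumes cases: "(\<nu>, n, j) \<in> {(TwoL0, 0, 0), (L0L1, - 1, 1), (TwoL0, - 2, 2)}"
  shows "sp4_highest_weight_module U (V_space j) j (tens M \<nu> (vac \<nu>) (fvac n))"
proof -
  let ?v = "sgl (\<nu>, n, {#}) (vac \<nu>)"
  have "?v \<noteq> 0"
    using V.vac_nonzero[of \<nu>] by (metis lookup_single_eq lookup_zero)
  moreover have "sp4_generated U ?v = V_space j"
  proof (rule generated_V_space)
    show "(\<nu>, n) \<in> sectors j" "even (wt_eval \<nu> 1 + n)"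
      using cases by (auto simp: sectors_iff)
    fix \<nu>' n' assume "(\<nu>', n') \<in> sectors j"
    then show "\<exists>k. n' = n + 2 * k \<and> \<nu>' = (if even k then \<nu> else swap_wt \<nu>)"
      using cases by (intro exI[of _ "(n' - n) div 2"]) (auto simp: sectors_def)
  qed
  moreover have "sp4_e U i ?v = 0" if "i \<in> {0, 1, 2}" for i
  proof -
    consider "i = 0" | "i = 1" | "i = 2"
      using \<open>i \<in> {0, 1, 2}\<close> by auto
    then show ?thesis
    proof cases
      case 1
      then show ?thesis
        using e_0_vac[of \<nu> n] cases by auto
    next
      case 2
      then show ?thesis
        by (simp add: sp4_e_def action_single V.x_e1 V.e_vac)
    next
      case 3
      have "Yplus M \<sigma> 0 ?v = 0"
        using cases by (intro Yplus_vac(1)[of "nat (wt_eval \<nu> 0)"]) (auto simp: wt_eval_nonneg)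
      then show ?thesis
        using 3 by (simp add: sp4_e_def wx2)
    qed
  qed
  moreover have "sp4_t U i ?v = tscale M (sp4_q i ^ (if i = j then 1 else 0)) ?v" if "i \<in> {0, 1, 2}" for i
  proof -
    let ?w = "wt_eval \<nu> 1"
    have t: "mt (M \<nu>) 1 (vac \<nu>) = mscale (M \<nu>) (q powi ?w) (vac \<nu>)"
      "inv (mt (M \<nu>) 1) (vac \<nu>) = mscale (M \<nu>) (q powi (- ?w)) (vac \<nu>)"
      using V.inv_t_eigen[OF _ V.t_vac[of 1 \<nu>]] by (simp_all add: V.t_vac)
    have "sp4_t U 0 ?v = sgl (\<nu>, n, {#}) (mscale (M \<nu>) (q powi (2 + n - ?w)) (vac \<nu>))"
      by (simp add: sp4_t_def action_single t linear_simps[OF V.endo_t] linear_simps[OF V.endo_inv_t] wg_eq power_int_add power_int_diff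
          power_int_minus power2_eq_square field_simps)
    moreover have "sp4_t U 1 ?v = sgl (\<nu>, n, {#}) (mscale (M \<nu>) (q powi ?w) (vac \<nu>))"
      by (simp add: sp4_t_def action_single t)
    moreover have "sp4_t U 2 ?v = sgl (\<nu>, n, {#}) (mscale (M \<nu>) (q powi (- n - ?w)) (vac \<nu>))"
      by (simp add: sp4_t_def action_single t power_int_minus power_int_diff field_simps)
    moreover have "i = 0 \<or> i = 1 \<or> i = 2"
      using \<open>i \<in> {0, 1, 2}\<close> by auto
    ultimately show ?thesis
      using cases by (auto simp: sp4_q_def)
  qed
  ultimately show ?thesis
    unfolding sp4_highest_weight_module_def tens_vac using submodule_V_space by simp
qed

end

theorem theorem6p2:
  fixes M :: "wt \<Rightarrow> 'v::ab_group_add sl2_ops"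
    and vac :: "wt \<Rightarrow> 'v"
    and \<sigma> :: "wt \<Rightarrow> 'v \<Rightarrow> 'v"
  assumes "\<And>\<nu>. irreducible_hw_module (M \<nu>) \<nu> (vac \<nu>)"
    and "diagram_map M vac \<sigma>"
  shows "sp4_highest_weight_module (sp4_action M \<sigma>) (V_space 0) 0
           (tens M TwoL0 (vac TwoL0) (fvac 0)) \<and>
         sp4_highest_weight_module (sp4_action M \<sigma>) (V_space 1) 1
           (tens M L0L1 (vac L0L1) (fvac (- 1))) \<and>
         sp4_highest_weight_module (sp4_action M \<sigma>) (V_space 2) 2
           (tens M TwoL0 (vac TwoL0) (fvac (- 2)))"
proof -
  interpret hw_family M vac \<sigma>
    using assms by unfold_locales
  show ?thesis
    using highest_weight_module by simp
qed

end
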